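(* Let $m\ge1$, let $z_1,\dots,z_m\in\mathbf{R}^2$ be distinct points and let $n_1,\dots,n_m$ be positive integers. For all $q>0$ and $\kappa>0$ there exists a smooth topological solution $(\phi,A,N)$ of the Bogomol'nyi equations $$A_0=-N,\qquad (D_1+iD_2)\phi=0,\qquad F_{12}+(q|\phi|^2+\kappa N-q)=0,$$ $$\Delta A_0=\kappa q(1-|\phi|^2)+\kappa^2A_0+2q^2|\phi|^2A_0$$ on $\mathbf{R}^2$ such that $\phi=0$ at each $z_j$ with corresponding winding number $n_j$, $j=1,\dots,m$, and $$0\le \frac{\kappa}{q}N=-\frac{\kappa}{q}A_0\le 1-|\phi|^2\quad\text{on }\mathbf{R}^2 .$$
   Context: The unknowns are static fields on $\mathbf{R}^2$: a complex-valued function $\phi$, a real-valued function $N$, and real-valued functions $A=(A_0,A_1,A_2)$. Notation: $\partial_j=\partial/\partial x_j$, $D_j=\partial_j-iqA_j$ for $j=1,2$, and $F_{12}=\partial_1A_2-\partial_2A_1$. A solution is called topological if $|\phi|^2\to1$ and $N=-A_0\to0$ as $|x|\to\infty$. That $\phi$ vanishes at $z_j$ with winding number $n_j$ means that $z_j$ is an isolated zero of $\phi$ and that $\phi/|\phi|$ restricted to small positively oriented circles centered at $z_j$ has degree $n_j$. *)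

theory Defs
  imports "HOL-Complex_Analysis.Winding_Numbers"
begin

primrec times_cont_differentiable ::
  "nat \<Rightarrow> ('a::real_normed_vector \<Rightarrow> 'b::real_normed_vector) \<Rightarrow> bool" where
  "times_cont_differentiable 0 f \<longleftrightarrow> continuous_on UNIV f"
| "times_cont_differentiable (Suc k) f \<longleftrightarrow>
     (\<forall>x. f differentiable (at x)) \<and>
     (\<forall>v. times_cont_differentiable k (\<lambda>x. frechet_derivative f (at x) v))"

definition smooth :: "('a::real_normed_vector \<Rightarrow> 'b::real_normed_vector) \<Rightarrow> bool" where
  "smooth f \<longleftrightarrow> (\<forall>k. times_cont_differentiable k f)"

definition partial :: "2 \<Rightarrow> (real^2 \<Rightarrow> 'a::real_normed_vector) \<Rightarrow> real^2 \<Rightarrow> 'a" where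
  "partial j f x = vector_derivative (\<lambda>t. f (x + t *\<^sub>R axis j 1)) (at 0)"

definition laplacian :: "(real^2 \<Rightarrow> real) \<Rightarrow> real^2 \<Rightarrow> real" where
  "laplacian f x = partial 1 (partial 1 f) x + partial 2 (partial 2 f) x"

text \<open>The covariant derivative \<open>D\<^sub>j = \<partial>\<^sub>j - i q A\<^sub>j\<close>, where \<open>a\<close> is the component \<open>A\<^sub>j\<close>.\<close>

definition cov_deriv ::
  "real \<Rightarrow> (real^2 \<Rightarrow> real) \<Rightarrow> 2 \<Rightarrow> (real^2 \<Rightarrow> complex) \<Rightarrow> real^2 \<Rightarrow> complex" where
  "cov_deriv q a j \<phi> x = partial j \<phi> x - \<i> * of_real (q * a x) * \<phi> x"

definition curvature :: "(real^2 \<Rightarrow> real) \<Rightarrow> (real^2 \<Rightarrow> real) \<Rightarrow> real^2 \<Rightarrow> real" where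
  "curvature A1 A2 x = partial 1 A2 x - partial 2 A1 x"

definition bogomolnyi ::
  "real \<Rightarrow> real \<Rightarrow> (real^2 \<Rightarrow> complex) \<Rightarrow> (real^2 \<Rightarrow> real) \<Rightarrow> (real^2 \<Rightarrow> real) \<Rightarrow> (real^2 \<Rightarrow> real) \<Rightarrow>
   (real^2 \<Rightarrow> real) \<Rightarrow> bool" where
  "bogomolnyi q \<kappa> \<phi> A0 A1 A2 N \<longleftrightarrow>
     (\<forall>x. A0 x = - N x \<and>
          cov_deriv q A1 1 \<phi> x + \<i> * cov_deriv q A2 2 \<phi> x = 0 \<and>
          curvature A1 A2 x + (q * (cmod (\<phi> x))\<^sup>2 + \<kappa> * N x - q) = 0 \<and>
          laplacian A0 x =
            \<kappa> * q * (1 - (cmod (\<phi> x))\<^sup>2) + \<kappa>\<^sup>2 * A0 x + 2 * q\<^sup>2 * (cmod (\<phi> x))\<^sup>2 * A0 x)"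

definition topological ::
  "(real^2 \<Rightarrow> complex) \<Rightarrow> (real^2 \<Rightarrow> real) \<Rightarrow> (real^2 \<Rightarrow> real) \<Rightarrow> bool" where
  "topological \<phi> A0 N \<longleftrightarrow>
     ((\<lambda>x. (cmod (\<phi> x))\<^sup>2) \<longlongrightarrow> 1) at_infinity \<and>
     (\<forall>x. N x = - A0 x) \<and> (N \<longlongrightarrow> 0) at_infinity"

definition circle_at :: "real^2 \<Rightarrow> real \<Rightarrow> real \<Rightarrow> real^2" where
  "circle_at z r t = z + r *\<^sub>R vector [cos (2 * pi * t), sin (2 * pi * t)]"

text \<open>The degree of \<open>\<phi>/|\<phi>|\<close> on a circle, a map into the unit circle, is the winding number about the
  origin of the loop that it traces as the circle is traversed once, over \<open>0 \<le> t \<le> 1\<close>.\<close>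

definition vanishes_with_winding :: "(real^2 \<Rightarrow> complex) \<Rightarrow> real^2 \<Rightarrow> nat \<Rightarrow> bool" where
  "vanishes_with_winding \<phi> z n \<longleftrightarrow>
     \<phi> z = 0 \<and>
     (\<exists>\<delta>>0. (\<forall>x. 0 < dist x z \<and> dist x z < \<delta> \<longrightarrow> \<phi> x \<noteq> 0) \<and>
            (\<forall>r. 0 < r \<and> r < \<delta> \<longrightarrow>
               winding_number
                 (\<lambda>t. \<phi> (circle_at z r t) / of_real (cmod (\<phi> (circle_at z r t)))) 0 = of_nat n))"

end

theory Submission
  imports Defs "HOL-Probability.Probability"
begin

text \<open>Let \<open>p = \<Prod> (\<zeta> - z\<^sub>j)\<^bsup>n\<^sub>j\<^esup>\<close>. Writing \<open>\<phi> = p e\<^sup>v\<close> with \<open>v\<close> real, the equation \<open>(D\<^sub>1 + iD\<^sub>2)\<phi> = 0\<close> just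
  determines \<open>A\<^sub>1, A\<^sub>2\<close> from the gradient of \<open>v\<close>, and with \<open>u = ln |\<phi>|\<^sup>2\<close>, \<open>A = (\<kappa>/q) A\<^sub>0\<close> the other two become
  (away from the zeros)
  \<open>\<Delta>u = 2q\<^sup>2 (e\<^sup>u - 1 - A)\<close> and \<open>\<Delta>A = \<kappa>\<^sup>2 (1 - e\<^sup>u + A) + 2q\<^sup>2 e\<^sup>u A\<close>.
  For \<open>A \<le> \<kappa>\<^sup>2/(2q\<^sup>2)\<close> this system is cooperative, so monotone iteration with the resolvent of the Laplacian
  yields a solution between an ordered sub- and supersolution; it is smooth because the gradient of the
  resolvent kernel is integrable, so that every application of the resolvent gains a derivative. With
  \<open>E = |p|\<^sup>2 / (a + |p|\<^sup>4)\<^bsup>1/2\<^esup>\<close> the subsolution is \<open>u = ln E\<close>, \<open>A = - (1 - E) (1 - d E)\<close> for small \<open>d\<close>: every error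
  term is at most a multiple of \<open>(|p'|\<^sup>2 / (a + |p|\<^sup>4)\<^bsup>1/2\<^esup>) E (1 - E)\<close>, whose first factor is uniformly small when
  \<open>a\<close> is large. The bounds \<open>A \<le> 0\<close>, \<open>e\<^sup>u \<le> 1\<close> and \<open>- A \<le> 1 - e\<^sup>u\<close> follow from the Omori--Yau maximum
  principle, and the limits at infinity from \<open>E \<le> e\<^sup>u \<le> 1\<close>.\<close>

section \<open>Bounded smooth functions on the plane\<close>

text \<open>Since ln |p|^2 is harmonic off the zeros, u = ln E + w replaces the logarithmic
  singularities by the smooth source \<open>G\<close>, the Laplacian of ln (a + |p|^4)^(1/2), and
  all unknowns become bounded smooth functions. No decay is prescribed, so the iteration runs on
  bounded functions and rests on positivity of the resolvent. The threshold \<kappa>^2/(2q^2) is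
  where the coefficient 2q^2 A - \<kappa>^2 of e^u in the second equation changes sign; the constant
  A at this threshold is one half of the supersolution. The other half must cope with the zeros of
  p, where E vanishes and the exponential gives no help: there a multiple of 1/(L + |x|^2), whose
  Laplacian is negative near the origin, compensates, while far out a large additive constant does.
  This supersolution allows A > 0 and |phi| > 1; it only makes the iteration converge, and the sharp
  inequalities are recovered afterwards from the equations. In the subsolution, A = - (1 - E) alone
  would make e^u - 1 - A vanish identically; the factor 1 - dE creates the negative amount that
  absorbs the positive source.\<close>

definition has_grad ::
  "(real^2 \<Rightarrow> 'b::real_normed_vector) \<Rightarrow> (real^2 \<Rightarrow> 'b) \<Rightarrow> (real^2 \<Rightarrow> 'b) \<Rightarrow> bool" where
  "has_grad f f1 f2 \<longleftrightarrow> (\<forall>x. (f has_derivative (\<lambda>h. h$1 *\<^sub>R f1 x + h$2 *\<^sub>R f2 x)) (at x))"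

lemma has_grad_partial:
  assumes "has_grad f f1 f2"
  shows "partial 1 f = f1" "partial 2 f = f2"
proof -
  have *: "((\<lambda>t. f (x + t *\<^sub>R axis j 1)) has_vector_derivative
      (axis j 1 $ 1 *\<^sub>R f1 x + axis j 1 $ 2 *\<^sub>R f2 x)) (at 0)" for x j
  proof -
    have f: "(f has_derivative (\<lambda>h. h$1 *\<^sub>R f1 x + h$2 *\<^sub>R f2 x)) (at (x + 0 *\<^sub>R axis j 1))"
      using spec[OF assms[unfolded has_grad_def], of x] by (simp only: scaleR_zero_left add_0_right)
    have g: "((\<lambda>t. x + t *\<^sub>R axis j 1) has_derivative (\<lambda>t. t *\<^sub>R axis j 1)) (at (0::real))"
      by (auto intro!: derivative_eq_intros)
    have "((\<lambda>t. f (x + t *\<^sub>R axis j 1)) has_derivative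
        (\<lambda>t. (t *\<^sub>R axis j 1)$1 *\<^sub>R f1 x + (t *\<^sub>R axis j 1)$2 *\<^sub>R f2 x)) (at 0)"
      by (rule has_derivative_compose[OF g f])
    then show ?thesis
      by (simp add: has_vector_derivative_def scaleR_add_right)
  qed
  show "partial 1 f = f1"
    using *[of _ 1] by (auto simp: partial_def fun_eq_iff axis_def intro!: vector_derivative_at)
  show "partial 2 f = f2"
    using *[of _ 2] by (auto simp: partial_def fun_eq_iff axis_def intro!: vector_derivative_at)
qed

lemma has_grad_unique: "has_grad f f1 f2 \<Longrightarrow> has_grad f g1 g2 \<Longrightarrow> f1 = g1 \<and> f2 = g2"
  using has_grad_partial by metis

lemma has_grad_const: "has_grad (\<lambda>x. c) (\<lambda>x. 0) (\<lambda>x. 0)"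
  by (simp add: has_grad_def)

lemma has_grad_add:
  "has_grad f f1 f2 \<Longrightarrow> has_grad g g1 g2 \<Longrightarrow>
    has_grad (\<lambda>x. f x + g x) (\<lambda>x. f1 x + g1 x) (\<lambda>x. f2 x + g2 x)"
  unfolding has_grad_def
  by (auto intro!: derivative_eq_intros simp: algebra_simps fun_eq_iff)

lemma has_grad_mult:
  fixes f g :: "real^2 \<Rightarrow> 'b::real_normed_algebra"
  assumes "has_grad f f1 f2" "has_grad g g1 g2"
  shows "has_grad (\<lambda>x. f x * g x) (\<lambda>x. f1 x * g x + f x * g1 x) (\<lambda>x. f2 x * g x + f x * g2 x)"
  unfolding has_grad_def
proof
  fix x
  have "((\<lambda>x. f x * g x) has_derivative (\<lambda>h. f x * (h$1 *\<^sub>R g1 x + h$2 *\<^sub>R g2 x) +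
      (h$1 *\<^sub>R f1 x + h$2 *\<^sub>R f2 x) * g x)) (at x)"
    using assms unfolding has_grad_def by (intro has_derivative_mult) auto
  then show "((\<lambda>x. f x * g x) has_derivative (\<lambda>h. h$1 *\<^sub>R (f1 x * g x + f x * g1 x) +
      h$2 *\<^sub>R (f2 x * g x + f x * g2 x))) (at x)"
    by (simp add: algebra_simps scaleR_add_right)
qed

lemma has_grad_linear:
  assumes "bounded_linear T" "has_grad f f1 f2"
  shows "has_grad (\<lambda>x. T (f x)) (\<lambda>x. T (f1 x)) (\<lambda>x. T (f2 x))"
  unfolding has_grad_def
proof
  fix x
  have "(T has_derivative T) (at (f x))"
    using assms(1) by (rule bounded_linear_imp_has_derivative)
  then have "((\<lambda>x. T (f x)) has_derivative (\<lambda>h. T (h$1 *\<^sub>R f1 x + h$2 *\<^sub>R f2 x))) (at x)"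
    by (rule has_derivative_compose[OF spec[OF assms(2)[unfolded has_grad_def]]])
  then show "((\<lambda>x. T (f x)) has_derivative (\<lambda>h. h$1 *\<^sub>R T (f1 x) + h$2 *\<^sub>R T (f2 x))) (at x)"
    by (simp add: linear_add linear_cmul bounded_linear.linear[OF assms(1)])
qed

lemma has_grad_diff:
  "has_grad f f1 f2 \<Longrightarrow> has_grad g g1 g2 \<Longrightarrow>
    has_grad (\<lambda>x. f x - g x) (\<lambda>x. f1 x - g1 x) (\<lambda>x. f2 x - g2 x)"
  unfolding has_grad_def
  by (auto intro!: derivative_eq_intros simp: algebra_simps fun_eq_iff)

lemma has_grad_cmult:
  fixes f :: "real^2 \<Rightarrow> 'b::real_normed_algebra"
  shows "has_grad f f1 f2 \<Longrightarrow> has_grad (\<lambda>x. r * f x) (\<lambda>x. r * f1 x) (\<lambda>x. r * f2 x)"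
  by (rule has_grad_linear[OF bounded_linear_mult_right])

lemma has_grad_compose:
  fixes \<Phi> \<Phi>' :: "real \<Rightarrow> real"
  assumes "\<And>x. (\<Phi> has_real_derivative \<Phi>' (f x)) (at (f x))" "has_grad f f1 f2"
  shows "has_grad (\<lambda>x. \<Phi> (f x)) (\<lambda>x. \<Phi>' (f x) * f1 x) (\<lambda>x. \<Phi>' (f x) * f2 x)"
  unfolding has_grad_def
proof
  fix x
  have "(\<Phi> has_derivative (*) (\<Phi>' (f x))) (at (f x))"
    using assms(1) by (simp add: has_field_derivative_def)
  then have "((\<lambda>x. \<Phi> (f x)) has_derivative (\<lambda>h. \<Phi>' (f x) * (h$1 *\<^sub>R f1 x + h$2 *\<^sub>R f2 x))) (at x)"
    by (rule has_derivative_compose[OF spec[OF assms(2)[unfolded has_grad_def]]])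
  then show "((\<lambda>x. \<Phi> (f x)) has_derivative (\<lambda>h. h$1 *\<^sub>R (\<Phi>' (f x) * f1 x) + h$2 *\<^sub>R (\<Phi>' (f x) * f2 x))) (at x)"
    by (simp add: algebra_simps)
qed

lemma has_grad_coord:
  "has_grad (\<lambda>x. x$1) (\<lambda>x. 1::real) (\<lambda>x. 0)" "has_grad (\<lambda>x. x$2) (\<lambda>x. 0::real) (\<lambda>x. 1)"
  unfolding has_grad_def by (auto intro!: bounded_linear_imp_has_derivative bounded_linear_vec_nth)

lemma has_grad_continuous: "has_grad f f1 f2 \<Longrightarrow> continuous_on UNIV f"
  unfolding has_grad_def
  by (intro continuous_at_imp_continuous_on ballI has_derivative_continuous) (erule spec)

text \<open>The space C^k_b: all partial derivatives up to order k exist and are bounded, and those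
  of order k are continuous. Boundedness is built in because the resolvent integrates over the whole
  plane.\<close>

primrec CB :: "nat \<Rightarrow> (real^2 \<Rightarrow> 'b::real_normed_vector) \<Rightarrow> bool" where
  "CB 0 f \<longleftrightarrow> bounded (range f) \<and> continuous_on UNIV f"
| "CB (Suc k) f \<longleftrightarrow> bounded (range f) \<and> (\<exists>f1 f2. has_grad f f1 f2 \<and> CB k f1 \<and> CB k f2)"

lemma CB_bounded: "CB k f \<Longrightarrow> bounded (range f)"
  by (cases k) auto

lemma CB_continuous: "CB k f \<Longrightarrow> continuous_on UNIV f"
  by (cases k) (auto intro: has_grad_continuous)

lemma CB_SucI:
  "bounded (range f) \<Longrightarrow> has_grad f f1 f2 \<Longrightarrow> CB k f1 \<Longrightarrow> CB k f2 \<Longrightarrow> CB (Suc k) f"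
  by (simp only: CB.simps) blast

lemma CB_SucE:
  assumes "CB (Suc k) f"
  obtains f1 f2 where "has_grad f f1 f2" "CB k f1" "CB k f2"
  using assms by (simp only: CB.simps) blast

lemma CB_SucD: "CB (Suc k) f \<Longrightarrow> CB k f"
proof (induction k arbitrary: f)
  case 0
  then show ?case by (metis CB.simps(1) CB_bounded CB_continuous)
next
  case (Suc k)
  obtain f1 f2 where "has_grad f f1 f2" "CB (Suc k) f1" "CB (Suc k) f2"
    using Suc.prems by (rule CB_SucE)
  then show ?case by (intro CB_SucI[OF CB_bounded[OF Suc.prems]] Suc.IH)
qed

lemma CB_partial:
  assumes "CB (Suc k) f"
  shows "has_grad f (partial 1 f) (partial 2 f)" "CB k (partial 1 f)" "CB k (partial 2 f)"
proof -
  obtain f1 f2 where *: "has_grad f f1 f2" "CB k f1" "CB k f2" using assms by (rule CB_SucE)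
  then show "has_grad f (partial 1 f) (partial 2 f)" "CB k (partial 1 f)" "CB k (partial 2 f)"
    using has_grad_partial[OF *(1)] by simp_all
qed

lemma bounded_range_add:
  fixes f g :: "'a \<Rightarrow> 'b::real_normed_vector"
  assumes "bounded (range f)" "bounded (range g)"
  shows "bounded (range (\<lambda>x. f x + g x))"
  using assms by (rule bounded_plus_comp)

lemma bounded_range_mult:
  fixes f g :: "'a \<Rightarrow> 'b::real_normed_algebra"
  assumes "bounded (range f)" "bounded (range g)"
  shows "bounded (range (\<lambda>x. f x * g x))"
proof -
  obtain B C where B: "\<And>x. norm (f x) \<le> B" and C: "\<And>x. norm (g x) \<le> C"
    using assms by (auto simp: bounded_iff)
  have "norm (f x * g x) \<le> B * C" for x
    by (rule order_trans[OF norm_mult_ineq]) (meson B C mult_mono norm_ge_zero order_trans)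
  then show ?thesis by (auto simp: bounded_iff)
qed

lemma bounded_range_linear:
  assumes "bounded_linear T" "bounded (range f)"
  shows "bounded (range (\<lambda>x. T (f x)))"
  using bounded_linear_image[OF assms(2,1)] by (simp add: image_image)

lemma CB_const: "CB k (\<lambda>x. c)"
proof (induction k arbitrary: c)
  case (Suc k)
  show ?case by (rule CB_SucI[OF _ has_grad_const]) (auto intro: Suc)
qed auto

lemma CB_add: "CB k f \<Longrightarrow> CB k g \<Longrightarrow> CB k (\<lambda>x. f x + g x)"
proof (induction k arbitrary: f g)
  case 0
  then show ?case by (auto intro: bounded_range_add continuous_on_add)
next
  case (Suc k)
  from Suc.prems obtain f1 f2 g1 g2 where
    *: "has_grad f f1 f2" "CB k f1" "CB k f2" "has_grad g g1 g2" "CB k g1" "CB k g2"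
    by (metis CB_SucE)
  show ?case
    by (intro CB_SucI[OF _ has_grad_add[OF *(1,4)]] bounded_range_add Suc.IH *
        Suc.prems[THEN CB_bounded])
qed

lemma CB_mult:
  fixes f g :: "real^2 \<Rightarrow> 'b::real_normed_algebra"
  shows "CB k f \<Longrightarrow> CB k g \<Longrightarrow> CB k (\<lambda>x. f x * g x)"
proof (induction k arbitrary: f g)
  case 0
  then show ?case by (auto intro: bounded_range_mult continuous_on_mult)
next
  case (Suc k)
  from Suc.prems obtain f1 f2 g1 g2 where
    *: "has_grad f f1 f2" "CB k f1" "CB k f2" "has_grad g g1 g2" "CB k g1" "CB k g2"
    by (metis CB_SucE)
  show ?case
    by (intro CB_SucI[OF _ has_grad_mult[OF *(1,4)]] bounded_range_mult CB_add Suc.IH *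
        Suc.prems[THEN CB_bounded] Suc.prems[THEN CB_SucD])
qed

lemma CB_linear: "bounded_linear T \<Longrightarrow> CB k f \<Longrightarrow> CB k (\<lambda>x. T (f x))"
proof (induction k arbitrary: f)
  case 0
  then show ?case by (auto intro: bounded_range_linear bounded_linear.continuous_on)
next
  case (Suc k)
  obtain f1 f2 where *: "has_grad f f1 f2" "CB k f1" "CB k f2"
    by (rule CB_SucE[OF Suc.prems(2)])
  show ?case
    by (rule CB_SucI[OF bounded_range_linear[OF Suc.prems(1) CB_bounded[OF Suc.prems(2)]]
        has_grad_linear[OF Suc.prems(1) *(1)] Suc.IH[OF Suc.prems(1) *(2)] Suc.IH[OF Suc.prems(1) *(3)]])
qed

lemma CB_cmult: fixes c :: "'b::real_normed_algebra" shows "CB k f \<Longrightarrow> CB k (\<lambda>x. c * f x)"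
  by (rule CB_mult[OF CB_const])

lemma CB_scaleR: "CB k f \<Longrightarrow> CB k (\<lambda>x. c *\<^sub>R f x)"
  by (rule CB_linear[OF bounded_linear_scaleR_right])

lemma CB_diff: "CB k f \<Longrightarrow> CB k g \<Longrightarrow> CB k (\<lambda>x. f x - g x)"
  using CB_add[of k f "\<lambda>x. (-1) *\<^sub>R g x"] CB_scaleR[of k g "-1"] by simp

lemma CB_uminus: "CB k f \<Longrightarrow> CB k (\<lambda>x. - f x)"
  using CB_scaleR[of k f "-1"] by simp

lemma CB_power:
  fixes f :: "real^2 \<Rightarrow> 'b::real_normed_algebra_1"
  shows "CB k f \<Longrightarrow> CB k (\<lambda>x. f x ^ n)"
  by (induction n) (auto intro: CB_mult CB_const)

lemma CB_exp:
  fixes f :: "real^2 \<Rightarrow> real"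
  shows "CB k f \<Longrightarrow> CB k (\<lambda>x. exp (f x))"
proof (induction k)
  case 0
  then obtain B where "\<And>x. \<bar>f x\<bar> \<le> B" by (auto simp: bounded_iff)
  then have "norm (exp (f x)) \<le> exp B" for x by (simp add: abs_le_D1)
  then show ?case using 0 by (auto simp: bounded_iff intro!: continuous_intros)
next
  case (Suc k)
  obtain f1 f2 where *: "has_grad f f1 f2" "CB k f1" "CB k f2"
    by (rule CB_SucE[OF Suc.prems])
  have e: "CB k (\<lambda>x. exp (f x))" by (rule Suc.IH[OF CB_SucD[OF Suc.prems]])
  show ?case
    by (intro CB_SucI[OF CB_bounded[OF e] has_grad_compose[OF DERIV_exp *(1)]] CB_mult e *)
qed

text \<open>Differentiation lowers the exponent by one, so the induction runs over all exponents at
  once; the lower bound c keeps negative powers bounded.\<close>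

lemma CB_powr:
  fixes f :: "real^2 \<Rightarrow> real"
  assumes c: "c > 0" "\<And>x. f x \<ge> c"
  shows "CB k f \<Longrightarrow> CB k (\<lambda>x. f x powr r)"
proof (induction k arbitrary: r)
  case 0
  then obtain B where B: "\<And>x. \<bar>f x\<bar> \<le> B" by (auto simp: bounded_iff)
  have "norm (f x powr r) \<le> B powr r + c powr r" for x
  proof (cases "r \<ge> 0")
    case True
    have "0 \<le> f x" "f x \<le> B" using c(1) c(2)[of x] B[of x] by linarith+
    then have "f x powr r \<le> B powr r" using True by (simp add: powr_mono2)
    then show ?thesis by (simp add: add_increasing2)
  next
    case False
    then have "f x powr r \<le> c powr r" using c by (simp add: powr_mono2')
    then show ?thesis by (simp add: add_increasing)
  qed
  moreover have "f x \<noteq> 0" for x using c(1) c(2)[of x] by auto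
  ultimately show ?case using 0 by (auto simp: bounded_iff intro!: continuous_on_powr continuous_intros)
next
  case (Suc k)
  obtain f1 f2 where *: "has_grad f f1 f2" "CB k f1" "CB k f2"
    by (rule CB_SucE[OF Suc.prems])
  have e: "CB k (\<lambda>x. f x powr s)" for s by (rule Suc.IH[OF CB_SucD[OF Suc.prems]])
  have "((\<lambda>t. t powr r) has_real_derivative r * f x powr (r - 1)) (at (f x))" for x
    using order.strict_trans2[OF c] by (rule has_real_derivative_powr)
  from has_grad_compose[OF this *(1)] show ?case
    by (rule CB_SucI[OF CB_bounded[OF e]]) (intro CB_mult CB_const e *)+
qed

definition CBi :: "(real^2 \<Rightarrow> 'b::real_normed_vector) \<Rightarrow> bool" where
  "CBi f \<longleftrightarrow> (\<forall>k. CB k f)"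

lemma CBiD: "CBi f \<Longrightarrow> CB k f" by (simp add: CBi_def)

lemma CBi_has_grad: "CBi f \<Longrightarrow> has_grad f (partial 1 f) (partial 2 f)"
  by (rule CB_partial(1)[OF CBiD])

lemma CBi_partial: assumes "CBi f" shows "CBi (partial 1 f)" "CBi (partial 2 f)"
  unfolding CBi_def by (auto intro: CB_partial(2,3)[OF CBiD[OF assms]])

lemma CBi_const: "CBi (\<lambda>x. c)" by (simp add: CBi_def CB_const)
lemma CBi_add: "CBi f \<Longrightarrow> CBi g \<Longrightarrow> CBi (\<lambda>x. f x + g x)" by (simp add: CBi_def CB_add)
lemma CBi_diff: "CBi f \<Longrightarrow> CBi g \<Longrightarrow> CBi (\<lambda>x. f x - g x)" by (simp add: CBi_def CB_diff)
lemma CBi_uminus: "CBi f \<Longrightarrow> CBi (\<lambda>x. - f x)" by (simp add: CBi_def CB_uminus)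
lemma CBi_mult:
  fixes f g :: "real^2 \<Rightarrow> 'b::real_normed_algebra"
  shows "CBi f \<Longrightarrow> CBi g \<Longrightarrow> CBi (\<lambda>x. f x * g x)" by (simp add: CBi_def CB_mult)
lemma CBi_power:
  fixes f :: "real^2 \<Rightarrow> 'b::real_normed_algebra_1"
  shows "CBi f \<Longrightarrow> CBi (\<lambda>x. f x ^ n)" by (simp add: CBi_def CB_power)
lemma CBi_linear: "bounded_linear T \<Longrightarrow> CBi f \<Longrightarrow> CBi (\<lambda>x. T (f x))" by (simp add: CBi_def CB_linear)
lemma CBi_exp: fixes f :: "real^2 \<Rightarrow> real" shows "CBi f \<Longrightarrow> CBi (\<lambda>x. exp (f x))" by (simp add: CBi_def CB_exp)
lemma CBi_powr:
  fixes f :: "real^2 \<Rightarrow> real"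
  shows "c > 0 \<Longrightarrow> (\<And>x. f x \<ge> c) \<Longrightarrow> CBi f \<Longrightarrow> CBi (\<lambda>x. f x powr r)"
  unfolding CBi_def using CB_powr by blast

text \<open>Bridge to the smoothness notion of the theorem: the derivative in a fixed direction v is
  a constant combination of the two partials, hence stays in the class.\<close>

lemma CB_times_cont_differentiable: "CB k f \<Longrightarrow> times_cont_differentiable k f"
proof (induction k arbitrary: f)
  case (Suc k)
  obtain f1 f2 where *: "has_grad f f1 f2" "CB k f1" "CB k f2"
    by (rule CB_SucE[OF Suc.prems])
  have d: "(f has_derivative (\<lambda>h. h$1 *\<^sub>R f1 x + h$2 *\<^sub>R f2 x)) (at x)" for x
    using *(1) by (simp add: has_grad_def)
  have "(\<lambda>x. frechet_derivative f (at x) v) = (\<lambda>x. v$1 *\<^sub>R f1 x + v$2 *\<^sub>R f2 x)" for v :: "real^2"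
    using frechet_derivative_at[OF d] by (metis (no_types, lifting))
  moreover have "CB k (\<lambda>x. v$1 *\<^sub>R f1 x + v$2 *\<^sub>R f2 x)" for v :: "real^2"
    by (intro CB_add CB_scaleR *)
  ultimately show ?case using Suc.IH differentiableI[OF d] by simp
qed auto

lemma CBi_smooth: "CBi f \<Longrightarrow> smooth f"
  by (simp add: CBi_def smooth_def CB_times_cont_differentiable)

text \<open>A relation with explicit witnesses lets Laplacians be assembled by rules, also for
  functions such as \<open>K\<close> that are unbounded and so lie outside
  \<open>CBi\<close>.\<close>

definition has_lap :: "(real^2 \<Rightarrow> real) \<Rightarrow> (real^2 \<Rightarrow> real) \<Rightarrow> bool" where
  "has_lap f l \<longleftrightarrow> (\<exists>f1 f2 f11 f12 f21 f22. has_grad f f1 f2 \<and> has_grad f1 f11 f12 \<and>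
     has_grad f2 f21 f22 \<and> l = (\<lambda>x. f11 x + f22 x))"

lemma has_lap_laplacian: "has_lap f l \<Longrightarrow> laplacian f = l"
  unfolding has_lap_def laplacian_def
  by (elim exE conjE) (simp add: has_grad_partial fun_eq_iff)

lemma CBi_laplacian: "CBi f \<Longrightarrow> CBi (laplacian f)"
  unfolding laplacian_def by (intro CBi_add CBi_partial)

lemma has_lapI:
  assumes "has_grad f f1 f2" "has_grad f1 f11 f12" "has_grad f2 f21 f22" "\<And>x. l x = f11 x + f22 x"
  shows "has_lap f l"
proof -
  have "l = (\<lambda>x. f11 x + f22 x)" using assms(4) by (rule ext)
  then show ?thesis unfolding has_lap_def using assms(1-3) by blast
qed

lemma has_lap_add: "has_lap f l \<Longrightarrow> has_lap g k \<Longrightarrow> has_lap (\<lambda>x. f x + g x) (\<lambda>x. l x + k x)"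
  unfolding has_lap_def by (elim exE conjE, intro exI conjI) (assumption | rule has_grad_add | force)+

lemma has_lap_diff: "has_lap f l \<Longrightarrow> has_lap g k \<Longrightarrow> has_lap (\<lambda>x. f x - g x) (\<lambda>x. l x - k x)"
  unfolding has_lap_def by (elim exE conjE, intro exI conjI) (assumption | rule has_grad_diff | force)+

lemma has_lap_cmult: "has_lap f l \<Longrightarrow> has_lap (\<lambda>x. r * f x) (\<lambda>x. r * l x)"
  unfolding has_lap_def by (elim exE conjE, intro exI conjI) (assumption | rule has_grad_cmult | simp add: algebra_simps)+

lemma has_lap_const: "has_lap (\<lambda>x. r) (\<lambda>x. 0)"
  by (rule has_lapI[OF has_grad_const has_grad_const has_grad_const]) simp

lemma has_lap_unique: "has_lap f l \<Longrightarrow> has_lap f k \<Longrightarrow> l = k"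
  using has_lap_laplacian by metis

lemma has_lap_compose:
  fixes \<Phi> \<Phi>' \<Phi>'' :: "real \<Rightarrow> real"
  assumes f: "has_grad f f1 f2" "has_grad f1 f11 f12" "has_grad f2 f21 f22"
    and \<Phi>: "\<And>x. (\<Phi> has_real_derivative \<Phi>' (f x)) (at (f x))"
      "\<And>x. (\<Phi>' has_real_derivative \<Phi>'' (f x)) (at (f x))"
  shows "has_lap (\<lambda>x. \<Phi> (f x)) (\<lambda>x. \<Phi>'' (f x) * ((f1 x)\<^sup>2 + (f2 x)\<^sup>2) + \<Phi>' (f x) * (f11 x + f22 x))"
  by (rule has_lapI[OF has_grad_compose[OF \<Phi>(1) f(1)] has_grad_mult[OF has_grad_compose[OF \<Phi>(2) f(1)] f(2)]
        has_grad_mult[OF has_grad_compose[OF \<Phi>(2) f(1)] f(3)]])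
    (simp add: algebra_simps power2_eq_square)

section \<open>Averages of translates\<close>

text \<open>The second bound is the uniform majorant of the remainder divided by |h| that dominated
  convergence asks for when differentiating under the integral; the increment and its linear part
  contribute 2B each.\<close>

lemma CB_remainder_bound:
  fixes f :: "real^2 \<Rightarrow> real"
  assumes g: "has_grad f f1 f2" and B: "\<And>x. \<bar>f1 x\<bar> \<le> B" "\<And>x. \<bar>f2 x\<bar> \<le> B"
  shows "\<bar>f (x + h) - f x\<bar> \<le> 2 * B * norm h"
    and "\<bar>f (x + h) - f x - (h$1 * f1 x + h$2 * f2 x)\<bar> \<le> 4 * B * norm h"
proof -
  have lin: "\<bar>k$1 * f1 y + k$2 * f2 y\<bar> \<le> 2 * B * norm k" for y and k :: "real^2"
  proof -
    have "\<bar>k$1 * f1 y\<bar> \<le> norm k * B" "\<bar>k$2 * f2 y\<bar> \<le> norm k * B"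
      unfolding abs_mult using B by (intro mult_mono component_le_norm_cart; force)+
    then show ?thesis by (simp add: algebra_simps)
  qed
  have "norm (f (x + h) - f x) \<le> 2 * B * norm (x + h - x)"
  proof (rule differentiable_bound[of UNIV f "\<lambda>y k. k$1 *\<^sub>R f1 y + k$2 *\<^sub>R f2 y"])
    show "(f has_derivative (\<lambda>k. k$1 *\<^sub>R f1 y + k$2 *\<^sub>R f2 y)) (at y within UNIV)" for y
      using spec[OF g[unfolded has_grad_def]] by simp
    show "onorm (\<lambda>k::real^2. k$1 *\<^sub>R f1 y + k$2 *\<^sub>R f2 y) \<le> 2 * B" for y
      using lin by (intro onorm_le) simp
  qed auto
  then show *: "\<bar>f (x + h) - f x\<bar> \<le> 2 * B * norm h" by simp
  show "\<bar>f (x + h) - f x - (h$1 * f1 x + h$2 * f2 x)\<bar> \<le> 4 * B * norm h"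
    using * lin[of h x] by linarith
qed

lemma abs_mult_le: "\<bar>y\<bar> \<le> B \<Longrightarrow> \<bar>m * y\<bar> \<le> B * \<bar>m\<bar>" for m y B :: real
  using mult_right_mono[of "\<bar>y\<bar>" B "\<bar>m\<bar>"] by (simp add: abs_mult mult.commute)

lemma CB_measurable_bound:
  fixes f :: "real^2 \<Rightarrow> real"
  assumes "CB k f"
  shows "f \<in> borel_measurable borel" "\<exists>B. \<forall>x. \<bar>f x\<bar> \<le> B"
  using CB_continuous[OF assms] CB_bounded[OF assms]
  by (auto intro: borel_measurable_continuous_onI simp: bounded_iff)

text \<open>A weighted average of translates, with a weight that may change sign. It commutes with
  translations, hence with differentiation, so the resolvent and both of its gradient kernels share
  one regularity theory.\<close>

definition smear ::
  "'w measure \<Rightarrow> ('w \<Rightarrow> real^2) \<Rightarrow> ('w \<Rightarrow> real) \<Rightarrow> (real^2 \<Rightarrow> real) \<Rightarrow> real^2 \<Rightarrow> real" where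
  "smear M X m f x = (\<integral>\<omega>. m \<omega> * f (x + X \<omega>) \<partial>M)"

context
  fixes M :: "'w measure" and X :: "'w \<Rightarrow> real^2" and m :: "'w \<Rightarrow> real"
  assumes X [measurable]: "X \<in> borel_measurable M" and m: "integrable M m"
begin

lemma smear_integrable:
  assumes f [measurable]: "f \<in> borel_measurable borel" and B: "\<And>y. \<bar>f y\<bar> \<le> B"
  shows "integrable M (\<lambda>\<omega>. m \<omega> * f (x + X \<omega>))"
proof (rule Bochner_Integration.integrable_bound[of _ "\<lambda>\<omega>. B * m \<omega>"])
  show "integrable M (\<lambda>\<omega>. B * m \<omega>)" using m by simp
  have [measurable]: "m \<in> borel_measurable M" using m by auto
  show "(\<lambda>\<omega>. m \<omega> * f (x + X \<omega>)) \<in> borel_measurable M" by measurable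
  have "\<bar>m \<omega> * f (x + X \<omega>)\<bar> \<le> \<bar>B * m \<omega>\<bar>" for \<omega>
    unfolding abs_mult[of B] by (rule abs_mult_le[OF order_trans[OF B abs_ge_self]])
  then show "AE \<omega> in M. norm (m \<omega> * f (x + X \<omega>)) \<le> norm (B * m \<omega>)"
    by (intro AE_I2) (simp only: real_norm_def)
qed

lemma smear_bound:
  assumes "f \<in> borel_measurable borel" and B: "\<And>y. \<bar>f y\<bar> \<le> B"
  shows "\<bar>smear M X m f x\<bar> \<le> B * (\<integral>\<omega>. \<bar>m \<omega>\<bar> \<partial>M)"
proof -
  have "\<bar>smear M X m f x\<bar> \<le> (\<integral>\<omega>. \<bar>m \<omega> * f (x + X \<omega>)\<bar> \<partial>M)"
    unfolding smear_def using integral_norm_bound[of M "\<lambda>\<omega>. m \<omega> * f (x + X \<omega>)"] by simp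
  also have "\<dots> \<le> (\<integral>\<omega>. B * \<bar>m \<omega>\<bar> \<partial>M)"
    by (intro integral_mono integrable_abs smear_integrable[OF assms] integrable_mult_right m
        abs_mult_le[OF B])
  finally show ?thesis by simp
qed

lemma smear_limit:
  assumes f: "\<And>n. f n \<in> borel_measurable borel" and g: "g \<in> borel_measurable borel"
    and B: "\<And>n y. \<bar>f n y\<bar> \<le> B"
    and lim: "\<And>y. (\<lambda>n. f n y) \<longlonglongrightarrow> g y"
  shows "(\<lambda>n. smear M X m (f n) x) \<longlonglongrightarrow> smear M X m g x"
  unfolding smear_def
proof (rule integral_dominated_convergence[of _ _ _ "\<lambda>\<omega>. B * \<bar>m \<omega>\<bar>"])
  have [measurable]: "m \<in> borel_measurable M" using m by auto
  note [measurable] = f g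
  show "(\<lambda>\<omega>. m \<omega> * g (x + X \<omega>)) \<in> borel_measurable M" by measurable
  show "(\<lambda>\<omega>. m \<omega> * f n (x + X \<omega>)) \<in> borel_measurable M" for n by measurable
  show "integrable M (\<lambda>\<omega>. B * \<bar>m \<omega>\<bar>)" using m by simp
  show "AE \<omega> in M. (\<lambda>n. m \<omega> * f n (x + X \<omega>)) \<longlonglongrightarrow> m \<omega> * g (x + X \<omega>)"
    by (intro AE_I2 tendsto_mult tendsto_const lim)
  show "AE \<omega> in M. norm (m \<omega> * f n (x + X \<omega>)) \<le> B * \<bar>m \<omega>\<bar>" for n
    unfolding real_norm_def by (intro AE_I2 abs_mult_le[OF B])
qed

lemma smear_add:
  assumes "f \<in> borel_measurable borel" "g \<in> borel_measurable borel" "\<And>y. \<bar>f y\<bar> \<le> B" "\<And>y. \<bar>g y\<bar> \<le> C"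
  shows "smear M X m (\<lambda>y. f y + g y) x = smear M X m f x + smear M X m g x"
  unfolding smear_def distrib_left
  by (intro Bochner_Integration.integral_add smear_integrable[OF assms(1,3)] smear_integrable[OF assms(2,4)])

lemma smear_cmult: "smear M X m (\<lambda>y. c * f y) x = c * smear M X m f x"
  unfolding smear_def by (subst integral_mult_right_zero[symmetric]) (simp add: ac_simps)

lemma smear_mono:
  assumes f: "f \<in> borel_measurable borel" "\<And>y. \<bar>f y\<bar> \<le> B"
    and g: "g \<in> borel_measurable borel" "\<And>y. \<bar>g y\<bar> \<le> C"
    and le: "\<And>y. f y \<le> g y" and pos: "AE \<omega> in M. 0 \<le> m \<omega>"
  shows "smear M X m f x \<le> smear M X m g x"
  unfolding smear_def
proof (rule integral_mono_AE[OF smear_integrable[OF f] smear_integrable[OF g]])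
  show "AE \<omega> in M. m \<omega> * f (x + X \<omega>) \<le> m \<omega> * g (x + X \<omega>)"
    using pos by eventually_elim (rule mult_left_mono[OF le])
qed

lemma smear_continuous:
  assumes f: "continuous_on UNIV f" and B: "\<And>y. \<bar>f y\<bar> \<le> B"
  shows "continuous_on UNIV (smear M X m f)"
proof -
  have [measurable]: "f \<in> borel_measurable borel" by (rule borel_measurable_continuous_onI[OF f])
  have [measurable]: "m \<in> borel_measurable M" using m by auto
  have "(\<lambda>n. smear M X m f (s n)) \<longlonglongrightarrow> smear M X m f x" if s: "s \<longlonglongrightarrow> x" for s x
    unfolding smear_def
  proof (rule integral_dominated_convergence[of _ _ _ "\<lambda>\<omega>. B * \<bar>m \<omega>\<bar>"])
    show "integrable M (\<lambda>\<omega>. B * \<bar>m \<omega>\<bar>)" using m by simp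
    have lim: "(\<lambda>n. f (s n + X \<omega>)) \<longlonglongrightarrow> f (x + X \<omega>)" for \<omega>
      by (rule continuous_on_tendsto_compose[OF f]) (auto intro!: tendsto_intros s)
    show "AE \<omega> in M. (\<lambda>n. m \<omega> * f (s n + X \<omega>)) \<longlonglongrightarrow> m \<omega> * f (x + X \<omega>)"
      by (intro AE_I2 tendsto_mult tendsto_const lim)
    show "AE \<omega> in M. norm (m \<omega> * f (s n + X \<omega>)) \<le> B * \<bar>m \<omega>\<bar>" for n
      unfolding real_norm_def by (intro AE_I2 abs_mult_le[OF B])
  qed measurable
  then show ?thesis
    by (auto simp: continuous_on_sequentially o_def)
qed

text \<open>Differentiation under the integral: the remainder quotient tends to 0 pointwise and is
  dominated by 4B|m|.\<close>

lemma smear_has_grad: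
  assumes g: "has_grad f f1 f2" and cf: "continuous_on UNIV f" and cf1: "continuous_on UNIV f1"
    and cf2: "continuous_on UNIV f2"
    and B: "\<And>x. \<bar>f x\<bar> \<le> A" "\<And>x. \<bar>f1 x\<bar> \<le> B" "\<And>x. \<bar>f2 x\<bar> \<le> B"
  shows "has_grad (smear M X m f) (smear M X m f1) (smear M X m f2)"
  unfolding has_grad_def has_derivative_at
proof (intro allI conjI)
  fix x
  let ?D = "\<lambda>h::real^2. h$1 *\<^sub>R smear M X m f1 x + h$2 *\<^sub>R smear M X m f2 x"
  show "bounded_linear ?D"
    by (intro bounded_linear_add bounded_linear_scaleR_const bounded_linear_vec_nth)
  have [measurable]: "f \<in> borel_measurable borel" "f1 \<in> borel_measurable borel" "f2 \<in> borel_measurable borel"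
    using cf cf1 cf2 by (auto intro: borel_measurable_continuous_onI)
  have [measurable]: "m \<in> borel_measurable M" using m by auto
  note int = smear_integrable[OF _ B(1)] smear_integrable[OF _ B(2)] smear_integrable[OF _ B(3)]
  define r where "r h y = f (y + h) - f y - (h$1 * f1 y + h$2 * f2 y)" for h y
  have rm [measurable]: "r h \<in> borel_measurable borel" for h
    unfolding r_def by measurable
  have rb: "\<bar>r h y\<bar> \<le> 4 * B * norm h" for h y
    unfolding r_def by (rule CB_remainder_bound(2)[OF g B(2,3)])
  have eq: "smear M X m f (x + h) - smear M X m f x - ?D h = (\<integral>\<omega>. m \<omega> * r h (x + X \<omega>) \<partial>M)" for h
  proof -
    have i: "integrable M (\<lambda>\<omega>. m \<omega> * f (x + h + X \<omega>))" "integrable M (\<lambda>\<omega>. m \<omega> * f (x + X \<omega>))"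
      "integrable M (\<lambda>\<omega>. m \<omega> * f1 (x + X \<omega>))" "integrable M (\<lambda>\<omega>. m \<omega> * f2 (x + X \<omega>))"
      by (rule int; measurable)+
    have "(\<integral>\<omega>. m \<omega> * r h (x + X \<omega>) \<partial>M) = (\<integral>\<omega>. m \<omega> * f (x + h + X \<omega>) - m \<omega> * f (x + X \<omega>)
        - (h$1 * (m \<omega> * f1 (x + X \<omega>)) + h$2 * (m \<omega> * f2 (x + X \<omega>))) \<partial>M)"
      unfolding r_def by (rule Bochner_Integration.integral_cong) (auto simp: algebra_simps)
    also have "\<dots> = smear M X m f (x + h) - smear M X m f x - ?D h"
      using i by (simp add: smear_def)
    finally show ?thesis by simp
  qed
  show "(\<lambda>h. norm (smear M X m f (x + h) - smear M X m f x - ?D h) / norm h) \<midarrow>0\<rightarrow> 0"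
    unfolding eq LIMSEQ_SEQ_conv[symmetric]
  proof (intro allI impI)
    fix s :: "nat \<Rightarrow> real^2"
    assume s: "(\<forall>n. s n \<noteq> 0) \<and> s \<longlonglongrightarrow> 0"
    have "(\<lambda>n. (\<integral>\<omega>. m \<omega> * (r (s n) (x + X \<omega>) / norm (s n)) \<partial>M)) \<longlonglongrightarrow> (\<integral>\<omega>. 0 \<partial>M)"
    proof (rule integral_dominated_convergence[of _ _ _ "\<lambda>\<omega>. 4 * B * \<bar>m \<omega>\<bar>"])
      show "integrable M (\<lambda>\<omega>. 4 * B * \<bar>m \<omega>\<bar>)" using m by simp
      have lim: "(\<lambda>n. r (s n) y / norm (s n)) \<longlonglongrightarrow> 0" for y
      proof -
        have "(\<lambda>h. norm (r h y) / norm h) \<midarrow>0\<rightarrow> 0"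
          using spec[OF g[unfolded has_grad_def], of y] unfolding has_derivative_at r_def by simp
        then have "(\<lambda>n. norm (r (s n) y) / norm (s n)) \<longlonglongrightarrow> 0"
          unfolding LIMSEQ_SEQ_conv[symmetric] using s by blast
        then have "(\<lambda>n. norm (r (s n) y / norm (s n))) \<longlonglongrightarrow> 0" by simp
        then show ?thesis by (rule tendsto_norm_zero_cancel)
      qed
      show "AE \<omega> in M. (\<lambda>n. m \<omega> * (r (s n) (x + X \<omega>) / norm (s n))) \<longlonglongrightarrow> 0"
        by (intro AE_I2 tendsto_mult_right_zero lim)
      have bd: "\<bar>r (s n) y / norm (s n)\<bar> \<le> 4 * B" for n y
        using rb[of "s n" y] s by (simp add: field_simps)
      show "AE \<omega> in M. norm (m \<omega> * (r (s n) (x + X \<omega>) / norm (s n))) \<le> 4 * B * \<bar>m \<omega>\<bar>" for n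
        unfolding real_norm_def by (intro AE_I2 abs_mult_le bd)
    qed measurable
    then have "(\<lambda>n. (\<integral>\<omega>. m \<omega> * r (s n) (x + X \<omega>) \<partial>M) / norm (s n)) \<longlonglongrightarrow> 0" by simp
    from tendsto_norm_zero[OF this]
    show "(\<lambda>n. norm (\<integral>\<omega>. m \<omega> * r (s n) (x + X \<omega>) \<partial>M) / norm (s n)) \<longlonglongrightarrow> 0" by simp
  qed
qed

lemma smear_CB: "CB k f \<Longrightarrow> CB k (smear M X m f)"
proof (induction k arbitrary: f)
  case 0
  obtain B where B: "\<And>x. \<bar>f x\<bar> \<le> B" using CB_measurable_bound(2)[OF 0] by auto
  have "bounded (range (smear M X m f))"
    using smear_bound[OF CB_measurable_bound(1)[OF 0] B] by (auto simp: bounded_iff)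
  then show ?case using smear_continuous[OF CB_continuous[OF 0] B] by simp
next
  case (Suc k)
  obtain f1 f2 where *: "has_grad f f1 f2" "CB k f1" "CB k f2" by (rule CB_SucE[OF Suc.prems])
  obtain B where B: "\<And>x. \<bar>f x\<bar> \<le> B" using CB_measurable_bound(2)[OF Suc.prems] by auto
  obtain B1 B2 where B12: "\<And>x. \<bar>f1 x\<bar> \<le> B1" "\<And>x. \<bar>f2 x\<bar> \<le> B2"
    using CB_measurable_bound(2)[OF *(2)] CB_measurable_bound(2)[OF *(3)] by auto
  have b: "bounded (range (smear M X m f))"
    using smear_bound[OF CB_measurable_bound(1)[OF Suc.prems] B] by (auto simp: bounded_iff)
  have "has_grad (smear M X m f) (smear M X m f1) (smear M X m f2)"
    by (rule smear_has_grad[OF *(1) CB_continuous[OF Suc.prems] CB_continuous[OF *(2)] CB_continuous[OF *(3)] B,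
       of "max B1 B2"]) (use B12 in \<open>auto intro: max.coboundedI1 max.coboundedI2\<close>)
  then show ?case by (rule CB_SucI[OF b _ Suc.IH[OF *(2)] Suc.IH[OF *(3)]])
qed

end

text \<open>The gradient relation passes to pointwise limits because each increment is the integral of the
  derivative along a segment.\<close>

lemma has_grad_limit:
  fixes w :: "real^2 \<Rightarrow> real"
  assumes g: "\<And>n. has_grad (w' n) (g1' n) (g2' n)"
    and c: "\<And>n. continuous_on UNIV (g1' n)" "\<And>n. continuous_on UNIV (g2' n)"
    and B: "\<And>n x. \<bar>g1' n x\<bar> \<le> B" "\<And>n x. \<bar>g2' n x\<bar> \<le> B"
    and lim: "\<And>x. (\<lambda>n. w' n x) \<longlonglongrightarrow> w x" "\<And>x. (\<lambda>n. g1' n x) \<longlonglongrightarrow> g1 x" "\<And>x. (\<lambda>n. g2' n x) \<longlonglongrightarrow> g2 x"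
    and cg: "continuous_on UNIV g1" "continuous_on UNIV g2"
  shows "has_grad w g1 g2"
proof -
  have int: "((\<lambda>s. h$1 * g1 (x + s *\<^sub>R h) + h$2 * g2 (x + s *\<^sub>R h)) has_integral w (x + h) - w x) {0..1}" for x h
  proof -
    let ?F = "\<lambda>n s. h$1 * g1' n (x + s *\<^sub>R h) + h$2 * g2' n (x + s *\<^sub>R h)"
    let ?G = "\<lambda>s. h$1 * g1 (x + s *\<^sub>R h) + h$2 * g2 (x + s *\<^sub>R h)"
    have hi: "(?F n has_integral w' n (x + 1 *\<^sub>R h) - w' n (x + 0 *\<^sub>R h)) {0..1}" for n
    proof (rule fundamental_theorem_of_calculus)
      fix s :: real
      have "((\<lambda>s. x + s *\<^sub>R h) has_derivative (\<lambda>t. t *\<^sub>R h)) (at s within {0..1})"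
        by (auto intro!: derivative_eq_intros)
      from has_derivative_compose[OF this spec[OF g[unfolded has_grad_def]]]
      show "((\<lambda>s. w' n (x + s *\<^sub>R h)) has_vector_derivative ?F n s) (at s within {0..1})"
        by (simp add: has_vector_derivative_def algebra_simps)
    qed simp
    have bd: "norm (?F n s) \<le> 2 * B * norm h" for n s
    proof -
      have "\<bar>h$1 * g1' n (x + s *\<^sub>R h)\<bar> \<le> norm h * B" "\<bar>h$2 * g2' n (x + s *\<^sub>R h)\<bar> \<le> norm h * B"
        unfolding abs_mult using B by (intro mult_mono component_le_norm_cart; force)+
      then show ?thesis by (simp add: algebra_simps)
    qed
    have ii: "?F n integrable_on {0..1}" for n using hi by blast
    have conv: "(\<lambda>n. ?F n s) \<longlonglongrightarrow> ?G s" for s by (intro tendsto_intros lim)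
    have ci: "(\<lambda>s. 2 * B * norm h) integrable_on {0..1::real}" by (rule integrable_const_ivl)
    note dc = dominated_convergence[of ?F "{0..1}" "\<lambda>s. 2 * B * norm h" ?G, OF ii ci bd conv]
    have "(\<lambda>n. integral {0..1} (?F n)) \<longlonglongrightarrow> w (x + h) - w x"
      unfolding integral_unique[OF hi] by (simp, intro tendsto_intros lim)
    with dc(2) have eq: "integral {0..1} ?G = w (x + h) - w x" by (rule LIMSEQ_unique)
    show ?thesis using integrable_integral[OF dc(1)] unfolding eq .
  qed
  show ?thesis
    unfolding has_grad_def has_derivative_at_alt
  proof (intro allI conjI impI)
    fix x
    show "bounded_linear (\<lambda>h::real^2. h$1 *\<^sub>R g1 x + h$2 *\<^sub>R g2 x)"
      by (intro bounded_linear_add bounded_linear_scaleR_const bounded_linear_vec_nth)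
    fix e :: real assume e: "e > 0"
    obtain d1 where d1: "d1 > 0" "\<And>y. dist y x < d1 \<Longrightarrow> dist (g1 y) (g1 x) < e/2"
      using cg(1) e unfolding continuous_on_iff by (metis UNIV_I half_gt_zero)
    obtain d2 where d2: "d2 > 0" "\<And>y. dist y x < d2 \<Longrightarrow> dist (g2 y) (g2 x) < e/2"
      using cg(2) e unfolding continuous_on_iff by (metis UNIV_I half_gt_zero)
    show "\<exists>d>0. \<forall>y. norm (y - x) < d \<longrightarrow>
       norm (w y - w x - ((y - x)$1 *\<^sub>R g1 x + (y - x)$2 *\<^sub>R g2 x)) \<le> e * norm (y - x)"
    proof (intro exI[of _ "min d1 d2"] conjI allI impI)
      show "min d1 d2 > 0" using d1 d2 by simp
      fix y assume y: "norm (y - x) < min d1 d2"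
      define h where "h = y - x"
      have "((\<lambda>s. (h$1 * g1 (x + s *\<^sub>R h) + h$2 * g2 (x + s *\<^sub>R h)) - (h$1 * g1 x + h$2 * g2 x))
          has_integral (w (x + h) - w x) - (1 - 0) *\<^sub>R (h$1 * g1 x + h$2 * g2 x)) {0..1}"
        using has_integral_const_real[of "h$1 * g1 x + h$2 * g2 x" 0 1]
        by (intro has_integral_diff int) simp
      moreover have "norm ((h$1 * g1 (x + s *\<^sub>R h) + h$2 * g2 (x + s *\<^sub>R h)) - (h$1 * g1 x + h$2 * g2 x))
          \<le> e * norm h" if s: "s \<in> cbox 0 1" for s :: real
      proof -
        have "norm (s *\<^sub>R h) \<le> 1 * norm h" unfolding norm_scaleR using s by (intro mult_right_mono) auto
        then have "dist (x + s *\<^sub>R h) x < d1" "dist (x + s *\<^sub>R h) x < d2"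
          using y unfolding h_def dist_norm by auto
        then have a: "\<bar>g1 (x + s *\<^sub>R h) - g1 x\<bar> \<le> e/2" "\<bar>g2 (x + s *\<^sub>R h) - g2 x\<bar> \<le> e/2"
          using d1(2) d2(2) unfolding dist_real_def by (meson less_imp_le)+
        have b: "\<bar>h$1 * (g1 (x + s *\<^sub>R h) - g1 x)\<bar> \<le> norm h * (e/2)" "\<bar>h$2 * (g2 (x + s *\<^sub>R h) - g2 x)\<bar> \<le> norm h * (e/2)"
          unfolding abs_mult using a by (intro mult_mono component_le_norm_cart; force)+
        have "(h$1 * g1 (x + s *\<^sub>R h) + h$2 * g2 (x + s *\<^sub>R h)) - (h$1 * g1 x + h$2 * g2 x) =
          h$1 * (g1 (x + s *\<^sub>R h) - g1 x) + h$2 * (g2 (x + s *\<^sub>R h) - g2 x)" by (simp add: algebra_simps)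
        then show ?thesis
          unfolding real_norm_def
          using order_trans[OF abs_triangle_ineq add_mono[OF b]] by (simp add: mult.commute)
      qed
      ultimately have "norm ((w (x + h) - w x) - (1 - 0) *\<^sub>R (h$1 * g1 x + h$2 * g2 x)) \<le>
          e * norm h * measure lborel (cbox 0 (1::real))"
        using e by (intro has_integral_bound[of "e * norm h"]) (auto simp del: real_norm_def)
      then show "norm (w y - w x - ((y - x)$1 *\<^sub>R g1 x + (y - x)$2 *\<^sub>R g2 x)) \<le> e * norm (y - x)"
        by (simp add: h_def)
    qed
  qed
qed

section \<open>The resolvent of the Laplacian\<close>

definition gauss :: "real measure" where
  "gauss = density lborel std_normal_density"

text \<open>The radial time variable of the resolvent: a finite measure of mass sqrt(pi)/2, not a
  probability measure.\<close>

definition half_gauss :: "real measure" where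
  "half_gauss = density lborel (\<lambda>t. indicator {0..} t * exp (- t\<^sup>2))"

lemma sets_gauss [measurable_cong, simp]: "sets gauss = sets borel" by (simp add: gauss_def)
lemma sets_half_gauss [measurable_cong, simp]: "sets half_gauss = sets borel" by (simp add: half_gauss_def)
lemma space_gauss [simp]: "space gauss = UNIV" by (simp add: gauss_def)
lemma space_half_gauss [simp]: "space half_gauss = UNIV" by (simp add: half_gauss_def)

interpretation gauss: prob_space gauss
  unfolding gauss_def by (rule prob_space_normal_density) simp

lemma half_gauss_integrable:
  "integrable half_gauss f \<longleftrightarrow> integrable lborel (\<lambda>t. (indicator {0..} t * exp (- t\<^sup>2)) * f t)"
  if [measurable]: "f \<in> borel_measurable borel" for f :: "real \<Rightarrow> real"
  unfolding half_gauss_def by (subst integrable_density) auto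

lemma half_gauss_moments:
  "integrable half_gauss (\<lambda>t. 1::real)" "integrable half_gauss (\<lambda>t. t)"
  using integrable.intros[OF gaussian_moment_0]
    integrable.intros[OF gaussian_moment_1]
  by (simp_all add: half_gauss_integrable mult.assoc)

interpretation half_gauss: finite_measure half_gauss
proof (rule finite_measureI)
  have "integrable half_gauss (indicator UNIV :: real \<Rightarrow> real)" using half_gauss_moments(1) by simp
  then show "emeasure half_gauss (space half_gauss) \<noteq> \<infinity>"
    by (subst (asm) integrable_indicator_iff) simp
qed

lemma gauss_moments: "integrable gauss (\<lambda>z. 1::real)" "integrable gauss (\<lambda>z. z)"
proof -
  show "integrable gauss (\<lambda>z. 1::real)" by simp
  show "integrable gauss (\<lambda>z. z)"
    unfolding gauss_def using integrable_std_normal_moment[of 1]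
    by (subst integrable_density) auto
qed

text \<open>Stein's identity E[Z g(Z)] = E[g'(Z)]. Against the density the integrand is minus the
  derivative of density times g, and boundedness of g kills both boundary terms. It serves to move
  derivatives from f onto the kernel.\<close>

lemma gauss_by_parts:
  fixes g g' :: "real \<Rightarrow> real"
  assumes g: "\<And>z. (g has_real_derivative g' z) (at z)" and c: "continuous_on UNIV g'"
    and B: "\<And>z. \<bar>g z\<bar> \<le> B" "\<And>z. \<bar>g' z\<bar> \<le> B"
  shows "(\<integral>z. z * g z - g' z \<partial>gauss) = 0"
proof -
  have cg: "continuous_on UNIV g"
    using g by (meson DERIV_isCont continuous_at_imp_continuous_on)
  have [measurable]: "g \<in> borel_measurable borel" "g' \<in> borel_measurable borel"
    using cg c by (auto intro: borel_measurable_continuous_onI)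
  let ?f = "\<lambda>z. std_normal_density z * (g' z - z * g z)"
  have d: "(std_normal_density has_real_derivative (- z * std_normal_density z)) (at z)" for z
    unfolding std_normal_density_def by (auto intro!: derivative_eq_intros simp: field_simps)
  have lim: "(std_normal_density \<longlongrightarrow> 0) at_top" "(std_normal_density \<longlongrightarrow> 0) at_bot"
    unfolding std_normal_density_def by real_asymp+
  have lim': "((\<lambda>z. std_normal_density z * g z) \<longlongrightarrow> 0) F" if "(std_normal_density \<longlongrightarrow> 0) F" for F
  proof (rule Lim_null_comparison)
    show "\<forall>\<^sub>F z in F. norm (std_normal_density z * g z) \<le> std_normal_density z * B"
      using B(1) by (intro always_eventually allI) (simp add: abs_mult mult_left_mono)
    show "((\<lambda>z. std_normal_density z * B) \<longlongrightarrow> 0) F"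
      using tendsto_mult_left_zero[OF that] by simp
  qed
  have int: "integrable lborel ?f"
  proof (rule Bochner_Integration.integrable_bound)
    show "integrable lborel (\<lambda>z. B * (std_normal_density z * \<bar>z\<bar> ^ 0) + B * (std_normal_density z * \<bar>z\<bar> ^ 1))"
      by (intro Bochner_Integration.integrable_add integrable_mult_right integrable_std_normal_moment_abs)
    show "AE z in lborel. norm (?f z) \<le> norm (B * (std_normal_density z * \<bar>z\<bar> ^ 0) + B * (std_normal_density z * \<bar>z\<bar> ^ 1))"
    proof (rule AE_I2)
      fix z :: real
      have "\<bar>g' z - z * g z\<bar> \<le> B + B * \<bar>z\<bar>"
        using B(2)[of z] abs_mult_le[OF B(1)[of z], of z] by linarith
      then have "\<bar>?f z\<bar> \<le> std_normal_density z * (B + B * \<bar>z\<bar>)"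
        by (simp add: abs_mult mult_left_mono)
      then show "norm (?f z) \<le> norm (B * (std_normal_density z * \<bar>z\<bar> ^ 0) + B * (std_normal_density z * \<bar>z\<bar> ^ 1))"
        by (simp add: algebra_simps)
    qed
  qed measurable
  have "(LBINT z=-\<infinity>..\<infinity>. ?f z) = 0 - 0"
  proof (rule interval_integral_FTC_integrable)
    show "((\<lambda>z. std_normal_density z * g z) has_vector_derivative ?f z) (at z)" for z
      using DERIV_mult[OF d g, of z]
      by (simp add: has_real_derivative_iff_has_vector_derivative algebra_simps)
    have "continuous_on UNIV ?f"
      unfolding std_normal_density_def by (intro continuous_intros c cg) auto
    then show "isCont ?f z" for z by (simp add: continuous_on_eq_continuous_at)
    show "set_integrable lborel (einterval (-\<infinity>) \<infinity>) ?f"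
      using int by (simp add: set_integrable_def einterval_def)
    show "(((\<lambda>z. std_normal_density z * g z) \<circ> real_of_ereal) \<longlongrightarrow> 0) (at_right (-\<infinity>))"
      unfolding ereal_tendsto_simps1 by (rule lim'[OF lim(2)])
    show "(((\<lambda>z. std_normal_density z * g z) \<circ> real_of_ereal) \<longlongrightarrow> 0) (at_left \<infinity>)"
      unfolding ereal_tendsto_simps1 by (rule lim'[OF lim(1)])
  qed simp
  then have z: "(\<integral>z. ?f z \<partial>lborel) = 0"
    by (simp add: interval_integral_to_infinity_eq interval_lebesgue_integral_def set_lebesgue_integral_def einterval_def)
  have "(\<integral>z. z * g z - g' z \<partial>gauss) = (\<integral>z. - ?f z \<partial>lborel)"
    unfolding gauss_def by (subst integral_density) (auto simp: algebra_simps)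
  then show ?thesis using z by simp
qed

text \<open>The same integration by parts on a half line keeps the boundary term at t = 0; this term
  becomes the identity operator in the resolvent equation.\<close>

lemma half_gauss_by_parts:
  fixes g g' :: "real \<Rightarrow> real"
  assumes g: "\<And>t. (g has_real_derivative g' t) (at t)" and c: "continuous_on UNIV g'"
    and B: "\<And>t. \<bar>g t\<bar> \<le> B" "\<And>t. \<bar>g' t\<bar> \<le> B"
  shows "(\<integral>t. 2 * t * g t - g' t \<partial>half_gauss) = g 0"
proof -
  have cg: "continuous_on UNIV g"
    using g by (meson DERIV_isCont continuous_at_imp_continuous_on)
  have [measurable]: "g \<in> borel_measurable borel" "g' \<in> borel_measurable borel"
    using cg c by (auto intro: borel_measurable_continuous_onI)
  let ?f = "\<lambda>t. exp (- t\<^sup>2) * (g' t - 2 * t * g t)"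
  have lim: "((\<lambda>t. exp (- t\<^sup>2) * g t) \<longlongrightarrow> 0) at_top"
  proof (rule Lim_null_comparison)
    show "\<forall>\<^sub>F t in at_top. norm (exp (- t\<^sup>2) * g t) \<le> exp (- t\<^sup>2) * B"
      using B(1) by (intro always_eventually allI) (simp add: abs_mult)
    show "((\<lambda>t. exp (- t\<^sup>2) * B) \<longlongrightarrow> 0) at_top"
      by (rule tendsto_mult_left_zero) real_asymp
  qed
  have int: "integrable lborel (\<lambda>t. indicator {0..} t *\<^sub>R ?f t)"
  proof (rule Bochner_Integration.integrable_bound)
    show "integrable lborel (\<lambda>t. B * (indicator {0..} t *\<^sub>R exp (- t\<^sup>2)) + 2 * B * (indicator {0..} t *\<^sub>R (exp (- t\<^sup>2) * t)))"
      by (intro Bochner_Integration.integrable_add integrable_mult_right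
        integrable.intros[OF gaussian_moment_0] integrable.intros[OF gaussian_moment_1])
    show "AE t in lborel. norm (indicator {0..} t *\<^sub>R ?f t) \<le>
      norm (B * (indicator {0..} t *\<^sub>R exp (- t\<^sup>2)) + 2 * B * (indicator {0..} t *\<^sub>R (exp (- t\<^sup>2) * t)))"
    proof (rule AE_I2)
      fix t :: real
      have "\<bar>g' t - 2 * t * g t\<bar> \<le> B + B * \<bar>2 * t\<bar>"
        using B(2)[of t] abs_mult_le[OF B(1)[of t], of "2 * t"] by linarith
      then have "exp (- t\<^sup>2) * \<bar>g' t - 2 * t * g t\<bar> \<le> exp (- t\<^sup>2) * (B + B * \<bar>2 * t\<bar>)"
        by (rule mult_left_mono) simp
      moreover have "B \<ge> 0" using B(1)[of t] by linarith
      ultimately show "norm (indicator {0..} t *\<^sub>R ?f t) \<le>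
        norm (B * (indicator {0..} t *\<^sub>R exp (- t\<^sup>2)) + 2 * B * (indicator {0..} t *\<^sub>R (exp (- t\<^sup>2) * t)))"
        by (cases "0 \<le> t") (simp_all add: abs_mult right_diff_distrib[symmetric] distrib_left mult.assoc mult.left_commute mult.commute[of B])
    qed
  qed measurable
  have "(LBINT t=0..\<infinity>. ?f t) = 0 - g 0"
  proof (rule interval_integral_FTC_integrable)
    have d: "((\<lambda>t. exp (- t\<^sup>2)) has_real_derivative (- 2 * t * exp (- t\<^sup>2))) (at t)" for t :: real
      by (auto intro!: derivative_eq_intros)
    show "((\<lambda>t. exp (- t\<^sup>2) * g t) has_vector_derivative ?f t) (at t)" for t
      using DERIV_mult[OF d g, of t]
      by (simp add: has_real_derivative_iff_has_vector_derivative algebra_simps)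
    have "continuous_on UNIV ?f" by (intro continuous_intros c cg)
    then show "isCont ?f t" for t by (simp add: continuous_on_eq_continuous_at)
    show "set_integrable lborel (einterval 0 \<infinity>) ?f"
      unfolding set_integrable_def
    proof (rule Bochner_Integration.integrable_bound[OF int])
      show "AE x in lborel. norm (indicat_real (einterval 0 \<infinity>) x *\<^sub>R ?f x) \<le> norm (indicat_real {0..} x *\<^sub>R ?f x)"
        by (intro AE_I2) (auto simp: indicator_def einterval_def)
    qed measurable
    have "continuous_on UNIV (\<lambda>t. exp (- t\<^sup>2) * g t)" by (intro continuous_intros cg)
    then have "((\<lambda>t. exp (- t\<^sup>2) * g t) \<longlongrightarrow> exp (- 0\<^sup>2) * g 0) (at 0)"
      by (auto simp: continuous_on_def dest: spec[of _ 0])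
    then have "((\<lambda>t. exp (- t\<^sup>2) * g t) \<longlongrightarrow> g 0) (at_right 0)"
      by (simp add: filterlim_at_split)
    then show "(((\<lambda>t. exp (- t\<^sup>2) * g t) \<circ> real_of_ereal) \<longlongrightarrow> g 0) (at_right 0)"
      unfolding zero_ereal_def ereal_tendsto_simps1 .
    show "(((\<lambda>t. exp (- t\<^sup>2) * g t) \<circ> real_of_ereal) \<longlongrightarrow> 0) (at_left \<infinity>)"
      unfolding ereal_tendsto_simps1 by (rule lim)
  qed simp
  then have z: "(\<integral>t. indicator {0<..} t * ?f t \<partial>lborel) = - g 0"
    by (simp add: interval_lebesgue_integral_def set_lebesgue_integral_def einterval_def greaterThan_def)
  have "(\<integral>t. 2 * t * g t - g' t \<partial>half_gauss) = (\<integral>t. - (indicator {0..} t * ?f t) \<partial>lborel)"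
    unfolding half_gauss_def by (subst integral_density) (auto simp: algebra_simps)
  also have "\<dots> = (\<integral>t. - (indicator {0<..} t * ?f t) \<partial>lborel)"
  proof (rule integral_cong_AE)
    show "AE t in lborel. - (indicator {0..} t * ?f t) = - (indicator {0<..} t * ?f t)"
      using AE_lborel_singleton[of 0] by eventually_elim (auto simp: indicator_def)
  qed measurable
  also have "\<dots> = g 0" using z by simp
  finally show ?thesis .
qed

definition heat_measure :: "(real \<times> real \<times> real) measure" where
  "heat_measure = half_gauss \<Otimes>\<^sub>M (gauss \<Otimes>\<^sub>M gauss)"

definition heat_shift :: "real \<Rightarrow> real \<times> real \<times> real \<Rightarrow> real^2" where
  "heat_shift c = (\<lambda>(t, a, b). (c * t * a) *\<^sub>R axis 1 1 + (c * t * b) *\<^sub>R axis 2 1)"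

text \<open>With \<open>\<lambda> = 2 / c\<^sup>2\<close>, the operator \<open>resolv c\<close> is \<open>(\<lambda> - \<Delta>)\<^sup>-\<^sup>1 = \<integral> e\<^sup>-\<^sup>\<lambda>\<^sup>s e\<^sup>s\<^sup>\<Delta> ds\<close> after the
  substitution \<open>s = c\<^sup>2 t\<^sup>2 / 2\<close>, which removes the singularity of the gradient kernel at \<open>s = 0\<close>;
  \<open>resolv1 c\<close> and \<open>resolv2 c\<close> are its partial derivatives with the derivative on the kernel.\<close>

definition resolv :: "real \<Rightarrow> (real^2 \<Rightarrow> real) \<Rightarrow> real^2 \<Rightarrow> real" where
  "resolv c = smear heat_measure (heat_shift c) (\<lambda>\<omega>. c\<^sup>2 * fst \<omega>)"

definition resolv1 :: "real \<Rightarrow> (real^2 \<Rightarrow> real) \<Rightarrow> real^2 \<Rightarrow> real" where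
  "resolv1 c = smear heat_measure (heat_shift c) (\<lambda>\<omega>. c * fst (snd \<omega>))"

definition resolv2 :: "real \<Rightarrow> (real^2 \<Rightarrow> real) \<Rightarrow> real^2 \<Rightarrow> real" where
  "resolv2 c = smear heat_measure (heat_shift c) (\<lambda>\<omega>. c * snd (snd \<omega>))"

interpretation gauss2: pair_prob_space gauss gauss ..
interpretation heat: pair_sigma_finite half_gauss "gauss \<Otimes>\<^sub>M gauss" ..

lemma sets_heat_measure [measurable_cong, simp]: "sets heat_measure = sets borel"
proof -
  have "sets heat_measure = sets (borel \<Otimes>\<^sub>M (borel \<Otimes>\<^sub>M borel) :: (real \<times> real \<times> real) measure)"
    unfolding heat_measure_def by (intro sets_pair_measure_cong) auto
  then show ?thesis by (simp only: borel_prod)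
qed

lemma heat_shift_measurable [measurable]: "heat_shift c \<in> borel_measurable heat_measure"
proof -
  have "continuous_on UNIV (heat_shift c)"
    unfolding heat_shift_def case_prod_beta by (intro continuous_intros)
  then have "heat_shift c \<in> borel_measurable borel" by (rule borel_measurable_continuous_onI)
  then show ?thesis by simp
qed

lemma (in pair_sigma_finite) integrable_prod_mult:
  fixes u :: "'a \<Rightarrow> real" and v :: "'b \<Rightarrow> real"
  assumes u: "integrable M1 u" and v: "integrable M2 v"
  shows "integrable (M1 \<Otimes>\<^sub>M M2) (\<lambda>(x, y). u x * v y)"
proof (rule Fubini_integrable)
  have [measurable]: "u \<in> borel_measurable M1" "v \<in> borel_measurable M2" using u v by auto
  show "(\<lambda>(x, y). u x * v y) \<in> borel_measurable (M1 \<Otimes>\<^sub>M M2)" by measurable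
  show "integrable M1 (\<lambda>x. \<integral>y. norm (case (x, y) of (x, y) \<Rightarrow> u x * v y) \<partial>M2)"
    using u by (simp add: abs_mult)
  show "AE x in M1. integrable M2 (\<lambda>y. case (x, y) of (x, y) \<Rightarrow> u x * v y)"
    using v by simp
qed

lemma gauss2_moments:
  "integrable (gauss \<Otimes>\<^sub>M gauss) (\<lambda>p. 1::real)"
  "integrable (gauss \<Otimes>\<^sub>M gauss) (\<lambda>(a, b). a)" "integrable (gauss \<Otimes>\<^sub>M gauss) (\<lambda>(a, b). b)"
  using gauss2.integrable_prod_mult[OF gauss_moments(2,1)] gauss2.integrable_prod_mult[OF gauss_moments(1,2)]
  by simp_all

lemma heat_weights:
  "integrable heat_measure (\<lambda>\<omega>. c * fst \<omega>)"
  "integrable heat_measure (\<lambda>\<omega>. c * fst (snd \<omega>))"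
  "integrable heat_measure (\<lambda>\<omega>. c * snd (snd \<omega>))"
  unfolding heat_measure_def
  using integrable_mult_right[of c, OF heat.integrable_prod_mult[OF half_gauss_moments(2) gauss2_moments(1)]]
    integrable_mult_right[of c, OF heat.integrable_prod_mult[OF half_gauss_moments(1) gauss2_moments(2)]]
    integrable_mult_right[of c, OF heat.integrable_prod_mult[OF half_gauss_moments(1) gauss2_moments(3)]]
  by (simp_all only: case_prod_beta mult_1_left mult_1_right)

lemma heat_shift_deriv:
  fixes f :: "real^2 \<Rightarrow> real"
  assumes g: "has_grad f f1 f2"
  shows "((\<lambda>a. f (x + heat_shift c (t, a, b))) has_real_derivative c * t * f1 (x + heat_shift c (t, a, b))) (at a)"
    and "((\<lambda>b. f (x + heat_shift c (t, a, b))) has_real_derivative c * t * f2 (x + heat_shift c (t, a, b))) (at b)"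
    and "((\<lambda>t. f (x + heat_shift c (t, a, b))) has_real_derivative
      c * a * f1 (x + heat_shift c (t, a, b)) + c * b * f2 (x + heat_shift c (t, a, b))) (at t)"
proof -
  have chain: "((\<lambda>s. f (h s)) has_real_derivative d1 * f1 (h s) + d2 * f2 (h s)) (at s)"
    if "(h has_derivative (\<lambda>r. r *\<^sub>R (d1 *\<^sub>R axis 1 1 + d2 *\<^sub>R axis 2 1))) (at s)" for h :: "real \<Rightarrow> real^2" and d1 d2 s
  proof -
    have "((\<lambda>s. f (h s)) has_derivative (\<lambda>r. (r *\<^sub>R (d1 *\<^sub>R axis 1 1 + d2 *\<^sub>R axis 2 1) :: real^2)$1 *\<^sub>R f1 (h s) +
        (r *\<^sub>R (d1 *\<^sub>R axis 1 1 + d2 *\<^sub>R axis 2 1) :: real^2)$2 *\<^sub>R f2 (h s))) (at s)"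
      by (rule has_derivative_compose[OF that spec[OF g[unfolded has_grad_def]]])
    then show ?thesis
      unfolding has_field_derivative_def by (rule has_derivative_eq_rhs) (auto simp: axis_def algebra_simps)
  qed
  have "((\<lambda>a. x + heat_shift c (t, a, b)) has_derivative (\<lambda>r. r *\<^sub>R ((c * t) *\<^sub>R axis 1 1 + 0 *\<^sub>R axis 2 1))) (at a)"
    unfolding heat_shift_def prod.case by (auto intro!: derivative_eq_intros simp: algebra_simps)
  from chain[OF this] show "((\<lambda>a. f (x + heat_shift c (t, a, b))) has_real_derivative c * t * f1 (x + heat_shift c (t, a, b))) (at a)"
    by simp
  have "((\<lambda>b. x + heat_shift c (t, a, b)) has_derivative (\<lambda>r. r *\<^sub>R (0 *\<^sub>R axis 1 1 + (c * t) *\<^sub>R axis 2 1))) (at b)"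
    unfolding heat_shift_def prod.case by (auto intro!: derivative_eq_intros simp: algebra_simps)
  from chain[OF this] show "((\<lambda>b. f (x + heat_shift c (t, a, b))) has_real_derivative c * t * f2 (x + heat_shift c (t, a, b))) (at b)"
    by simp
  have "((\<lambda>t. x + heat_shift c (t, a, b)) has_derivative (\<lambda>r. r *\<^sub>R ((c * a) *\<^sub>R axis 1 1 + (c * b) *\<^sub>R axis 2 1))) (at t)"
    unfolding heat_shift_def prod.case by (auto intro!: derivative_eq_intros simp: algebra_simps)
  from chain[OF this] show "((\<lambda>t. f (x + heat_shift c (t, a, b))) has_real_derivative
      c * a * f1 (x + heat_shift c (t, a, b)) + c * b * f2 (x + heat_shift c (t, a, b))) (at t)" .
qed

lemma heat_shift_continuous:
  fixes f :: "real^2 \<Rightarrow> real"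
  assumes "continuous_on UNIV f"
  shows "continuous_on UNIV (\<lambda>a. f (x + heat_shift c (t, a, b)))"
    and "continuous_on UNIV (\<lambda>b. f (x + heat_shift c (t, a, b)))"
    and "continuous_on UNIV (\<lambda>t. f (x + heat_shift c (t, a, b)))"
  unfolding heat_shift_def prod.case
  by (rule continuous_on_compose2[OF assms]; auto intro!: continuous_intros)+

context
  fixes f f1 f2 :: "real^2 \<Rightarrow> real" and A :: real
  assumes g: "has_grad f f1 f2"
    and c1: "continuous_on UNIV f1" and c2: "continuous_on UNIV f2"
    and B: "\<And>x. \<bar>f x\<bar> \<le> A" "\<And>x. \<bar>f1 x\<bar> \<le> A" "\<And>x. \<bar>f2 x\<bar> \<le> A"
begin

lemma resolv_measurable [measurable]:
  "f \<in> borel_measurable borel" "f1 \<in> borel_measurable borel" "f2 \<in> borel_measurable borel"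
  using has_grad_continuous[OF g] c1 c2 by (auto intro: borel_measurable_continuous_onI)

text \<open>Stein's identity in the first Gaussian variable at fixed t and b: the factor a is traded
  for a derivative of a -> f (x + c t (a, b)), which is c t f1. The weight c a thus turns into c^2
  t, the weight of \<open>resolv\<close>.\<close>

lemma resolv_by_parts1: "resolv1 c f x = resolv c f1 x"
proof -
  define D where "D = (\<lambda>(t, a, b). c * a * f (x + heat_shift c (t, a, b)) - c\<^sup>2 * t * f1 (x + heat_shift c (t, a, b)))"
  have i: "integrable heat_measure (\<lambda>\<omega>. (c * fst (snd \<omega>)) * f (x + heat_shift c \<omega>))"
    "integrable heat_measure (\<lambda>\<omega>. (c\<^sup>2 * fst \<omega>) * f1 (x + heat_shift c \<omega>))"
    by (rule smear_integrable[OF heat_shift_measurable heat_weights(2) resolv_measurable(1) B(1)]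
       smear_integrable[OF heat_shift_measurable heat_weights(1) resolv_measurable(2) B(2)])+
  have D: "D = (\<lambda>\<omega>. (c * fst (snd \<omega>)) * f (x + heat_shift c \<omega>) -
      (c\<^sup>2 * fst \<omega>) * f1 (x + heat_shift c \<omega>))"
    by (auto simp: D_def)
  have iD: "integrable heat_measure D" unfolding D by (intro Bochner_Integration.integrable_diff i)
  have A0: "A \<ge> 0" using B(1)[of 0] by linarith
  have z: "(\<integral>a. D (t, a, b) \<partial>gauss) = 0" for t b
  proof -
    have "(\<integral>a. a * f (x + heat_shift c (t, a, b)) - c * t * f1 (x + heat_shift c (t, a, b)) \<partial>gauss) = 0"
    proof (rule gauss_by_parts[of _ _ "A + \<bar>c * t\<bar> * A"])
      show "\<bar>f (x + heat_shift c (t, a, b))\<bar> \<le> A + \<bar>c * t\<bar> * A" for a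
        using B(1)[of "x + heat_shift c (t, a, b)"] mult_nonneg_nonneg[OF abs_ge_zero[of "c * t"] A0] by linarith
      show "\<bar>c * t * f1 (x + heat_shift c (t, a, b))\<bar> \<le> A + \<bar>c * t\<bar> * A" for a
        using abs_mult_le[OF B(2)[of "x + heat_shift c (t, a, b)"], of "c * t"] A0
        by (simp only: mult.commute[of A])
    qed (auto intro!: heat_shift_deriv[OF g] continuous_intros heat_shift_continuous[OF c1])
    then have "(\<integral>a. c * (a * f (x + heat_shift c (t, a, b)) - c * t * f1 (x + heat_shift c (t, a, b))) \<partial>gauss) = 0"
      by simp
    then show ?thesis by (simp add: D_def algebra_simps power2_eq_square)
  qed
  \<comment> \<open>A slice that fails to be integrable has integral 0 by convention, so both cases
    give the same value.\<close>
  have z2: "(\<integral>p. D (t, p) \<partial>(gauss \<Otimes>\<^sub>M gauss)) = 0" for t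
  proof (cases "integrable (gauss \<Otimes>\<^sub>M gauss) (\<lambda>(a, b). D (t, a, b))")
    case True
    from gauss2.integral_snd[OF True] z show ?thesis by (simp add: case_prod_beta')
  next
    case False
    then show ?thesis by (simp add: not_integrable_integral_eq case_prod_beta')
  qed
  have "(\<integral>\<omega>. D \<omega> \<partial>heat_measure) = 0"
    using heat.integral_fst'[OF iD[unfolded heat_measure_def]] z2 by (simp add: heat_measure_def)
  then show ?thesis
    unfolding D resolv1_def resolv_def smear_def using Bochner_Integration.integral_diff[OF i] by simp
qed

lemma resolv_by_parts2: "resolv2 c f x = resolv c f2 x"
proof -
  define D where "D = (\<lambda>(t, a, b). c * b * f (x + heat_shift c (t, a, b)) - c\<^sup>2 * t * f2 (x + heat_shift c (t, a, b)))"
  have i: "integrable heat_measure (\<lambda>\<omega>. (c * snd (snd \<omega>)) * f (x + heat_shift c \<omega>))"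
    "integrable heat_measure (\<lambda>\<omega>. (c\<^sup>2 * fst \<omega>) * f2 (x + heat_shift c \<omega>))"
    by (rule smear_integrable[OF heat_shift_measurable heat_weights(3) resolv_measurable(1) B(1)]
       smear_integrable[OF heat_shift_measurable heat_weights(1) resolv_measurable(3) B(3)])+
  have D: "D = (\<lambda>\<omega>. (c * snd (snd \<omega>)) * f (x + heat_shift c \<omega>) -
      (c\<^sup>2 * fst \<omega>) * f2 (x + heat_shift c \<omega>))"
    by (auto simp: D_def)
  have iD: "integrable heat_measure D" unfolding D by (intro Bochner_Integration.integrable_diff i)
  have A0: "A \<ge> 0" using B(1)[of 0] by linarith
  have z: "(\<integral>b. D (t, a, b) \<partial>gauss) = 0" for t a
  proof -
    have "(\<integral>b. b * f (x + heat_shift c (t, a, b)) - c * t * f2 (x + heat_shift c (t, a, b)) \<partial>gauss) = 0"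
    proof (rule gauss_by_parts[of _ _ "A + \<bar>c * t\<bar> * A"])
      show "\<bar>f (x + heat_shift c (t, a, b))\<bar> \<le> A + \<bar>c * t\<bar> * A" for b
        using B(1)[of "x + heat_shift c (t, a, b)"] mult_nonneg_nonneg[OF abs_ge_zero[of "c * t"] A0] by linarith
      show "\<bar>c * t * f2 (x + heat_shift c (t, a, b))\<bar> \<le> A + \<bar>c * t\<bar> * A" for b
        using abs_mult_le[OF B(3)[of "x + heat_shift c (t, a, b)"], of "c * t"] A0
        by (simp only: mult.commute[of A])
    qed (auto intro!: heat_shift_deriv[OF g] continuous_intros heat_shift_continuous[OF c2])
    then have "(\<integral>b. c * (b * f (x + heat_shift c (t, a, b)) - c * t * f2 (x + heat_shift c (t, a, b))) \<partial>gauss) = 0"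
      by simp
    then show ?thesis by (simp add: D_def algebra_simps power2_eq_square)
  qed
  have z2: "(\<integral>p. D (t, p) \<partial>(gauss \<Otimes>\<^sub>M gauss)) = 0" for t
  proof (cases "integrable (gauss \<Otimes>\<^sub>M gauss) (\<lambda>p. D (t, p))")
    case True
    from gauss2.integral_fst'[OF True] z show ?thesis by simp
  next
    case False
    then show ?thesis by (rule not_integrable_integral_eq)
  qed
  have "(\<integral>\<omega>. D \<omega> \<partial>heat_measure) = 0"
    using heat.integral_fst'[OF iD[unfolded heat_measure_def]] z2 by (simp add: heat_measure_def)
  then show ?thesis
    unfolding D resolv2_def resolv_def smear_def using Bochner_Integration.integral_diff[OF i] by simp
qed

text \<open>The resolvent equation with one derivative left on f. For fixed (a, b) the function t ->
  f (x + c t (a, b)) has derivative c a f1 + c b f2 and value f x at t = 0, so integration by parts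
  in t produces f x.\<close>

lemma resolv_time_by_parts:
  assumes c: "c > 0"
  shows "2 / c\<^sup>2 * resolv c f x - resolv1 c f1 x - resolv2 c f2 x = f x"
proof -
  let ?y = "\<lambda>\<omega>. x + heat_shift c \<omega>"
  define D where "D = (\<lambda>(t, a, b). 2 * t * f (?y (t, a, b)) - (c * a * f1 (?y (t, a, b)) + c * b * f2 (?y (t, a, b))))"
  have i: "integrable heat_measure (\<lambda>\<omega>. (c\<^sup>2 * fst \<omega>) * f (?y \<omega>))"
    "integrable heat_measure (\<lambda>\<omega>. (c * fst (snd \<omega>)) * f1 (?y \<omega>))"
    "integrable heat_measure (\<lambda>\<omega>. (c * snd (snd \<omega>)) * f2 (?y \<omega>))"
    by (rule smear_integrable[OF heat_shift_measurable heat_weights(1) resolv_measurable(1) B(1)]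
       smear_integrable[OF heat_shift_measurable heat_weights(2) resolv_measurable(2) B(2)]
       smear_integrable[OF heat_shift_measurable heat_weights(3) resolv_measurable(3) B(3)])+
  have D: "D = (\<lambda>\<omega>. 2 / c\<^sup>2 * ((c\<^sup>2 * fst \<omega>) * f (?y \<omega>)) -
      ((c * fst (snd \<omega>)) * f1 (?y \<omega>) + (c * snd (snd \<omega>)) * f2 (?y \<omega>)))"
    using c by (auto simp: D_def)
  have iD: "integrable heat_measure D"
    unfolding D by (intro Bochner_Integration.integrable_diff Bochner_Integration.integrable_add integrable_mult_right i)
  have z: "(\<integral>t. D (t, p) \<partial>half_gauss) = f x" for p
  proof -
    obtain a b where p: "p = (a, b)" by force
    let ?B = "A + (\<bar>c * a\<bar> * A + \<bar>c * b\<bar> * A)"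
    have A0: "A \<ge> 0" using B(1)[of 0] by linarith
    have "(\<integral>t. 2 * t * f (?y (t, a, b)) - (c * a * f1 (?y (t, a, b)) + c * b * f2 (?y (t, a, b))) \<partial>half_gauss) =
        f (?y (0, a, b))"
    proof (rule half_gauss_by_parts[of _ _ ?B])
      have n: "0 \<le> \<bar>c * a\<bar> * A" "0 \<le> \<bar>c * b\<bar> * A" using A0 by simp_all
      show "\<bar>f (?y (t, a, b))\<bar> \<le> ?B" for t
        using B(1)[of "?y (t, a, b)"] n by linarith
      show "\<bar>c * a * f1 (?y (t, a, b)) + c * b * f2 (?y (t, a, b))\<bar> \<le> ?B" for t
        using abs_mult_le[OF B(2)[of "?y (t, a, b)"], of "c * a"] abs_mult_le[OF B(3)[of "?y (t, a, b)"], of "c * b"] A0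
        unfolding mult.commute[of A] by linarith
    qed (auto intro!: heat_shift_deriv[OF g] continuous_intros heat_shift_continuous c1 c2)
    then show ?thesis by (simp add: D_def p heat_shift_def)
  qed
  have "integrable (half_gauss \<Otimes>\<^sub>M (gauss \<Otimes>\<^sub>M gauss)) (case_prod (\<lambda>t p. D (t, p)))"
    using iD by (simp add: heat_measure_def)
  from heat.integral_snd[OF this] have "(\<integral>\<omega>. D \<omega> \<partial>heat_measure) = f x"
    using z gauss2.P.prob_space by (simp add: heat_measure_def)
  moreover have "(\<integral>\<omega>. D \<omega> \<partial>heat_measure) = 2 / c\<^sup>2 * resolv c f x - (resolv1 c f1 x + resolv2 c f2 x)"
    unfolding D resolv_def resolv1_def resolv2_def smear_def
    by (subst Bochner_Integration.integral_diff)
      (simp_all only: Bochner_Integration.integral_add[OF i(2,3)] Bochner_Integration.integral_mult_right[OF i(1)]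
        Bochner_Integration.integrable_add i integrable_mult_right)
  ultimately show ?thesis by simp
qed

end

lemma CB_resolv:
  "CB k f \<Longrightarrow> CB k (resolv c f)" "CB k f \<Longrightarrow> CB k (resolv1 c f)" "CB k f \<Longrightarrow> CB k (resolv2 c f)"
  unfolding resolv_def resolv1_def resolv2_def
  by (rule smear_CB[OF heat_shift_measurable heat_weights(1)] smear_CB[OF heat_shift_measurable heat_weights(2)]
      smear_CB[OF heat_shift_measurable heat_weights(3)]; assumption)+

lemma CB_Suc_bound:
  fixes f :: "real^2 \<Rightarrow> real"
  assumes "CB (Suc 0) f"
  obtains f1 f2 A where "has_grad f f1 f2" "continuous_on UNIV f1" "continuous_on UNIV f2"
    "\<And>x. \<bar>f x\<bar> \<le> A" "\<And>x. \<bar>f1 x\<bar> \<le> A" "\<And>x. \<bar>f2 x\<bar> \<le> A"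
proof -
  obtain f1 f2 where *: "has_grad f f1 f2" "CB 0 f1" "CB 0 f2" by (rule CB_SucE[OF assms])
  obtain A0 A1 A2 where A: "\<And>x. \<bar>f x\<bar> \<le> A0" "\<And>x. \<bar>f1 x\<bar> \<le> A1" "\<And>x. \<bar>f2 x\<bar> \<le> A2"
    using CB_measurable_bound(2)[OF assms] CB_measurable_bound(2)[OF *(2)] CB_measurable_bound(2)[OF *(3)] by auto
  show thesis
  proof (rule that[OF *(1) CB_continuous[OF *(2)] CB_continuous[OF *(3)], of "max A0 (max A1 A2)"])
    show "\<bar>f x\<bar> \<le> max A0 (max A1 A2)" "\<bar>f1 x\<bar> \<le> max A0 (max A1 A2)" "\<bar>f2 x\<bar> \<le> max A0 (max A1 A2)" for x
      using A(1)[of x] A(2)[of x] A(3)[of x] by linarith+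
  qed
qed

lemma resolv_partial:
  assumes "CB (Suc 0) f" "has_grad f f1 f2"
  shows "resolv1 c f = resolv c f1" "resolv2 c f = resolv c f2"
proof -
  obtain g1 g2 A where *: "has_grad f g1 g2" "continuous_on UNIV g1" "continuous_on UNIV g2"
    "\<And>x. \<bar>f x\<bar> \<le> A" "\<And>x. \<bar>g1 x\<bar> \<le> A" "\<And>x. \<bar>g2 x\<bar> \<le> A" using CB_Suc_bound[OF assms(1)] by blast
  have "f1 = g1" "f2 = g2" using has_grad_unique[OF assms(2) *(1)] by auto
  then show "resolv1 c f = resolv c f1" "resolv2 c f = resolv c f2"
    using resolv_by_parts1[OF *] resolv_by_parts2[OF *] by auto
qed

text \<open>The gradient is expressed through f alone, without its derivatives: this is the gain of
  one derivative. The class of f is enlarged below by passing to limits.\<close>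

lemma resolv_has_grad:
  assumes "CB (Suc 0) f"
  shows "has_grad (resolv c f) (resolv1 c f) (resolv2 c f)"
proof -
  obtain f1 f2 A where *: "has_grad f f1 f2" "continuous_on UNIV f1" "continuous_on UNIV f2"
    "\<And>x. \<bar>f x\<bar> \<le> A" "\<And>x. \<bar>f1 x\<bar> \<le> A" "\<And>x. \<bar>f2 x\<bar> \<le> A" using CB_Suc_bound[OF assms(1)] by blast
  show ?thesis
    unfolding resolv_partial[OF assms *(1)] unfolding resolv_def
    by (rule smear_has_grad[OF heat_shift_measurable heat_weights(1) *(1) has_grad_continuous[OF *(1)] *(2-6)])
qed

lemma resolv_add:
  fixes f g :: "real^2 \<Rightarrow> real"
  assumes "CB 0 f" "CB 0 g"
  shows "resolv c (\<lambda>x. f x + g x) x = resolv c f x + resolv c g x"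
proof -
  obtain A B where A: "\<And>x. \<bar>f x\<bar> \<le> A" and B: "\<And>x. \<bar>g x\<bar> \<le> B"
    using CB_measurable_bound(2)[OF assms(1)] CB_measurable_bound(2)[OF assms(2)] by auto
  show ?thesis unfolding resolv_def
    by (rule smear_add[OF heat_shift_measurable heat_weights(1) CB_measurable_bound(1)[OF assms(1)]
        CB_measurable_bound(1)[OF assms(2)] A B])
qed

lemma resolv_cmult: "resolv c (\<lambda>x. r * f x) x = r * resolv c f x"
  unfolding resolv_def by (rule smear_cmult[OF heat_shift_measurable heat_weights(1)])

text \<open>The left inverse writes sub- and supersolutions as resolvents, so that their
  differential inequalities can be compared with the iterates by positivity.\<close>

lemma resolv_inverse:
  assumes f: "CB (Suc (Suc 0)) f" and c: "c > 0"
  shows "resolv c (\<lambda>x. 2 / c\<^sup>2 * f x - laplacian f x) = f"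
proof
  fix x
  obtain f1 f2 where *: "has_grad f f1 f2" "CB (Suc 0) f1" "CB (Suc 0) f2" by (rule CB_SucE[OF f])
  obtain f11 f12 where 1: "has_grad f1 f11 f12" "CB 0 f11" "CB 0 f12" by (rule CB_SucE[OF *(2)])
  obtain f21 f22 where 2: "has_grad f2 f21 f22" "CB 0 f21" "CB 0 f22" by (rule CB_SucE[OF *(3)])
  have lap: "laplacian f = (\<lambda>x. f11 x + f22 x)"
    by (rule has_lap_laplacian) (unfold has_lap_def, intro exI conjI, rule *(1), rule 1(1), rule 2(1), rule refl)
  have cf: "CB 0 f" by (rule CB_SucD[OF CB_SucD[OF f]])
  have cl: "CB 0 (\<lambda>x. f11 x + f22 x)" by (rule CB_add[OF 1(2) 2(3)])
  have "resolv c (\<lambda>x. 2 / c\<^sup>2 * f x + (-1) * (f11 x + f22 x)) x =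
      resolv c (\<lambda>x. 2 / c\<^sup>2 * f x) x + resolv c (\<lambda>x. (-1) * (f11 x + f22 x)) x"
    by (rule resolv_add[OF CB_cmult[OF cf] CB_cmult[OF cl]])
  also have "\<dots> = 2 / c\<^sup>2 * resolv c f x + (-1) * (resolv c f11 x + resolv c f22 x)"
    by (simp only: resolv_cmult resolv_add[OF 1(2) 2(3)])
  also have "\<dots> = 2 / c\<^sup>2 * resolv c f x - resolv1 c f1 x - resolv2 c f2 x"
    by (simp add: resolv_partial(1)[OF *(2) 1(1)] resolv_partial(2)[OF *(3) 2(1)])
  also have "\<dots> = f x"
  proof -
    obtain g1 g2 A where g: "has_grad f g1 g2" "continuous_on UNIV g1" "continuous_on UNIV g2"
      "\<And>x. \<bar>f x\<bar> \<le> A" "\<And>x. \<bar>g1 x\<bar> \<le> A" "\<And>x. \<bar>g2 x\<bar> \<le> A"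
      using CB_Suc_bound[OF CB_SucD[OF f]] by blast
    have "f1 = g1" "f2 = g2" using has_grad_unique[OF *(1) g(1)] by auto
    then show ?thesis using resolv_time_by_parts[OF g c] by simp
  qed
  finally show "resolv c (\<lambda>x. 2 / c\<^sup>2 * f x - laplacian f x) x = f x" by (simp add: lap algebra_simps)
qed

text \<open>The right inverse turns fixed points of the iteration into solutions of the differential
  equation. One derivative of the resolvent falls on f, the other on the kernel.\<close>

lemma resolv_has_lap:
  assumes f: "CBi f" and c: "c > 0"
  shows "has_lap (resolv c f) (\<lambda>x. 2 / c\<^sup>2 * resolv c f x - f x)"
proof -
  have g: "has_grad f (partial 1 f) (partial 2 f)" by (rule CBi_has_grad[OF f])
  note p = CBi_partial[OF f]
  have "has_grad (resolv c f) (resolv c (partial 1 f)) (resolv c (partial 2 f))"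
    using resolv_has_grad[OF CBiD[OF f]] unfolding resolv_partial[OF CBiD[OF f] g] .
  moreover note resolv_has_grad[OF CBiD[OF p(1)]] resolv_has_grad[OF CBiD[OF p(2)]]
  moreover have "(\<lambda>x. 2 / c\<^sup>2 * resolv c f x - f x) = (\<lambda>x. resolv1 c (partial 1 f) x + resolv2 c (partial 2 f) x)"
  proof
    fix x
    obtain g1 g2 A where *: "has_grad f g1 g2" "continuous_on UNIV g1" "continuous_on UNIV g2"
      "\<And>x. \<bar>f x\<bar> \<le> A" "\<And>x. \<bar>g1 x\<bar> \<le> A" "\<And>x. \<bar>g2 x\<bar> \<le> A"
      using CB_Suc_bound[OF CBiD[OF f]] by blast
    have "partial 1 f = g1" "partial 2 f = g2" using has_grad_partial[OF *(1)] by auto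
    then show "2 / c\<^sup>2 * resolv c f x - f x = resolv1 c (partial 1 f) x + resolv2 c (partial 2 f) x"
      using resolv_time_by_parts[OF * c, of x] by simp
  qed
  ultimately show ?thesis unfolding has_lap_def by blast
qed

section \<open>Positivity of the resolvent and passage to pointwise limits\<close>

lemma half_gauss_AE_nonneg: "AE t in half_gauss. 0 \<le> t"
  unfolding half_gauss_def by (subst AE_density) (auto simp: indicator_def)

text \<open>The weight c^2 t is nonnegative because t is so almost everywhere. This positivity plays
  the role of a maximum principle in the iteration.\<close>

lemma resolv_mono:
  fixes f g :: "real^2 \<Rightarrow> real"
  assumes f: "CB 0 f" and g: "CB 0 g" and le: "\<And>x. f x \<le> g x"
  shows "resolv c f x \<le> resolv c g x"
proof -
  obtain A B where A: "\<And>x. \<bar>f x\<bar> \<le> A" and B: "\<And>x. \<bar>g x\<bar> \<le> B"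
    using CB_measurable_bound(2)[OF f] CB_measurable_bound(2)[OF g] by auto
  have "AE \<omega> in heat_measure. 0 \<le> fst \<omega>"
    unfolding heat_measure_def
  proof (rule heat.AE_pair_measure)
    show "{\<omega> \<in> space (half_gauss \<Otimes>\<^sub>M (gauss \<Otimes>\<^sub>M gauss)). 0 \<le> fst \<omega>} \<in> sets (half_gauss \<Otimes>\<^sub>M (gauss \<Otimes>\<^sub>M gauss))"
      by measurable
    show "AE t in half_gauss. AE p in gauss \<Otimes>\<^sub>M gauss. 0 \<le> fst (t, p)"
      using half_gauss_AE_nonneg by simp
  qed
  then have "AE \<omega> in heat_measure. 0 \<le> c\<^sup>2 * fst \<omega>" by eventually_elim simp
  then show ?thesis unfolding resolv_def
    by (rule smear_mono[OF heat_shift_measurable heat_weights(1) CB_measurable_bound(1)[OF f] A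
        CB_measurable_bound(1)[OF g] B le])
qed

context
  fixes f :: "nat \<Rightarrow> real^2 \<Rightarrow> real" and g :: "real^2 \<Rightarrow> real" and B c :: real
  assumes f: "\<And>n. CB (Suc 0) (f n)" and B: "\<And>n x. \<bar>f n x\<bar> \<le> B"
    and lim: "\<And>x. (\<lambda>n. f n x) \<longlonglongrightarrow> g x"
begin

lemma limit_measurable: "g \<in> borel_measurable borel"
  by (rule borel_measurable_LIMSEQ_real[OF lim CB_measurable_bound(1)[OF f]])

lemma resolv_limit:
  "(\<lambda>n. resolv c (f n) x) \<longlonglongrightarrow> resolv c g x"
  "(\<lambda>n. resolv1 c (f n) x) \<longlonglongrightarrow> resolv1 c g x"
  "(\<lambda>n. resolv2 c (f n) x) \<longlonglongrightarrow> resolv2 c g x"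
  unfolding resolv_def resolv1_def resolv2_def
  by (rule smear_limit[OF heat_shift_measurable heat_weights(1) CB_measurable_bound(1)[OF f] limit_measurable B lim]
      smear_limit[OF heat_shift_measurable heat_weights(2) CB_measurable_bound(1)[OF f] limit_measurable B lim]
      smear_limit[OF heat_shift_measurable heat_weights(3) CB_measurable_bound(1)[OF f] limit_measurable B lim])+

text \<open>The kernels of \<open>resolv1\<close> and \<open>resolv2\<close> are integrable, so the
  sup norms of the f n control the gradients uniformly in n.\<close>

lemma resolv_grad_bound: "\<exists>C. \<forall>n x. \<bar>resolv1 c (f n) x\<bar> \<le> C \<and> \<bar>resolv2 c (f n) x\<bar> \<le> C"
proof -
  let ?C1 = "B * (\<integral>\<omega>. \<bar>c * fst (snd \<omega>)\<bar> \<partial>heat_measure)" and ?C2 = "B * (\<integral>\<omega>. \<bar>c * snd (snd \<omega>)\<bar> \<partial>heat_measure)"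
  have "\<bar>resolv1 c (f n) x\<bar> \<le> ?C1" "\<bar>resolv2 c (f n) x\<bar> \<le> ?C2" for n x
    unfolding resolv1_def resolv2_def
    by (rule smear_bound[OF heat_shift_measurable heat_weights(2) CB_measurable_bound(1)[OF f] B]
      smear_bound[OF heat_shift_measurable heat_weights(3) CB_measurable_bound(1)[OF f] B])+
  then show ?thesis by (intro exI[of _ "max ?C1 ?C2"]) (simp add: le_max_iff_disj)
qed

text \<open>A priori the limit g is only bounded and measurable. The common Lipschitz constant of
  the approximants survives the pointwise limit and starts the regularity argument.\<close>

lemma resolv_limit_continuous: "continuous_on UNIV (resolv c g)"
proof -
  obtain C where C: "\<And>n x. \<bar>resolv1 c (f n) x\<bar> \<le> C" "\<And>n x. \<bar>resolv2 c (f n) x\<bar> \<le> C"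
    using resolv_grad_bound by blast
  have C0: "C \<ge> 0" using C(1)[of 0 0] by linarith
  have lip: "\<bar>resolv c g y - resolv c g x\<bar> \<le> 2 * C * norm (y - x)" for x y
  proof (rule LIMSEQ_le_const2)
    show "(\<lambda>n. \<bar>resolv c (f n) y - resolv c (f n) x\<bar>) \<longlonglongrightarrow> \<bar>resolv c g y - resolv c g x\<bar>"
      by (intro tendsto_intros resolv_limit)
    show "\<exists>N. \<forall>n\<ge>N. \<bar>resolv c (f n) y - resolv c (f n) x\<bar> \<le> 2 * C * norm (y - x)"
      using CB_remainder_bound(1)[OF resolv_has_grad[OF f] C, of _ x "y - x"] by simp
  qed
  show ?thesis
    unfolding continuous_on_iff
  proof (intro ballI allI impI)
    fix x :: "real^2" and e :: real assume e: "e > 0"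
    show "\<exists>d>0. \<forall>y\<in>UNIV. dist y x < d \<longrightarrow> dist (resolv c g y) (resolv c g x) < e"
    proof (intro exI[of _ "e / (2 * C + 1)"] conjI ballI impI)
      show "e / (2 * C + 1) > 0" using e C0 by simp
      fix y assume "dist y x < e / (2 * C + 1)"
      then have "norm (y - x) * (2 * C + 1) < e" using C0 by (simp add: dist_norm field_simps)
      moreover have "norm (y - x) * (2 * C + 1) = 2 * C * norm (y - x) + norm (y - x)" by (simp add: algebra_simps)
      ultimately show "dist (resolv c g y) (resolv c g x) < e"
        using lip[of y x] norm_ge_zero[of "y - x"] unfolding dist_real_def by linarith
    qed
  qed
qed

text \<open>Here g is merely bounded and continuous; the gradient relation of the approximants
  \<open>resolv c (f n)\<close> is carried to the limit.\<close>

lemma resolv_limit_has_grad: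
  assumes g: "CB 0 g"
  shows "has_grad (resolv c g) (resolv1 c g) (resolv2 c g)"
proof -
  obtain C where C: "\<And>n x. \<bar>resolv1 c (f n) x\<bar> \<le> C" "\<And>n x. \<bar>resolv2 c (f n) x\<bar> \<le> C"
    using resolv_grad_bound by blast
  show ?thesis
    by (rule has_grad_limit[OF resolv_has_grad[OF f] _ _ C resolv_limit])
      (intro CB_continuous[OF CB_resolv(2)[OF f]] CB_continuous[OF CB_resolv(3)[OF f]]
        CB_continuous[OF CB_resolv(2)[OF g]] CB_continuous[OF CB_resolv(3)[OF g]])+
qed

end

section \<open>Cooperative systems\<close>

text \<open>For a system \<open>\<Delta>v = F\<^sub>1\<close>, \<open>\<Delta>w = F\<^sub>2\<close> the functions \<open>G1\<close>, \<open>G2\<close> are \<open>\<lambda>v - F\<^sub>1\<close>, \<open>\<lambda>w - F\<^sub>2\<close> with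
  \<open>\<lambda> = 2 / c\<^sup>2\<close> so large that both are increasing in \<open>v\<close> and \<open>w\<close>.\<close>

locale cooperative =
  fixes G1 G2 :: "real^2 \<Rightarrow> real \<Rightarrow> real \<Rightarrow> real" and c :: real
    and l1 l2 u1 u2 :: "real^2 \<Rightarrow> real"
  assumes c: "c > 0"
    and CB_G: "\<And>k v w. CB k v \<Longrightarrow> CB k w \<Longrightarrow> CB k (\<lambda>x. G1 x (v x) (w x))"
      "\<And>k v w. CB k v \<Longrightarrow> CB k w \<Longrightarrow> CB k (\<lambda>x. G2 x (v x) (w x))"
    and lim_G: "\<And>v w a b x. v \<longlonglongrightarrow> a \<Longrightarrow> w \<longlonglongrightarrow> b \<Longrightarrow> (\<lambda>n. G1 x (v n) (w n)) \<longlonglongrightarrow> G1 x a b"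
      "\<And>v w a b x. v \<longlonglongrightarrow> a \<Longrightarrow> w \<longlonglongrightarrow> b \<Longrightarrow> (\<lambda>n. G2 x (v n) (w n)) \<longlonglongrightarrow> G2 x a b"
    and mono_G: "\<And>x a b a' b'. l1 x \<le> a \<Longrightarrow> a \<le> a' \<Longrightarrow> a' \<le> u1 x \<Longrightarrow> l2 x \<le> b \<Longrightarrow> b \<le> b' \<Longrightarrow> b' \<le> u2 x \<Longrightarrow>
        G1 x a b \<le> G1 x a' b'"
      "\<And>x a b a' b'. l1 x \<le> a \<Longrightarrow> a \<le> a' \<Longrightarrow> a' \<le> u1 x \<Longrightarrow> l2 x \<le> b \<Longrightarrow> b \<le> b' \<Longrightarrow> b' \<le> u2 x \<Longrightarrow>
        G2 x a b \<le> G2 x a' b'"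
    and CBi_bounds: "CBi l1" "CBi l2" "CBi u1" "CBi u2"
    and ordered: "\<And>x. l1 x \<le> u1 x" "\<And>x. l2 x \<le> u2 x"
    and sub: "\<And>x. 2 / c\<^sup>2 * l1 x - laplacian l1 x \<le> G1 x (l1 x) (l2 x)"
      "\<And>x. 2 / c\<^sup>2 * l2 x - laplacian l2 x \<le> G2 x (l1 x) (l2 x)"
    and super: "\<And>x. G1 x (u1 x) (u2 x) \<le> 2 / c\<^sup>2 * u1 x - laplacian u1 x"
      "\<And>x. G2 x (u1 x) (u2 x) \<le> 2 / c\<^sup>2 * u2 x - laplacian u2 x"
begin

text \<open>Starting at the subsolution makes the sequence increasing.\<close>

primrec iter :: "nat \<Rightarrow> (real^2 \<Rightarrow> real) \<times> (real^2 \<Rightarrow> real)" where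
  "iter 0 = (l1, l2)"
| "iter (Suc n) = (resolv c (\<lambda>x. G1 x (fst (iter n) x) (snd (iter n) x)),
     resolv c (\<lambda>x. G2 x (fst (iter n) x) (snd (iter n) x)))"

definition v where "v n = fst (iter n)"
definition w where "w n = snd (iter n)"

lemma iter_simps:
  "v 0 = l1" "w 0 = l2"
  "v (Suc n) = resolv c (\<lambda>x. G1 x (v n x) (w n x))"
  "w (Suc n) = resolv c (\<lambda>x. G2 x (v n x) (w n x))"
  by (simp_all add: v_def w_def)

lemma CBi_G:
  assumes "CBi a" "CBi b"
  shows "CBi (\<lambda>x. G1 x (a x) (b x))" "CBi (\<lambda>x. G2 x (a x) (b x))"
  using assms CB_G by (auto simp: CBi_def)

lemma CBi_iter: "CBi (v n) \<and> CBi (w n)"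
proof (induction n)
  case 0
  then show ?case using CBi_bounds by (simp add: iter_simps)
next
  case (Suc n)
  then show ?case using CBi_G[of "v n" "w n"] CB_resolv(1) by (simp add: iter_simps CBi_def)
qed

lemma CBi_helmholtz: "CBi f \<Longrightarrow> CBi (\<lambda>x. 2 / c\<^sup>2 * f x - laplacian f x)"
  by (intro CBi_diff CBi_mult CBi_const CBi_laplacian)

lemma resolv_compare:
  assumes "CBi f" "CBi g" "\<And>x. f x \<le> g x"
  shows "resolv c f x \<le> resolv c g x"
  by (rule resolv_mono[OF CBiD[OF assms(1)] CBiD[OF assms(2)] assms(3)])

lemma resolv_helmholtz: "CBi f \<Longrightarrow> resolv c (\<lambda>x. 2 / c\<^sup>2 * f x - laplacian f x) = f"
  by (rule resolv_inverse[OF CBiD c])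

text \<open>Positivity of \<open>resolv c\<close> is applied to the barrier inequalities, whose
  differential sides it inverts. The functions \<open>G1\<close>, \<open>G2\<close> are monotone
  only between the barriers, so upper and lower bounds for both components go through one
  induction.\<close>

lemma iter_upper: "v n x \<le> u1 x \<and> w n x \<le> u2 x \<and> l1 x \<le> v n x \<and> l2 x \<le> w n x"
proof (induction n arbitrary: x)
  case 0
  then show ?case using ordered by (simp add: iter_simps)
next
  case (Suc n)
  have i: "CBi (v n)" "CBi (w n)" using CBi_iter by auto
  have "resolv c (\<lambda>x. G1 x (v n x) (w n x)) x \<le> resolv c (\<lambda>x. 2 / c\<^sup>2 * u1 x - laplacian u1 x) x"
    by (intro resolv_compare CBi_G i CBi_helmholtz CBi_bounds order_trans[OF mono_G(1) super(1)])
      (use Suc in auto)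
  moreover have "resolv c (\<lambda>x. G2 x (v n x) (w n x)) x \<le> resolv c (\<lambda>x. 2 / c\<^sup>2 * u2 x - laplacian u2 x) x"
    by (intro resolv_compare CBi_G i CBi_helmholtz CBi_bounds order_trans[OF mono_G(2) super(2)])
      (use Suc in auto)
  moreover have "resolv c (\<lambda>x. 2 / c\<^sup>2 * l1 x - laplacian l1 x) x \<le> resolv c (\<lambda>x. G1 x (v n x) (w n x)) x"
    by (intro resolv_compare CBi_G i CBi_helmholtz CBi_bounds order_trans[OF sub(1) mono_G(1)])
      (use Suc in auto)
  moreover have "resolv c (\<lambda>x. 2 / c\<^sup>2 * l2 x - laplacian l2 x) x \<le> resolv c (\<lambda>x. G2 x (v n x) (w n x)) x"
    by (intro resolv_compare CBi_G i CBi_helmholtz CBi_bounds order_trans[OF sub(2) mono_G(2)])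
      (use Suc in auto)
  ultimately show ?case
    unfolding iter_simps CBi_bounds[THEN resolv_helmholtz] by blast
qed

lemma iter_mono: "v n x \<le> v (Suc n) x \<and> w n x \<le> w (Suc n) x"
proof (induction n arbitrary: x)
  case 0
  then show ?case using iter_upper[of "Suc 0" x] by (simp add: iter_simps)
next
  case (Suc n)
  have i: "CBi (v m)" "CBi (w m)" for m using CBi_iter by auto
  have b: "l1 x \<le> v n x" "v (Suc n) x \<le> u1 x" "l2 x \<le> w n x" "w (Suc n) x \<le> u2 x" for x
    using iter_upper by blast+
  have m: "v n x \<le> v (Suc n) x" "w n x \<le> w (Suc n) x" for x using Suc by auto
  have "resolv c (\<lambda>x. G1 x (v n x) (w n x)) x \<le> resolv c (\<lambda>x. G1 x (v (Suc n) x) (w (Suc n) x)) x"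
    by (intro resolv_compare CBi_G i mono_G(1) b m)
  moreover have "resolv c (\<lambda>x. G2 x (v n x) (w n x)) x \<le> resolv c (\<lambda>x. G2 x (v (Suc n) x) (w (Suc n) x)) x"
    by (intro resolv_compare CBi_G i mono_G(2) b m)
  ultimately show ?case by (simp only: iter_simps)
qed

text \<open>The increasing iterates converge pointwise, and the limit is a fixed point of the
  resolvent map. Being a resolvent it is continuous, and then it is as smooth as one wishes because
  the resolvent gains a derivative each time.\<close>

lemma cooperative_solution:
  "\<exists>v w. CBi v \<and> CBi w \<and> (\<forall>x. l1 x \<le> v x \<and> l2 x \<le> w x \<and> v x \<le> u1 x \<and> w x \<le> u2 x) \<and>
     has_lap v (\<lambda>x. 2 / c\<^sup>2 * v x - G1 x (v x) (w x)) \<and>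
     has_lap w (\<lambda>x. 2 / c\<^sup>2 * w x - G2 x (v x) (w x))"
proof -
  have bd: "l1 x \<le> v n x" "v n x \<le> u1 x" "l2 x \<le> w n x" "w n x \<le> u2 x" for n x
    using iter_upper by blast+
  have "convergent (\<lambda>n. v n x)" "convergent (\<lambda>n. w n x)" for x
  proof -
    have "incseq (\<lambda>n. v n x)" "incseq (\<lambda>n. w n x)" using iter_mono by (auto intro: incseq_SucI)
    then show "convergent (\<lambda>n. v n x)" "convergent (\<lambda>n. w n x)"
      using bd by (metis convergent_def incseq_convergent)+
  qed
  then obtain v' w' where lim: "\<And>x. (\<lambda>n. v n x) \<longlonglongrightarrow> v' x" "\<And>x. (\<lambda>n. w n x) \<longlonglongrightarrow> w' x"
    unfolding convergent_def by metis
  have bd': "l1 x \<le> v' x" "v' x \<le> u1 x" "l2 x \<le> w' x" "w' x \<le> u2 x" for x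
    using bd by (auto intro: LIMSEQ_le_const[OF lim(1)] LIMSEQ_le_const2[OF lim(1)]
      LIMSEQ_le_const[OF lim(2)] LIMSEQ_le_const2[OF lim(2)])
  define g1 where "g1 x = G1 x (v' x) (w' x)" for x
  define g2 where "g2 x = G2 x (v' x) (w' x)" for x
  define f1 where "f1 n x = G1 x (v n x) (w n x)" for n x
  define f2 where "f2 n x = G2 x (v n x) (w n x)" for n x
  have i: "CBi (v m)" "CBi (w m)" for m using CBi_iter by auto
  have CBf: "CBi (f1 n)" "CBi (f2 n)" for n
    unfolding f1_def f2_def by (intro CBi_G i)+
  have lf: "(\<lambda>n. f1 n x) \<longlonglongrightarrow> g1 x" "(\<lambda>n. f2 n x) \<longlonglongrightarrow> g2 x" for x
    unfolding f1_def f2_def g1_def g2_def by (intro lim_G lim)+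
  \<comment> \<open>Monotonicity squeezes \<open>f1 n\<close> between its values at the two
    barriers; this uniform bound is the majorant for the limit under the integral.\<close>
  have "\<exists>B. \<forall>n x. \<bar>f1 n x\<bar> \<le> B"
  proof -
    obtain P Q where P: "\<And>x. \<bar>G1 x (l1 x) (l2 x)\<bar> \<le> P" and Q: "\<And>x. \<bar>G1 x (u1 x) (u2 x)\<bar> \<le> Q"
      using CB_measurable_bound(2)[OF CBiD[OF CBi_G(1)[OF CBi_bounds(1,2)]]]
        CB_measurable_bound(2)[OF CBiD[OF CBi_G(1)[OF CBi_bounds(3,4)]]] by auto
    have "G1 x (l1 x) (l2 x) \<le> f1 n x" "f1 n x \<le> G1 x (u1 x) (u2 x)" for n x
      unfolding f1_def using bd ordered by (auto intro!: mono_G(1) order_refl)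
    then have "\<bar>f1 n x\<bar> \<le> max P Q" for n x using P[of x] Q[of x] by (metis abs_le_iff le_max_iff_disj minus_le_iff order_trans)
    then show ?thesis by blast
  qed
  then obtain B1 where B1: "\<And>n x. \<bar>f1 n x\<bar> \<le> B1" by blast
  have "\<exists>B. \<forall>n x. \<bar>f2 n x\<bar> \<le> B"
  proof -
    obtain P Q where P: "\<And>x. \<bar>G2 x (l1 x) (l2 x)\<bar> \<le> P" and Q: "\<And>x. \<bar>G2 x (u1 x) (u2 x)\<bar> \<le> Q"
      using CB_measurable_bound(2)[OF CBiD[OF CBi_G(2)[OF CBi_bounds(1,2)]]]
        CB_measurable_bound(2)[OF CBiD[OF CBi_G(2)[OF CBi_bounds(3,4)]]] by auto
    have "G2 x (l1 x) (l2 x) \<le> f2 n x" "f2 n x \<le> G2 x (u1 x) (u2 x)" for n x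
      unfolding f2_def using bd ordered by (auto intro!: mono_G(2) order_refl)
    then have "\<bar>f2 n x\<bar> \<le> max P Q" for n x using P[of x] Q[of x] by (metis abs_le_iff le_max_iff_disj minus_le_iff order_trans)
    then show ?thesis by blast
  qed
  then obtain B2 where B2: "\<And>n x. \<bar>f2 n x\<bar> \<le> B2" by blast
  have v': "v' = resolv c g1" and w': "w' = resolv c g2"
  proof -
    have "(\<lambda>n. v (Suc n) x) \<longlonglongrightarrow> resolv c g1 x" for x
      unfolding iter_simps f1_def[symmetric] by (rule resolv_limit(1)[OF CBiD[OF CBf(1)] B1 lf(1)])
    then show "v' = resolv c g1" using LIMSEQ_unique[OF LIMSEQ_Suc[OF lim(1)]] by blast
    have "(\<lambda>n. w (Suc n) x) \<longlonglongrightarrow> resolv c g2 x" for x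
      unfolding iter_simps f2_def[symmetric] by (rule resolv_limit(1)[OF CBiD[OF CBf(2)] B2 lf(2)])
    then show "w' = resolv c g2" using LIMSEQ_unique[OF LIMSEQ_Suc[OF lim(2)]] by blast
  qed
  have bounded_between: "bounded (range f)"
    if lu: "CBi l" "CBi u" "\<And>x. l x \<le> f x" "\<And>x. f x \<le> u x" for f l u :: "real^2 \<Rightarrow> real"
  proof -
    obtain P Q where P: "\<And>x. \<bar>l x\<bar> \<le> P" and Q: "\<And>x. \<bar>u x\<bar> \<le> Q"
      using CB_measurable_bound(2)[OF CBiD[OF lu(1)]] CB_measurable_bound(2)[OF CBiD[OF lu(2)]] by auto
    have "norm (f x) \<le> max P Q" for x using P[of x] Q[of x] lu(3,4)[of x] by (simp add: abs_le_iff) linarith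
    then show ?thesis by (auto simp: bounded_iff)
  qed
  have b: "bounded (range v')" "bounded (range w')"
    using bounded_between[OF CBi_bounds(1,3)] bounded_between[OF CBi_bounds(2,4)] bd' by auto
  have CB0: "CB 0 v'" "CB 0 w'"
    using b resolv_limit_continuous[OF CBiD[OF CBf(1)] B1 lf(1)] resolv_limit_continuous[OF CBiD[OF CBf(2)] B2 lf(2)]
    by (simp_all add: v' w')
  have g0: "CB 0 g1" "CB 0 g2" unfolding g1_def g2_def by (intro CB_G CB0)+
  have grad: "has_grad v' (resolv1 c g1) (resolv2 c g1)" "has_grad w' (resolv1 c g2) (resolv2 c g2)"
    unfolding v' w'
    by (rule resolv_limit_has_grad[OF CBiD[OF CBf(1)] B1 lf(1) g0(1)]
        resolv_limit_has_grad[OF CBiD[OF CBf(2)] B2 lf(2) g0(2)])+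
  \<comment> \<open>Bootstrap: if the limits are in C^k_b, so are \<open>g1\<close> and
    \<open>g2\<close>, hence so are the gradients of the limits, which gives C^(k+1)_b.\<close>
  have "CB k v' \<and> CB k w'" for k
  proof (induction k)
    case 0
    show ?case using CB0 by blast
  next
    case (Suc k)
    have "CB k g1" "CB k g2" unfolding g1_def g2_def using Suc by (auto intro: CB_G)
    then show ?case
      using CB_SucI[OF b(1) grad(1)] CB_SucI[OF b(2) grad(2)] CB_resolv(2,3) by blast
  qed
  then have CBi: "CBi v'" "CBi w'" by (auto simp: CBi_def)
  have gi: "CBi g1" "CBi g2" unfolding g1_def g2_def by (intro CBi_G CBi)+
  have "has_lap v' (\<lambda>x. 2 / c\<^sup>2 * v' x - g1 x)" "has_lap w' (\<lambda>x. 2 / c\<^sup>2 * w' x - g2 x)"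
    unfolding v' w' by (rule resolv_has_lap[OF gi(1) c] resolv_has_lap[OF gi(2) c])+
  then show ?thesis using CBi bd' unfolding g1_def g2_def by blast
qed

end

section \<open>The vortex background\<close>

definition r2 :: "real^2 \<Rightarrow> real" where "r2 x = (x$1)\<^sup>2 + (x$2)\<^sup>2"

lemma r2_nonneg: "r2 x \<ge> 0" by (simp add: r2_def)

lemma r2_norm: "r2 x = (norm x)\<^sup>2"
  unfolding r2_def norm_vec_def L2_set_def by (simp add: sum_2)

lemma has_grad_r2: "has_grad r2 (\<lambda>x. 2 * x$1) (\<lambda>x. 2 * x$2)"
proof -
  have "has_grad (\<lambda>x. x$1 * x$1 + x$2 * x$2 :: real) (\<lambda>x. 1 * x$1 + x$1 * 1 + (0 * x$2 + x$2 * 0))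
     (\<lambda>x. 0 * x$1 + x$1 * 0 + (1 * x$2 + x$2 * 1))"
    by (intro has_grad_add has_grad_mult has_grad_coord)
  then show ?thesis by (simp add: r2_def[abs_def] power2_eq_square)
qed

lemma has_lap_radial:
  assumes \<Phi>: "\<And>x. (\<Phi> has_real_derivative \<Phi>' (r2 x)) (at (r2 x))"
      "\<And>x. (\<Phi>' has_real_derivative \<Phi>'' (r2 x)) (at (r2 x))"
  shows "has_lap (\<lambda>x. \<Phi> (r2 x)) (\<lambda>x. 4 * (r2 x * \<Phi>'' (r2 x) + \<Phi>' (r2 x)))"
proof -
  have g: "has_grad (\<lambda>x. 2 * x$1) (\<lambda>x. 2 * 1) (\<lambda>x. 2 * 0 :: real)" "has_grad (\<lambda>x. 2 * x$2) (\<lambda>x. 2 * 0) (\<lambda>x. 2 * 1 :: real)"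
    by (intro has_grad_cmult has_grad_coord)+
  have "(\<lambda>x. \<Phi>'' (r2 x) * ((2 * x$1)\<^sup>2 + (2 * x$2)\<^sup>2) + \<Phi>' (r2 x) * (2 * 1 + 2 * 1)) = (\<lambda>x. 4 * (r2 x * \<Phi>'' (r2 x) + \<Phi>' (r2 x)))"
    by (rule ext) (simp add: r2_def algebra_simps power2_eq_square)
  then show ?thesis using has_lap_compose[OF has_grad_r2 g \<Phi>] by simp
qed

text \<open>A smooth substitute for 1/|x|: its powers scale polynomials down to bounded functions,
  and its square is the correction in the supersolution.\<close>

definition bump :: "real \<Rightarrow> real^2 \<Rightarrow> real" where "bump L x = (L + r2 x) powr (-1/2)"

context
  fixes L :: real
  assumes L: "L > 0"
begin

lemma L_r2_pos: "L + r2 x > 0" using L r2_nonneg[of x] by linarith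

lemma bump_square: "bump L x * bump L x = 1 / (L + r2 x)"
  unfolding bump_def using L_r2_pos[of x] by (simp add: powr_add[symmetric] powr_minus_divide)

lemma has_grad_bump:
  "has_grad (bump L) (\<lambda>x. - (x$1 * bump L x) * (bump L x * bump L x)) (\<lambda>x. - (x$2 * bump L x) * (bump L x * bump L x))"
proof -
  have "((\<lambda>s. (L + s) powr (-1/2)) has_real_derivative (-1/2) * (L + r2 x) powr (-1/2 - 1)) (at (r2 x))" for x
    using L_r2_pos[of x] by (auto intro!: derivative_eq_intros)
  from has_grad_compose[OF this has_grad_r2]
  have "has_grad (bump L) (\<lambda>x. (-1/2) * (L + r2 x) powr (-1/2 - 1) * (2 * x$1)) (\<lambda>x. (-1/2) * (L + r2 x) powr (-1/2 - 1) * (2 * x$2))"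
    by (simp add: bump_def[abs_def])
  moreover have "(L + r2 x) powr (-1/2 - 1) = bump L x * (bump L x * bump L x)" for x
    unfolding powr_diff bump_square using L_r2_pos[of x] by (simp add: bump_def)
  ultimately show ?thesis by (simp add: mult_ac)
qed

text \<open>The partial derivatives of these three functions are polynomials in the three functions
  themselves, so one joint induction closes.\<close>

lemma CB_bump: "CB k (bump L) \<and> CB k (\<lambda>x. x$1 * bump L x) \<and> CB k (\<lambda>x. x$2 * bump L x)"
proof -
  have b0: "bump L x > 0" for x unfolding bump_def using L_r2_pos[of x] by simp
  have "bump L x \<le> L powr (-1/2)" for x
    unfolding bump_def using L r2_nonneg[of x] by (intro powr_mono2') auto
  then have b: "bounded (range (bump L))"
    using b0 by (auto simp: bounded_iff intro!: exI[of _ "L powr (-1/2)"] simp: less_imp_le)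
  have "\<bar>x$i * bump L x\<bar> \<le> 1" if i: "i = 1 \<or> i = 2" for x and i :: 2
  proof (rule power2_le_imp_le)
    have "(x$i)\<^sup>2 \<le> L + r2 x" using i L by (auto simp: r2_def)
    then have "(x$i)\<^sup>2 * (bump L x * bump L x) \<le> 1" unfolding bump_square using L_r2_pos[of x] by simp
    then show "\<bar>x$i * bump L x\<bar>\<^sup>2 \<le> 1\<^sup>2" by (simp add: power2_eq_square mult_ac)
  qed simp
  then have b12: "bounded (range (\<lambda>x. x$1 * bump L x))" "bounded (range (\<lambda>x. x$2 * bump L x))"
    by (auto simp: bounded_iff intro!: exI[of _ 1])
  note g = has_grad_bump has_grad_mult[OF has_grad_coord(1) has_grad_bump] has_grad_mult[OF has_grad_coord(2) has_grad_bump]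
  show ?thesis
  proof (induction k)
    case 0
    show ?case using b b12 has_grad_continuous[OF g(1)] has_grad_continuous[OF g(2)] has_grad_continuous[OF g(3)] by simp
  next
    case (Suc k)
    then have s: "CB k (bump L)" "CB k (\<lambda>x. x$1 * bump L x)" "CB k (\<lambda>x. x$2 * bump L x)" by auto
    have e: "(\<lambda>x. 1 * bump L x + x$1 * (- (x$1 * bump L x) * (bump L x * bump L x))) =
        (\<lambda>x. bump L x + - (x$1 * bump L x) * (x$1 * bump L x) * bump L x)"
      "(\<lambda>x. 0 * bump L x + x$1 * (- (x$2 * bump L x) * (bump L x * bump L x))) =
        (\<lambda>x. - (x$1 * bump L x) * (x$2 * bump L x) * bump L x)"
      "(\<lambda>x. 0 * bump L x + x$2 * (- (x$1 * bump L x) * (bump L x * bump L x))) =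
        (\<lambda>x. - (x$1 * bump L x) * (x$2 * bump L x) * bump L x)"
      "(\<lambda>x. 1 * bump L x + x$2 * (- (x$2 * bump L x) * (bump L x * bump L x))) =
        (\<lambda>x. bump L x + - (x$2 * bump L x) * (x$2 * bump L x) * bump L x)"
      by (auto simp: fun_eq_iff algebra_simps)
    show ?case
      using CB_SucI[OF b g(1)] CB_SucI[OF b12(1) g(2)[unfolded e]] CB_SucI[OF b12(2) g(3)[unfolded e]]
      by (simp only: CB_mult CB_add CB_uminus s simp_thms)
  qed
qed

lemma CBi_bump: "CBi (bump L)" "CBi (\<lambda>x. x$1 * bump L x)" "CBi (\<lambda>x. x$2 * bump L x)"
  using CB_bump by (auto simp: CBi_def)

end

section \<open>Complex polynomials as functions on the plane\<close>

definition cx :: "real^2 \<Rightarrow> complex" where "cx x = Complex (x$1) (x$2)"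

lemma cmod_cx: "cmod (cx x) = norm x"
  using r2_norm[of x] by (simp add: cx_def cmod_def r2_def)

lemma bounded_linear_cx: "bounded_linear cx"
  by (rule bounded_linear_intro[of _ 1]) (simp_all add: cmod_cx, simp_all add: cx_def complex_eq_iff)

lemma filterlim_cx: "filterlim cx at_infinity at_infinity"
  by (simp add: filterlim_at_infinity_conv_norm_at_top cmod_cx filterlim_norm_at_top)

lemma has_grad_cx: "has_grad cx (\<lambda>x. 1) (\<lambda>x. \<i>)"
proof -
  have "(cx has_derivative cx) (at x)" for x by (rule bounded_linear_imp_has_derivative[OF bounded_linear_cx])
  then show ?thesis
    unfolding has_grad_def by (rule allI[OF has_derivative_eq_rhs]) (auto simp: cx_def complex_eq_iff fun_eq_iff)
qed

lemma has_grad_poly: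
  "has_grad (\<lambda>x. poly p (cx x)) (\<lambda>x. poly (pderiv p) (cx x)) (\<lambda>x. \<i> * poly (pderiv p) (cx x))"
  unfolding has_grad_def
proof
  fix x
  have "(poly p has_derivative (*) (poly (pderiv p) (cx x))) (at (cx x))"
    using poly_DERIV[of p "cx x"] by (simp add: has_field_derivative_def)
  from has_derivative_compose[OF spec[OF has_grad_cx[unfolded has_grad_def]] this]
  show "((\<lambda>x. poly p (cx x)) has_derivative (\<lambda>h. h$1 *\<^sub>R poly (pderiv p) (cx x) + h$2 *\<^sub>R (\<i> * poly (pderiv p) (cx x)))) (at x)"
    by (rule has_derivative_eq_rhs) (auto simp: fun_eq_iff algebra_simps)
qed

lemma poly_div_power_limit:
  fixes p :: "complex poly"
  assumes "degree p \<le> N"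
  shows "((\<lambda>z. poly p z / z ^ N) \<longlongrightarrow> coeff p N) at_infinity"
proof -
  have "((\<lambda>z. \<Sum>i\<le>N. coeff p i * inverse z ^ (N - i)) \<longlongrightarrow> (\<Sum>i\<le>N. coeff p i * 0 ^ (N - i))) at_infinity"
    by (intro tendsto_intros tendsto_inverse_0)
  \<comment> \<open>Only i = N survives, through 0 ^ 0 = 1; for N above the degree the limit is
    therefore 0.\<close>
  moreover have "(\<Sum>i\<le>N. coeff p i * 0 ^ (N - i)) = coeff p N"
  proof -
    have "(\<Sum>i\<le>N. coeff p i * 0 ^ (N - i)) = (\<Sum>i\<le>N. if i = N then coeff p N else 0)"
      by (intro sum.cong) (auto simp: power_0_left)
    then show ?thesis by simp
  qed
  moreover have "\<forall>\<^sub>F z in at_infinity. (\<Sum>i\<le>N. coeff p i * inverse z ^ (N - i)) = poly p z / z ^ N"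
  proof -
    have "\<forall>\<^sub>F z::complex in at_infinity. z \<noteq> 0"
      by (rule eventually_at_infinityI[of 1]) auto
    then show ?thesis
    proof eventually_elim
      case (elim z)
      have "poly p z = (\<Sum>i\<le>N. coeff p i * z ^ i)"
        unfolding poly_altdef using assms by (intro sum.mono_neutral_left) (auto simp: coeff_eq_0)
      also have "\<dots> / z ^ N = (\<Sum>i\<le>N. coeff p i * inverse z ^ (N - i))"
        unfolding sum_divide_distrib using elim
        by (intro sum.cong) (auto simp: power_diff field_simps)
      finally show ?case by simp
    qed
  qed
  ultimately show ?thesis by (auto intro: Lim_transform_eventually)
qed

lemma poly_quotient_limit:
  fixes p q :: "complex poly"
  assumes "degree q < degree p"
  shows "((\<lambda>z. poly q z / poly p z) \<longlongrightarrow> 0) at_infinity"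
proof -
  have "((\<lambda>z. (poly q z / z ^ degree p) / (poly p z / z ^ degree p)) \<longlongrightarrow> coeff q (degree p) / coeff p (degree p)) at_infinity"
    using assms by (intro tendsto_divide poly_div_power_limit) auto
  moreover have "coeff q (degree p) = 0" using assms by (rule coeff_eq_0)
  moreover have "\<forall>\<^sub>F z in at_infinity. (poly q z / z ^ degree p) / (poly p z / z ^ degree p) = poly q z / poly p z"
    by (rule eventually_at_infinityI[of 1]) auto
  ultimately show ?thesis by (auto intro: Lim_transform_eventually)
qed

lemma poly_eventually_nonzero:
  fixes p :: "complex poly"
  assumes "degree p > 0"
  shows "\<forall>\<^sub>F z in at_infinity. poly p z \<noteq> 0"
proof -
  have "((\<lambda>z. poly p z / z ^ degree p) \<longlongrightarrow> lead_coeff p) at_infinity" by (rule poly_div_power_limit) simp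
  then have "\<forall>\<^sub>F z in at_infinity. poly p z / z ^ degree p \<noteq> 0"
    by (rule tendsto_imp_eventually_ne) (use assms in auto)
  then show ?thesis by eventually_elim auto
qed

section \<open>The weight \<open>E\<close>, its logarithm and their regularity\<close>

locale vortex =
  fixes p :: "complex poly" and a :: real
  assumes deg: "degree p > 0" and a: "a > 0"
begin

definition P where "P x = poly p (cx x)"
definition P' where "P' x = poly (pderiv p) (cx x)"
definition S where "S x = (cmod (P x))\<^sup>2"
definition T where "T x = (cmod (P' x))\<^sup>2"
definition S1 where "S1 x = 2 * Re (cnj (P x) * P' x)"
definition S2 where "S2 x = 2 * Re (\<i> * (cnj (P x) * P' x))"
definition D where "D x = sqrt (a + (S x)\<^sup>2)"
definition E where "E x = S x / D x"
text \<open>This is ln D. Off the zeros ln E = ln S - K with ln S harmonic, so \<open>G\<close>, the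
  Laplacian of K, is minus the Laplacian of ln E and extends smoothly across the zeros.\<close>

definition K where "K x = ln (a + (S x)\<^sup>2) / 2"
definition G where "G x = 8 * a * S x * T x / (D x) ^ 4"

lemma S_nonneg: "S x \<ge> 0" by (simp add: S_def)
lemma T_nonneg: "T x \<ge> 0" by (simp add: T_def)
lemma Q_pos: "a + s\<^sup>2 > 0" using a by (simp add: add_pos_nonneg)
lemma D_pos: "D x > 0" by (simp add: D_def Q_pos)
lemma D_sq: "(D x)\<^sup>2 = a + (S x)\<^sup>2" using Q_pos[of "S x"] by (simp add: D_def)

lemma has_grad_P: "has_grad P P' (\<lambda>x. \<i> * P' x)"
  using has_grad_poly[of p] by (simp add: P_def[abs_def] P'_def[abs_def])

lemma has_grad_P': "has_grad P' (\<lambda>x. poly (pderiv (pderiv p)) (cx x)) (\<lambda>x. \<i> * poly (pderiv (pderiv p)) (cx x))"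
  using has_grad_poly[of "pderiv p"] by (simp add: P'_def[abs_def])

lemma has_grad_S: "has_grad S S1 S2"
proof -
  have "has_grad (\<lambda>x. Re (P x * cnj (P x))) (\<lambda>x. Re (P' x * cnj (P x) + P x * cnj (P' x)))
     (\<lambda>x. Re (\<i> * P' x * cnj (P x) + P x * cnj (\<i> * P' x)))"
    by (intro has_grad_linear[OF bounded_linear_Re] has_grad_mult has_grad_P has_grad_linear[OF bounded_linear_cnj])
  moreover have "(\<lambda>x. Re (P x * cnj (P x))) = S"
    unfolding complex_norm_square[symmetric] Re_complex_of_real S_def ..
  moreover have "(\<lambda>x. Re (P' x * cnj (P x) + P x * cnj (P' x))) = S1" "(\<lambda>x. Re (\<i> * P' x * cnj (P x) + P x * cnj (\<i> * P' x))) = S2"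
    by (rule ext, simp add: S1_def S2_def algebra_simps)+
  ultimately show ?thesis by simp
qed

definition W1 where "W1 x = cnj (P' x) * P' x + cnj (P x) * poly (pderiv (pderiv p)) (cx x)"
definition W2 where "W2 x = cnj (\<i> * P' x) * P' x + cnj (P x) * (\<i> * poly (pderiv (pderiv p)) (cx x))"

lemma has_grad_S12:
  "has_grad S1 (\<lambda>x. 2 * Re (W1 x)) (\<lambda>x. 2 * Re (W2 x))"
  "has_grad S2 (\<lambda>x. 2 * Re (\<i> * W1 x)) (\<lambda>x. 2 * Re (\<i> * W2 x))"
proof -
  have W: "has_grad (\<lambda>x. cnj (P x) * P' x) W1 W2"
    unfolding W1_def[abs_def] W2_def[abs_def]
    by (intro has_grad_mult has_grad_P has_grad_P' has_grad_linear[OF bounded_linear_cnj])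
  show "has_grad S1 (\<lambda>x. 2 * Re (W1 x)) (\<lambda>x. 2 * Re (W2 x))"
    unfolding S1_def[abs_def] by (intro has_grad_cmult has_grad_linear[OF bounded_linear_Re] W)
  show "has_grad S2 (\<lambda>x. 2 * Re (\<i> * W1 x)) (\<lambda>x. 2 * Re (\<i> * W2 x))"
    unfolding S2_def[abs_def] by (intro has_grad_cmult has_grad_linear[OF bounded_linear_Re] W)
qed

text \<open>Holomorphy of P gives |grad S|^2 = 4 S T and a Laplacian 4 T of S, so the Laplacian of
  any function of S reduces to one-variable calculus times T.\<close>

lemma has_lap_compose_S:
  assumes \<Phi>: "\<And>s. s \<ge> 0 \<Longrightarrow> (\<Phi> has_real_derivative \<Phi>' s) (at s)"
      "\<And>s. s \<ge> 0 \<Longrightarrow> (\<Phi>' has_real_derivative \<Phi>'' s) (at s)"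
  shows "has_lap (\<lambda>x. \<Phi> (S x)) (\<lambda>x. 4 * T x * (S x * \<Phi>'' (S x) + \<Phi>' (S x)))"
proof -
  have "(S1 x)\<^sup>2 + (S2 x)\<^sup>2 = 4 * S x * T x" for x
  proof -
    have "(S1 x)\<^sup>2 + (S2 x)\<^sup>2 = 4 * (cmod (cnj (P x) * P' x))\<^sup>2"
      unfolding S1_def S2_def cmod_power2 by (simp add: power2_eq_square algebra_simps)
    then show ?thesis by (simp add: S_def T_def norm_mult power_mult_distrib)
  qed
  moreover have "2 * Re (W1 x) + 2 * Re (\<i> * W2 x) = 4 * T x" for x
    unfolding T_def W1_def W2_def cmod_power2 by (simp add: power2_eq_square algebra_simps)
  ultimately have "(\<lambda>x. \<Phi>'' (S x) * ((S1 x)\<^sup>2 + (S2 x)\<^sup>2) + \<Phi>' (S x) * (2 * Re (W1 x) + 2 * Re (\<i> * W2 x))) =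
      (\<lambda>x. 4 * T x * (S x * \<Phi>'' (S x) + \<Phi>' (S x)))"
    by (simp add: algebra_simps)
  then show ?thesis
    using has_lap_compose[OF has_grad_S has_grad_S12 \<Phi>(1)[OF S_nonneg] \<Phi>(2)[OF S_nonneg]] by simp
qed

lemma has_lap_K: "has_lap K G"
proof -
  have "has_lap (\<lambda>x. ln (a + (S x)\<^sup>2) / 2) (\<lambda>x. 4 * T x * (S x * ((a - (S x)\<^sup>2) / (a + (S x)\<^sup>2)\<^sup>2) + S x / (a + (S x)\<^sup>2)))"
  proof (rule has_lap_compose_S)
    fix s :: real
    show "((\<lambda>s. ln (a + s\<^sup>2) / 2) has_real_derivative s / (a + s\<^sup>2)) (at s)"
      using Q_pos[of s] by (auto intro!: derivative_eq_intros simp: field_simps)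
    show "((\<lambda>s. s / (a + s\<^sup>2)) has_real_derivative (a - s\<^sup>2) / (a + s\<^sup>2)\<^sup>2) (at s)"
      using Q_pos[of s] by (auto intro!: derivative_eq_intros simp: field_simps power2_eq_square)
  qed
  moreover have "4 * T x * (S x * ((a - (S x)\<^sup>2) / (a + (S x)\<^sup>2)\<^sup>2) + S x / (a + (S x)\<^sup>2)) = G x" for x
  proof -
    have D4: "(D x) ^ 4 = (a + (S x)\<^sup>2)\<^sup>2" unfolding D_sq[symmetric] by simp
    have "(a - (S x)\<^sup>2) / (a + (S x)\<^sup>2)\<^sup>2 * S x + S x / (a + (S x)\<^sup>2) = 2 * a * S x / (a + (S x)\<^sup>2)\<^sup>2"
      using Q_pos[of "S x"] by (simp add: divide_simps) (simp add: algebra_simps power2_eq_square)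
    then show ?thesis unfolding G_def D4 by (simp add: mult.commute[of "S x"])
  qed
  ultimately show ?thesis by (simp add: K_def[abs_def])
qed

text \<open>P and a + S^2 scaled by their growth rates. \<open>Pb\<close> is bounded,
  \<open>H\<close> is bounded and bounded away from 0, and in scale-invariant expressions such as
  \<open>E\<close> the powers of \<open>bump\<close> cancel; this shows that all derivatives are
  bounded.\<close>

definition Pb where "Pb x = P x * of_real (bump 1 x ^ degree p)"
definition H where "H x = (a + (S x)\<^sup>2) * bump 1 x ^ (4 * degree p)"

lemma bump_pos: "bump 1 x > 0" using r2_nonneg[of x] by (simp add: bump_def)

lemma CBi_Pb: "CBi Pb"
proof -
  have c: "CBi (\<lambda>x. cx x * of_real (bump 1 x))"
  proof -
    have "CBi (\<lambda>x. of_real (x$1 * bump 1 x) + \<i> * of_real (x$2 * bump 1 x))"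
      by (intro CBi_add CBi_mult CBi_const CBi_linear[OF bounded_linear_of_real] CBi_bump) auto
    moreover have "of_real (x$1 * bump 1 x) + \<i> * of_real (x$2 * bump 1 x) = cx x * of_real (bump 1 x)" for x :: "real^2"
      by (simp add: cx_def complex_eq_iff)
    ultimately show ?thesis by simp
  qed
  have sum: "CBi (\<lambda>x. \<Sum>i\<in>I. f i x)" if "\<And>i. i \<in> I \<Longrightarrow> CBi (f i)" for I :: "nat set" and f :: "nat \<Rightarrow> real^2 \<Rightarrow> complex"
    using that by (induction I rule: infinite_finite_induct) (auto intro: CBi_add CBi_const)
  have "CBi (\<lambda>x. \<Sum>i\<le>degree p. coeff p i * ((cx x * of_real (bump 1 x)) ^ i * of_real (bump 1 x) ^ (degree p - i)))"
    by (intro sum CBi_mult CBi_const CBi_power c CBi_linear[OF bounded_linear_of_real] CBi_bump) auto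
  moreover have "(\<Sum>i\<le>degree p. coeff p i * ((cx x * of_real (bump 1 x)) ^ i * of_real (bump 1 x) ^ (degree p - i))) = Pb x" for x
    unfolding Pb_def P_def poly_altdef sum_distrib_right of_real_power
    by (intro sum.cong) (auto simp: power_mult_distrib power_add[symmetric] mult_ac)
  ultimately show ?thesis by simp
qed

lemma Pb_sq: "(cmod (Pb x))\<^sup>2 = S x * bump 1 x ^ (2 * degree p)"
  using bump_pos[of x] by (simp add: Pb_def S_def norm_mult norm_power power_mult_distrib power_mult[symmetric] mult.commute)

lemma CBi_Pb_sq: "CBi (\<lambda>x. (cmod (Pb x))\<^sup>2)"
proof -
  have "CBi (\<lambda>x. Re (Pb x * cnj (Pb x)))"
    by (intro CBi_linear[OF bounded_linear_Re] CBi_mult CBi_linear[OF bounded_linear_cnj] CBi_Pb)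
  moreover have "Re (w * cnj w) = (cmod w)\<^sup>2" for w
    unfolding complex_norm_square[symmetric] Re_complex_of_real ..
  ultimately show ?thesis by simp
qed

lemma H_eq: "H x = a * bump 1 x ^ (4 * degree p) + ((cmod (Pb x))\<^sup>2)\<^sup>2"
  unfolding Pb_sq H_def by (simp add: algebra_simps power_mult[symmetric] power_mult_distrib)

lemma CBi_H: "CBi H"
  unfolding H_eq[abs_def] by (intro CBi_add CBi_mult CBi_const CBi_power CBi_bump CBi_Pb_sq) simp

lemma P_limit: "filterlim P at_infinity at_infinity"
proof -
  have "((\<lambda>z. poly 1 z / poly p z) \<longlongrightarrow> 0) at_infinity" using deg by (intro poly_quotient_limit) simp
  then have "((\<lambda>x. inverse (P x)) \<longlongrightarrow> 0) at_infinity"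
    using filterlim_compose[OF _ filterlim_cx] unfolding P_def by (fastforce simp: divide_inverse)
  moreover have "\<forall>\<^sub>F x in at_infinity. P x \<noteq> 0"
    using filterlim_cx poly_eventually_nonzero[OF deg] unfolding filterlim_iff P_def by blast
  ultimately have "filterlim (\<lambda>x. inverse (P x)) (at 0) at_infinity"
    unfolding filterlim_at by (auto elim: eventually_mono)
  then show ?thesis by (simp add: filterlim_inverse_at_iff)
qed

text \<open>Outside a large disc the leading coefficient of p bounds |P| from below; inside it the
  constant a does, because \<open>bump\<close> is bounded below there.\<close>

lemma H_lower: "\<exists>h>0. \<forall>x. H x \<ge> h"
proof -
  have "((\<lambda>z. cmod (poly p z / z ^ degree p)) \<longlongrightarrow> cmod (lead_coeff p)) at_infinity"
    by (intro tendsto_norm poly_div_power_limit) simp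
  moreover have l: "cmod (lead_coeff p) / 2 < cmod (lead_coeff p)" using deg by auto
  ultimately have "\<forall>\<^sub>F z in at_infinity. cmod (lead_coeff p) / 2 < cmod (poly p z / z ^ degree p)"
    by (rule order_tendstoD(1))
  then obtain R where R: "\<And>z. cmod z \<ge> R \<Longrightarrow> cmod (lead_coeff p) / 2 < cmod (poly p z / z ^ degree p)"
    unfolding eventually_at_infinity by blast
  define c where "c = cmod (lead_coeff p) / 2"
  have c: "c > 0" using deg unfolding c_def by auto
  define R' where "R' = max R 1"
  \<comment> \<open>The first entry is the bound for large x, where r2/(1 + r2) is at least 1/2; the
    second is the bound on the disc of radius \<open>R'\<close>.\<close>
  define h where "h = min (c ^ 4 * (1/2) ^ (2 * degree p)) (a * (1 / (1 + R'\<^sup>2)) ^ (2 * degree p))"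
  have b: "bump 1 x ^ (4 * degree p) = (1 / (1 + r2 x)) ^ (2 * degree p)" for x
    unfolding bump_square[of 1, symmetric, simplified] by (simp add: power_mult_distrib power_add[symmetric])
  have "h \<le> H x" for x
  proof (cases "norm x \<ge> R'")
    case True
    then have r: "norm x \<ge> 1" "cmod (cx x) \<ge> R" by (auto simp: R'_def cmod_cx)
    have "c * norm x ^ degree p \<le> cmod (P x)"
      using R[OF r(2)] zero_less_power[OF less_le_trans[OF zero_less_one r(1)], of "degree p"]
      unfolding c_def P_def by (simp add: norm_divide norm_power cmod_cx field_simps)
    then have "(c * norm x ^ degree p) ^ 4 \<le> cmod (P x) ^ 4" using c by (intro power_mono) auto
    then have "c ^ 4 * (r2 x) ^ (2 * degree p) \<le> a + (S x)\<^sup>2"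
      using a by (simp add: S_def r2_norm power_mult_distrib power_mult[symmetric] mult.commute)
    then have "c ^ 4 * (r2 x) ^ (2 * degree p) * (1 / (1 + r2 x)) ^ (2 * degree p) \<le> H x"
      unfolding H_def b using r2_nonneg[of x] by (intro mult_right_mono) auto
    moreover have "(1/2) ^ (2 * degree p) \<le> (r2 x * (1 / (1 + r2 x))) ^ (2 * degree p)"
    proof (rule power_mono)
      have "r2 x \<ge> 1" using r(1) by (simp add: r2_norm one_le_power)
      then show "1/2 \<le> r2 x * (1 / (1 + r2 x))" by (simp add: field_simps)
    qed simp
    then have h: "(1/2) ^ (2 * degree p) \<le> r2 x ^ (2 * degree p) * (1 / (1 + r2 x)) ^ (2 * degree p)"
      unfolding power_mult_distrib[of "r2 x"] .
    have "0 \<le> c ^ 4" using c by simp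
    from mult_left_mono[OF h this]
    have "c ^ 4 * (1/2) ^ (2 * degree p) \<le> c ^ 4 * (r2 x) ^ (2 * degree p) * (1 / (1 + r2 x)) ^ (2 * degree p)"
      by (simp only: mult.assoc)
    ultimately show ?thesis unfolding h_def by linarith
  next
    case False
    have "(norm x)\<^sup>2 \<le> R'\<^sup>2" using False by (intro power_mono) auto
    then have "1 / (1 + R'\<^sup>2) \<le> 1 / (1 + r2 x)"
      unfolding r2_norm by (intro divide_left_mono mult_pos_pos) (auto intro: add_pos_nonneg)
    then have "(1 / (1 + R'\<^sup>2)) ^ (2 * degree p) \<le> (1 / (1 + r2 x)) ^ (2 * degree p)"
      by (intro power_mono) auto
    then have "a * (1 / (1 + R'\<^sup>2)) ^ (2 * degree p) \<le> H x"
      unfolding H_def b using a r2_nonneg[of x] by (intro mult_mono) auto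
    then show ?thesis unfolding h_def by linarith
  qed
  moreover have "h > 0"
    unfolding h_def using a c by (auto intro!: mult_pos_pos zero_less_power divide_pos_pos add_pos_nonneg)
  ultimately show ?thesis by blast
qed

lemma H_pos: "H x > 0"
  using H_lower by (metis less_le_trans)

lemma CBi_H_powr: "CBi (\<lambda>x. H x powr r)"
  using H_lower CBi_powr[OF _ _ CBi_H] by metis

lemma H_powr: "H x powr r = (a + (S x)\<^sup>2) powr r * bump 1 x powr (r * (4 * degree p))"
  unfolding H_def using Q_pos[of "S x"] bump_pos[of x]
  by (simp add: powr_mult powr_realpow[symmetric] powr_powr mult.commute)

lemma E_eq: "E x = (cmod (Pb x))\<^sup>2 * H x powr (-1/2)"
proof -
  have "bump 1 x ^ (2 * degree p) * bump 1 x powr (- (1/2) * (4 * degree p)) = 1"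
    using bump_pos[of x] by (simp add: powr_realpow[symmetric] powr_add[symmetric])
  then show ?thesis
    unfolding E_def D_def Pb_sq H_powr using Q_pos[of "S x"]
    by (simp add: powr_minus_divide powr_half_sqrt field_simps)
qed

lemma CBi_E: "CBi E"
  unfolding E_eq[abs_def] by (intro CBi_mult CBi_Pb_sq CBi_H_powr)

text \<open>Neither factor is in \<open>CBi\<close> by itself: P grows polynomially and K
  logarithmically. The product equals \<open>Pb\<close> times H^(-1/4).\<close>

lemma CBi_phase: "CBi (\<lambda>x. P x * of_real (exp (- K x / 2)))"
proof -
  have "CBi (\<lambda>x. Pb x * of_real (H x powr (-1/4)))"
    by (intro CBi_mult CBi_Pb CBi_linear[OF bounded_linear_of_real] CBi_H_powr)
  moreover have "Pb x * of_real (H x powr (-1/4)) = P x * of_real (exp (- K x / 2))" for x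
  proof -
    have "bump 1 x ^ degree p * bump 1 x powr (- (1/4) * (4 * degree p)) = 1"
      using bump_pos[of x] by (simp add: powr_realpow[symmetric] powr_add[symmetric])
    moreover have "exp (- K x / 2) = (a + (S x)\<^sup>2) powr (-1/4)"
      using Q_pos[of "S x"] by (simp add: K_def powr_def)
    ultimately have "bump 1 x ^ degree p * H x powr (-1/4) = exp (- K x / 2)"
      unfolding H_powr by (simp add: mult.left_commute)
    then show ?thesis unfolding Pb_def by (simp only: mult.assoc of_real_mult[symmetric])
  qed
  ultimately show ?thesis by simp
qed

text \<open>K is unbounded but its gradient is not: splitting off the growth as degree p * ln (1 +
  r2) leaves half the logarithm of the function \<open>H\<close>, which is bounded above and away
  from 0.\<close>

lemma K_grad: "has_grad K (partial 1 K) (partial 2 K)" "CBi (partial 1 K)" "CBi (partial 2 K)"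
proof -
  have K: "K = (\<lambda>x. 1/2 * ln (H x) + degree p * ln (1 + r2 x))"
  proof
    fix x
    have "ln (H x) = ln (a + (S x)\<^sup>2) + (4 * degree p) * ln (bump 1 x)"
      unfolding H_def using Q_pos[of "S x"] bump_pos[of x] by (simp add: ln_mult ln_realpow)
    moreover have "ln (bump 1 x) = -1/2 * ln (1 + r2 x)" using r2_nonneg[of x] by (simp add: bump_def ln_powr)
    ultimately show "K x = 1/2 * ln (H x) + degree p * ln (1 + r2 x)"
      by (simp add: K_def add_divide_distrib diff_divide_distrib)
  qed
  have l: "(ln has_real_derivative H x powr (-1)) (at (H x))" for x
    using H_pos[of x] by (auto intro!: derivative_eq_intros simp: powr_minus_divide divide_inverse)
  have r: "((\<lambda>s. ln (1 + s)) has_real_derivative 1 / (1 + r2 x)) (at (r2 x))" for x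
    using r2_nonneg[of x] by (auto intro!: derivative_eq_intros)
  note b = bump_square[of 1, symmetric, simplified]
  have g: "has_grad K (\<lambda>x. 1/2 * (H x powr (-1) * partial 1 H x) + degree p * (1 / (1 + r2 x) * (2 * x$1)))
      (\<lambda>x. 1/2 * (H x powr (-1) * partial 2 H x) + degree p * (1 / (1 + r2 x) * (2 * x$2)))"
    unfolding K
    by (rule has_grad_add[OF has_grad_cmult[OF has_grad_compose[where \<Phi>=ln, OF l CBi_has_grad[OF CBi_H]]]
      has_grad_cmult[OF has_grad_compose[where \<Phi>="\<lambda>s. ln (1 + s)", OF r has_grad_r2]]])
  have c: "CBi (\<lambda>x. real (degree p) * (1 / (1 + r2 x) * (2 * x$i)))" if "i = 1 \<or> i = 2" for i :: 2
  proof -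
    have "CBi (\<lambda>x. real (degree p) * (2 * (bump 1 x * (x$i * bump 1 x))))"
      by (rule CBi_mult[OF CBi_const CBi_mult[OF CBi_const CBi_mult[OF CBi_bump(1)]]])
        (use that CBi_bump(2,3)[of 1] in auto)
    then show ?thesis unfolding b by (simp add: mult_ac)
  qed
  have "CBi (\<lambda>x. 1/2 * (H x powr (-1) * partial 1 H x) + degree p * (1 / (1 + r2 x) * (2 * x$1)))"
    "CBi (\<lambda>x. 1/2 * (H x powr (-1) * partial 2 H x) + degree p * (1 / (1 + r2 x) * (2 * x$2)))"
    by (intro CBi_add c CBi_mult CBi_const CBi_H_powr CBi_partial CBi_H; simp)+
  then show "has_grad K (partial 1 K) (partial 2 K)" "CBi (partial 1 K)" "CBi (partial 2 K)"
    using g unfolding has_grad_partial[OF g] by simp_all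
qed

text \<open>Read as the divergence of grad K, the source inherits all its bounds from
  \<open>K_grad\<close>.\<close>

lemma CBi_G: "CBi G"
proof -
  have "has_lap K (\<lambda>x. partial 1 (partial 1 K) x + partial 2 (partial 2 K) x)"
    by (rule has_lapI[OF K_grad(1) CBi_has_grad[OF K_grad(2)] CBi_has_grad[OF K_grad(3)]]) simp
  from has_lap_unique[OF has_lap_K this] show ?thesis
    by (simp add: CBi_add CBi_partial K_grad)
qed

end

section \<open>Maximum principle\<close>

lemma second_derivative_at_max:
  fixes h h' :: "real \<Rightarrow> real"
  assumes h: "\<And>t. (h has_real_derivative h' t) (at t)" and h': "(h' has_real_derivative d) (at 0)"
    and max: "\<And>t. h t \<le> h 0"
  shows "d \<le> 0"
proof (rule ccontr)
  assume "\<not> d \<le> 0"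
  then have "d > 0" by simp
  have "h' 0 = 0" by (rule DERIV_local_max[OF h, of 1]) (use max in auto)
  obtain e where e: "e > 0" "\<And>t. 0 < t \<Longrightarrow> t < e \<Longrightarrow> h' 0 < h' (0 + t)"
    using DERIV_pos_inc_right[OF h' \<open>d > 0\<close>] by blast
  obtain t where t: "0 < t" "t < e/2" "h (e/2) - h 0 = (e/2 - 0) * h' t"
    using MVT2[of 0 "e/2" h h'] h e(1) by auto
  have "h' t > 0" using e(2)[of t] t \<open>h' 0 = 0\<close> by simp
  then have "h (e/2) > h 0" using t(3) mult_pos_pos[OF e(1) \<open>h' t > 0\<close>] by (simp add: field_simps)
  then show False using max[of "e/2"] by simp
qed

lemma laplacian_at_max:
  assumes l: "has_lap f l" and max: "\<And>y. f y \<le> f x"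
  shows "l x \<le> 0"
proof -
  obtain f1 f2 f11 f12 f21 f22 where g: "has_grad f f1 f2" "has_grad f1 f11 f12" "has_grad f2 f21 f22"
    and eq: "l = (\<lambda>x. f11 x + f22 x)"
    using l unfolding has_lap_def by blast
  have d: "((\<lambda>t. g (x + t *\<^sub>R e)) has_real_derivative (e$1 * g1 (x + t *\<^sub>R e) + e$2 * g2 (x + t *\<^sub>R e))) (at t)"
    if "has_grad g g1 g2" for g g1 g2 :: "real^2 \<Rightarrow> real" and e t
  proof -
    have "((\<lambda>t. x + t *\<^sub>R e) has_derivative (\<lambda>s. s *\<^sub>R e)) (at t)"
      by (auto intro!: derivative_eq_intros)
    from has_derivative_compose[OF this spec[OF that[unfolded has_grad_def]]]
    show ?thesis unfolding has_field_derivative_def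
      by (rule has_derivative_eq_rhs) (auto simp: fun_eq_iff algebra_simps)
  qed
  have "f11 x \<le> 0"
  proof (rule second_derivative_at_max[of "\<lambda>t. f (x + t *\<^sub>R axis 1 1)" "\<lambda>t. f1 (x + t *\<^sub>R axis 1 1)"])
    show "((\<lambda>t. f (x + t *\<^sub>R axis 1 1)) has_real_derivative f1 (x + t *\<^sub>R axis 1 1)) (at t)" for t
      using d[OF g(1), of "axis 1 1" t] by (simp add: axis_def)
    show "((\<lambda>t. f1 (x + t *\<^sub>R axis 1 1)) has_real_derivative f11 x) (at 0)"
      using d[OF g(2), of "axis 1 1" 0] by (simp add: axis_def)
  qed (use max in simp)
  moreover have "f22 x \<le> 0"
  proof (rule second_derivative_at_max[of "\<lambda>t. f (x + t *\<^sub>R axis 2 1)" "\<lambda>t. f2 (x + t *\<^sub>R axis 2 1)"])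
    show "((\<lambda>t. f (x + t *\<^sub>R axis 2 1)) has_real_derivative f2 (x + t *\<^sub>R axis 2 1)) (at t)" for t
      using d[OF g(1), of "axis 2 1" t] by (simp add: axis_def)
    show "((\<lambda>t. f2 (x + t *\<^sub>R axis 2 1)) has_real_derivative f22 x) (at 0)"
      using d[OF g(3), of "axis 2 1" 0] by (simp add: axis_def)
  qed (use max in simp)
  ultimately show ?thesis by (simp add: eq)
qed

text \<open>The Omori--Yau principle: penalising by a small multiple of \<open>|x|\<^sup>2\<close> makes the supremum
  attained.\<close>

lemma almost_maximum:
  fixes f :: "real^2 \<Rightarrow> real"
  assumes l: "has_lap f l" and B: "\<And>x. f x \<le> B" and e: "e > 0"
  obtains x where "\<And>y. f y \<le> f x + e" "l x \<le> e"
proof -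
  have bdd: "bdd_above (range f)" by (rule bdd_aboveI2[OF B])
  have "(SUP x. f x) - e/2 < (SUP x. f x)" using e by simp
  then obtain y0 where "(SUP x. f x) - e/2 < f y0" using less_cSUP_iff[OF _ bdd] by auto
  then have y0: "f y \<le> f y0 + e/2" for y using cSUP_upper[OF _ bdd, of y] by auto
  \<comment> \<open>The penalty costs at most e/2 at the near maximiser \<open>y0\<close>, and its
    Laplacian 4\<mu> is at most e.\<close>
  define \<mu> where "\<mu> = e / (4 * (1 + r2 y0))"
  have r0: "1 + r2 y0 > 0" using r2_nonneg[of y0] by linarith
  have \<mu>: "\<mu> > 0" "4 * \<mu> \<le> e" "\<mu> * r2 y0 \<le> e/2"
    unfolding \<mu>_def using e r2_nonneg[of y0] r0 by (auto simp: field_simps)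
  define g where "g x = f x - \<mu> * r2 x" for x
  have cf: "continuous_on UNIV f" using l has_grad_continuous unfolding has_lap_def by blast
  have cg: "continuous_on UNIV g"
    unfolding g_def[abs_def] by (intro continuous_intros cf has_grad_continuous[OF has_grad_r2])
  \<comment> \<open>Outside this ball \<mu>|y|^2 exceeds |B| + |g y0|, using R \<le> R^2, so the
    penalised function lies below its value at \<open>y0\<close>.\<close>
  define R where "R = 1 + norm y0 + (\<bar>B\<bar> + \<bar>g y0\<bar>) / \<mu>"
  have "compact (cball 0 R :: (real^2) set)" by simp
  moreover have R0: "R \<ge> 1 + norm y0" using \<mu>(1) unfolding R_def by simp
  then have R1: "R \<ge> 1" and "y0 \<in> cball 0 R" using norm_ge_zero[of y0] by (linarith, simp)
  ultimately obtain x where x: "x \<in> cball 0 R" "\<And>y. y \<in> cball 0 R \<Longrightarrow> g y \<le> g x"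
    using continuous_attains_sup[of "cball 0 R" g] continuous_on_subset[OF cg] by blast
  have max: "g y \<le> g x" for y
  proof (cases "y \<in> cball 0 R")
    case False
    then have "norm y > R" by simp
    have "(\<bar>B\<bar> + \<bar>g y0\<bar>) / \<mu> \<le> R" unfolding R_def by simp
    also have "R \<le> R * R" using R1 by (simp add: mult_le_cancel_left1)
    also have "\<dots> \<le> norm y * norm y" using \<open>norm y > R\<close> R1 by (intro mult_mono) auto
    finally have "\<bar>B\<bar> + \<bar>g y0\<bar> \<le> \<mu> * r2 y"
      using \<mu>(1) by (simp add: r2_norm power2_eq_square field_simps)
    then have "g y \<le> g y0" unfolding g_def[of y] using B[of y] by linarith
    also have "\<dots> \<le> g x" using x(2) \<open>y0 \<in> cball 0 R\<close> by blast
    finally show ?thesis .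
  qed (rule x(2))
  have lr: "has_lap r2 (\<lambda>x. 4)"
    using has_lap_radial[of "\<lambda>s. s" "\<lambda>s. 1" "\<lambda>s. 0"] by (simp add: DERIV_ident)
  have "has_lap g (\<lambda>x. l x - \<mu> * 4)"
    unfolding g_def[abs_def] by (rule has_lap_diff[OF l has_lap_cmult[OF lr]])
  from laplacian_at_max[OF this max] have "l x \<le> e" using \<mu>(2) by simp
  moreover have "f y \<le> f x + e" for y
  proof -
    have "f y0 - \<mu> * r2 y0 \<le> f x - \<mu> * r2 x" using max[of y0] by (simp add: g_def)
    moreover have "\<mu> * r2 x \<ge> 0" using \<mu>(1) r2_nonneg[of x] by simp
    ultimately show ?thesis using y0[of y] \<mu>(3) by linarith
  qed
  ultimately show thesis using that by blast
qed

section \<open>Sub- and supersolution\<close>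

text \<open>At infinity p'/p tends to 0, so |p|^2 alone controls |p'|^2; on the remaining disc p' is
  bounded and a large a suffices.\<close>

lemma poly_deriv_bound:
  fixes p :: "complex poly"
  assumes deg: "degree p > 0" and e: "e > 0"
  shows "\<exists>a>0. \<forall>z. (cmod (poly (pderiv p) z))\<^sup>2 \<le> e * sqrt (a + ((cmod (poly p z))\<^sup>2)\<^sup>2)"
proof -
  have "((\<lambda>z. cmod (poly (pderiv p) z / poly p z)) \<longlongrightarrow> 0) at_infinity"
    using deg by (intro tendsto_norm_zero poly_quotient_limit) (simp add: degree_pderiv)
  then have "\<forall>\<^sub>F z in at_infinity. cmod (poly (pderiv p) z / poly p z) < sqrt e"
    using e by (auto intro: order_tendstoD(2))
  with poly_eventually_nonzero[OF deg]
  have "\<forall>\<^sub>F z in at_infinity. (cmod (poly (pderiv p) z))\<^sup>2 \<le> e * (cmod (poly p z))\<^sup>2"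
  proof eventually_elim
    case (elim z)
    then have "cmod (poly (pderiv p) z) \<le> sqrt e * cmod (poly p z)"
      by (simp add: norm_divide field_simps)
    then have "(cmod (poly (pderiv p) z))\<^sup>2 \<le> (sqrt e * cmod (poly p z))\<^sup>2" by (rule power_mono) simp
    then show ?case using e by (simp add: power_mult_distrib)
  qed
  then obtain R where R: "\<And>z. cmod z \<ge> R \<Longrightarrow> (cmod (poly (pderiv p) z))\<^sup>2 \<le> e * (cmod (poly p z))\<^sup>2"
    unfolding eventually_at_infinity by blast
  have "bounded (poly (pderiv p) ` cball 0 R)"
    by (intro compact_imp_bounded compact_continuous_image continuous_intros) simp
  then obtain B where B: "\<forall>z\<in>cball 0 R. cmod (poly (pderiv p) z) \<le> B"
    unfolding bounded_iff by auto
  \<comment> \<open>The square root of this exceeds B^2/e, which is what the disc requires.\<close>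
  define a where "a = 1 + (B\<^sup>2 / e)\<^sup>2"
  show ?thesis
  proof (intro exI[of _ a] conjI allI)
    show "a > 0" unfolding a_def by (simp add: add_pos_nonneg)
    fix z
    let ?s = "(cmod (poly p z))\<^sup>2"
    have s1: "?s \<le> sqrt (a + ?s\<^sup>2)" unfolding a_def by (rule real_le_rsqrt) simp
    have s2: "B\<^sup>2 / e \<le> sqrt (a + ?s\<^sup>2)" unfolding a_def by (rule real_le_rsqrt) simp
    show "(cmod (poly (pderiv p) z))\<^sup>2 \<le> e * sqrt (a + ?s\<^sup>2)"
    proof (cases "cmod z \<ge> R")
      case True
      show ?thesis using R[OF True] mult_left_mono[OF s1, of e] e by linarith
    next
      case False
      then have "(cmod (poly (pderiv p) z))\<^sup>2 \<le> B\<^sup>2" using B by (intro power_mono) auto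
      also have "\<dots> \<le> e * sqrt (a + ?s\<^sup>2)" using s2 e by (simp add: field_simps)
      finally show ?thesis .
    qed
  qed
qed

text \<open>Here k is the \<kappa> of the theorem. \<open>T_bound\<close> says that |p'|^2/D is
  small compared with q^2 d, with the d defined next; it is how the choice of a enters.\<close>

locale vortex_system = vortex +
  fixes q k :: real
  assumes q: "q > 0" and k: "k > 0"
    and T_bound: "\<And>x. T x \<le> q\<^sup>2 * min (1/3) (q\<^sup>2 / (k\<^sup>2 + 2 * q\<^sup>2)) / 32 * D x"
begin

text \<open>The bound 1/3 keeps \<open>M\<close> nonnegative and limits the quadratic terms in its
  Laplacian; the other bound keeps the k^2 part of \<open>F2\<close> below the helpful term -2q^2 E
  M.\<close>

definition d where "d = min (1/3) (q\<^sup>2 / (k\<^sup>2 + 2 * q\<^sup>2))"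

lemma d_bounds: "d > 0" "d \<le> 1/3" "d * (k\<^sup>2 + 2 * q\<^sup>2) \<le> q\<^sup>2"
proof -
  have *: "k\<^sup>2 + 2 * q\<^sup>2 > 0" using k by (simp add: add_pos_nonneg)
  then show "d > 0" using q by (auto simp: d_def)
  show "d \<le> 1/3" unfolding d_def by (rule min.cobounded1)
  have "d \<le> q\<^sup>2 / (k\<^sup>2 + 2 * q\<^sup>2)" by (simp add: d_def)
  then show "d * (k\<^sup>2 + 2 * q\<^sup>2) \<le> q\<^sup>2" using * by (simp add: field_simps)
qed

lemma S_le_D: "S x \<le> D x"
  unfolding D_def using a by (intro real_le_rsqrt) simp

lemma E_bounds: "0 \<le> E x" "E x \<le> 1"
  using S_nonneg[of x] D_pos[of x] S_le_D[of x] by (auto simp: E_def)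

text \<open>The common size of all error terms of the subsolution: \<open>G\<close> equals 8 X and
  the Laplacian of \<open>M\<close> is at most 16 X.\<close>

definition X where "X x = a * S x * T x / (D x) ^ 4"

lemma G_X: "G x = 8 * X x" by (simp add: G_def X_def)

text \<open>X is the product of a/D^2 = 1 - E^2 \<le> 2(1 - E), of S/D = E, and of T/D, which is
  small by the choice of a.\<close>

lemma X_bound: "X x \<le> q\<^sup>2 * d / 16 * (E x * (1 - E x))"
proof -
  have "a = (D x)\<^sup>2 - (S x)\<^sup>2" by (simp add: D_sq)
  then have "a / (D x)\<^sup>2 = 1 - (E x)\<^sup>2" using D_pos[of x] by (simp add: E_def power_divide field_simps)
  moreover have "1 - (E x)\<^sup>2 \<le> 2 * (1 - E x)"
  proof -
    have "2 * (1 - E x) - (1 - (E x)\<^sup>2) = (1 - E x)\<^sup>2" by (simp add: power2_eq_square algebra_simps)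
    then show ?thesis using zero_le_power2[of "1 - E x"] by linarith
  qed
  ultimately have a1: "a / (D x)\<^sup>2 \<le> 2 * (1 - E x)" by simp
  have t: "T x / D x \<le> q\<^sup>2 * d / 32"
    using T_bound[of x] D_pos[of x] by (simp add: d_def field_simps)
  have "X x = a / (D x)\<^sup>2 * (E x * (T x / D x))"
    using D_pos[of x] by (simp add: X_def E_def field_simps power2_eq_square power4_eq_xxxx)
  also have "\<dots> \<le> 2 * (1 - E x) * (E x * (q\<^sup>2 * d / 32))"
    using a1 t E_bounds[of x] a D_pos[of x] T_nonneg[of x] q d_bounds(1)
    by (intro mult_mono) auto
  finally show ?thesis by (simp add: algebra_simps)
qed

text \<open>The subsolution for A is -M. Its merit is the identity E - 1 + M = - d E (1 - E), a
  negative amount of the same shape as the bound on X.\<close>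

definition M where "M x = (1 - E x) * (1 - d * E x)"

lemma M_nonneg: "M x \<ge> 0"
proof -
  have "d * E x \<le> 1/3 * 1" using d_bounds E_bounds[of x] by (intro mult_mono) auto
  then show ?thesis unfolding M_def using E_bounds[of x] by (intro mult_nonneg_nonneg) auto
qed

lemma CBi_M: "CBi M"
  unfolding M_def[abs_def] by (intro CBi_mult CBi_diff CBi_const CBi_E)

text \<open>M is a function m of S alone, so only s m'' + m' has to be estimated. The lower-order
  terms are compared with s r^2, where r = sqrt (a + s^2) \<ge> s.\<close>

lemma lap_M: obtains l where "has_lap M l" "\<And>x. l x \<le> 16 * X x"
proof -
  define R where "R s = sqrt (a + s\<^sup>2)" for s
  have R: "R s > 0" "(R s)\<^sup>2 = a + s\<^sup>2" for s
    using Q_pos[of s] by (simp_all add: R_def)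
  have dR: "(R has_real_derivative s / R s) (at s)" for s
    unfolding R_def[abs_def] using Q_pos[of s]
    by (auto intro!: derivative_eq_intros simp: field_simps)
  define f where "f s = s / R s" for s
  define f' where "f' s = a / (R s) ^ 3" for s
  define f'' where "f'' s = - 3 * a * s / (R s) ^ 5" for s
  have df: "(f has_real_derivative f' s) (at s)" for s
  proof -
    have "(f has_real_derivative (1 * R s - s * (s / R s)) / (R s * R s)) (at s)"
      unfolding f_def[abs_def] using R(1)[of s] by (intro DERIV_divide DERIV_ident dR) simp
    moreover have "(1 * R s - s * (s / R s)) / (R s * R s) = ((R s)\<^sup>2 - s\<^sup>2) / (R s) ^ 3"
      using R(1)[of s] by (simp add: field_simps power2_eq_square power3_eq_cube)
    ultimately show ?thesis by (simp add: R(2) f'_def)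
  qed
  have df': "(f' has_real_derivative f'' s) (at s)" for s
  proof -
    have "(f' has_real_derivative (0 * R s ^ 3 - a * (real 3 * (s / R s * R s ^ (3 - Suc 0)))) / (R s ^ 3 * R s ^ 3)) (at s)"
      unfolding f'_def[abs_def] using R(1)[of s] by (intro DERIV_divide DERIV_const DERIV_power dR) simp
    moreover have "(0 * R s ^ 3 - a * (real 3 * (s / R s * R s ^ (3 - Suc 0)))) / (R s ^ 3 * R s ^ 3) = f'' s"
      using R(1)[of s] unfolding f''_def by (simp add: field_simps eval_nat_numeral)
    ultimately show ?thesis by simp
  qed
  define m where "m s = 1 - (1 + d) * f s + d * (f s * f s)" for s
  define m' where "m' s = - (1 + d) * f' s + 2 * d * (f s * f' s)" for s
  define m'' where "m'' s = - (1 + d) * f'' s + 2 * d * (f' s * f' s + f s * f'' s)" for s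
  have dm: "(m has_real_derivative m' s) (at s)" for s
    unfolding m_def[abs_def] m'_def by (auto intro!: derivative_eq_intros df simp: algebra_simps)
  have dm': "(m' has_real_derivative m'' s) (at s)" for s
    unfolding m'_def[abs_def] m''_def by (auto intro!: derivative_eq_intros df df' simp: algebra_simps)
  have "E x = f (S x)" for x by (simp add: E_def D_def f_def R_def)
  then have "M = (\<lambda>x. m (S x))"
    by (intro ext) (simp add: M_def m_def algebra_simps)
  then have l: "has_lap M (\<lambda>x. 4 * T x * (S x * m'' (S x) + m' (S x)))"
    using has_lap_compose_S[of m m' m''] dm dm' by simp
  have bound: "s * m'' s + m' s \<le> 4 * a * s / (R s) ^ 4" if s: "s \<ge> 0" for s
  proof -
    define r where "r = R s"
    have r: "r > 0" "r\<^sup>2 = a + s\<^sup>2" using R[of s] by (auto simp: r_def)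
    have sr: "s \<le> r" unfolding r_def R_def using a by (intro real_le_rsqrt) simp
    have "s * m'' s + m' s = a / r ^ 6 * ((1 + d) * (3 * s\<^sup>2 * r - r ^ 3) + 2 * d * (s * a - 3 * s ^ 3 + s * r\<^sup>2))"
      unfolding m''_def m'_def f_def f'_def f''_def r_def[symmetric] using r(1)
      by (simp add: divide_simps) (simp add: algebra_simps eval_nat_numeral)
    also have "\<dots> \<le> a / r ^ 6 * (4 * s * r\<^sup>2)"
    proof (rule mult_left_mono)
      have "3 * s\<^sup>2 * r - r ^ 3 \<le> 2 * (s * r\<^sup>2)"
      proof -
        have "s * r * (r - s) \<ge> 0" "r * ((r - s) * (r + s)) \<ge> 0" using s sr r(1) by auto
        moreover have "2 * (s * r\<^sup>2) - (3 * s\<^sup>2 * r - r ^ 3) = 2 * (s * r * (r - s)) + r * ((r - s) * (r + s))"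
          by (simp add: algebra_simps power2_eq_square power3_eq_cube)
        ultimately show ?thesis by linarith
      qed
      then have t1: "(1 + d) * (3 * s\<^sup>2 * r - r ^ 3) \<le> (1 + d) * (2 * (s * r\<^sup>2))"
        using d_bounds(1) by (intro mult_left_mono) auto
      have "s * a - 3 * s ^ 3 + s * r\<^sup>2 \<le> 2 * (s * r\<^sup>2)"
      proof -
        have "s * a = s * (r\<^sup>2 - s\<^sup>2)" using r(2) by simp
        also have "\<dots> = s * r\<^sup>2 - s ^ 3" by (simp add: algebra_simps power2_eq_square power3_eq_cube)
        finally have "s * a = s * r\<^sup>2 - s ^ 3" .
        moreover have "s ^ 3 \<ge> 0" using s by simp
        ultimately show ?thesis by linarith
      qed
      then have t2: "2 * d * (s * a - 3 * s ^ 3 + s * r\<^sup>2) \<le> 2 * d * (2 * (s * r\<^sup>2))"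
        using d_bounds(1) by (intro mult_left_mono) auto
      \<comment> \<open>The two estimates add up to 2(1 + d) + 4d times s r^2, and this is at most 4
        s r^2 exactly when d \<le> 1/3.\<close>
      have "d * (s * r\<^sup>2) \<le> 1/3 * (s * r\<^sup>2)" using d_bounds(2) s by (intro mult_right_mono) auto
      then show "(1 + d) * (3 * s\<^sup>2 * r - r ^ 3) + 2 * d * (s * a - 3 * s ^ 3 + s * r\<^sup>2) \<le> 4 * s * r\<^sup>2"
        using t1 t2 by (simp add: algebra_simps)
      show "0 \<le> a / r ^ 6" using a r(1) by simp
    qed
    also have "\<dots> = 4 * a * s / (R s) ^ 4"
      using r(1) unfolding r_def[symmetric] by (simp add: field_simps eval_nat_numeral)
    finally show ?thesis .
  qed
  show thesis
  proof (rule that[OF l])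
    fix x
    have "4 * T x * (S x * m'' (S x) + m' (S x)) \<le> 4 * T x * (4 * a * S x / (R (S x)) ^ 4)"
      using T_nonneg[of x] by (intro mult_left_mono bound S_nonneg) auto
    then show "4 * T x * (S x * m'' (S x) + m' (S x)) \<le> 16 * X x"
      by (simp add: X_def R_def D_def mult_ac)
  qed
qed

text \<open>The right-hand sides of the system for w = u - ln E and A. The subtraction contributes
  \<open>G\<close> and replaces e^u by E e^w, which makes sense at the zeros as well.\<close>

definition F1 where "F1 x w A = 2 * q\<^sup>2 * (E x * exp w - 1 - A) + G x"
definition F2 where "F2 x w A = k\<^sup>2 * (1 - E x * exp w + A) + 2 * q\<^sup>2 * (E x * exp w) * A"

text \<open>With e = E(1 - E), the first equation has -2q^2 d e against 8 X, and the second has at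
  most -q^2 e against 16 X; both margins suffice because 16 X \<le> q^2 d e and d \<le> 1.\<close>

lemma sub_solution:
  "F1 x 0 (- M x) \<le> 0" "F2 x 0 (- M x) \<le> laplacian (\<lambda>x. - M x) x"
proof -
  let ?e = "E x * (1 - E x)"
  have e: "?e \<ge> 0" using E_bounds[of x] by simp
  have eq: "E x - 1 + M x = - (d * ?e)" by (simp add: M_def algebra_simps)
  have X0: "X x \<ge> 0" unfolding X_def using a S_nonneg[of x] T_nonneg[of x] D_pos[of x] by simp
  have x8: "16 * X x \<le> q\<^sup>2 * d * ?e" using X_bound[of x] by simp
  have "F1 x 0 (- M x) = 2 * q\<^sup>2 * (E x - 1 + M x) + 8 * X x" by (simp add: F1_def G_X)
  also have "\<dots> \<le> 2 * q\<^sup>2 * (E x - 1 + M x) + q\<^sup>2 * d * ?e"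
    using x8 X0 by linarith
  also have "\<dots> = - (q\<^sup>2 * d * ?e)" unfolding eq by (simp add: algebra_simps)
  also have "\<dots> \<le> 0" using e d_bounds(1) by simp
  finally show "F1 x 0 (- M x) \<le> 0" .
  obtain l where l: "has_lap M l" "\<And>x. l x \<le> 16 * X x" using lap_M by blast
  have "has_lap (\<lambda>x. (-1) * M x) (\<lambda>x. (-1) * l x)" by (rule has_lap_cmult[OF l(1)])
  then have lap: "laplacian (\<lambda>x. - M x) x = - l x" using has_lap_laplacian by force
  have "F2 x 0 (- M x) = - (k\<^sup>2 * (E x - 1 + M x)) - 2 * q\<^sup>2 * E x * M x" by (simp add: F2_def algebra_simps)
  also have "\<dots> = (d * (k\<^sup>2 + 2 * q\<^sup>2 * E x) - 2 * q\<^sup>2) * ?e" unfolding eq by (simp add: M_def algebra_simps)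
  also have "\<dots> \<le> - (q\<^sup>2 * d) * ?e"
  proof (rule mult_right_mono[OF _ e])
    have "d * (k\<^sup>2 + 2 * q\<^sup>2 * E x) \<le> d * (k\<^sup>2 + 2 * q\<^sup>2 * 1)"
      using d_bounds(1) E_bounds(2)[of x] by (intro mult_left_mono add_left_mono) auto
    moreover have "q\<^sup>2 * d \<le> q\<^sup>2 * 1" using d_bounds(2) by (intro mult_left_mono) auto
    ultimately show "d * (k\<^sup>2 + 2 * q\<^sup>2 * E x) - 2 * q\<^sup>2 \<le> - (q\<^sup>2 * d)" using d_bounds(3) by simp
  qed
  also have "\<dots> \<le> - l x" using l(2)[of x] x8 by simp
  finally show "F2 x 0 (- M x) \<le> laplacian (\<lambda>x. - M x) x" unfolding lap .
qed

text \<open>The largest value of A at which \<open>F2\<close> is still nonincreasing in w; at A = B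
  it does not depend on w at all.\<close>

definition B where "B = k\<^sup>2 / (2 * q\<^sup>2)"

lemma B: "B > 0" "2 * q\<^sup>2 * B = k\<^sup>2" using q k by (auto simp: B_def)

text \<open>Where E is bounded below, a large C makes the exponential dominate the Laplacian of the
  bump. Near the zeros of p only F1 \<ge> -2q^2 (1 + B) is available, and there the Laplacian of the
  bump is equally negative. The source \<open>G\<close> is nonnegative and may be dropped from this
  lower bound.\<close>

lemma super_solution:
  obtains C c L where "C \<ge> 0" "c > 0" "L > 0"
    "\<And>x. laplacian (\<lambda>x. C + c * (bump L x * bump L x)) x \<le> F1 x (C + c * (bump L x * bump L x)) B"
proof -
  have "\<forall>\<^sub>F x in at_infinity. 1 \<le> norm (P x)"
    using P_limit unfolding filterlim_at_infinity_conv_norm_at_top by (simp add: filterlim_at_top)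
  then obtain R where R: "\<And>x. norm x \<ge> R \<Longrightarrow> 1 \<le> norm (P x)" unfolding eventually_at_infinity by blast
  \<comment> \<open>L/2 = R^2 + 1, so s x \<ge> L/2 forces |x| \<ge> R and hence S \<ge> 1.\<close>
  define L where "L = 2 * (R\<^sup>2 + 1)"
  have L: "L > 0" unfolding L_def by (simp add: add_nonneg_pos)
  \<comment> \<open>For S \<ge> 1 one has E \<ge> 1/sqrt (a + 1), so E exp C \<ge> 17(1 + B); after
    subtracting 1 + B, sixteen units remain for the Laplacian.\<close>
  define C where "C = ln (17 * (1 + B) * sqrt (a + 1))"
  \<comment> \<open>Chosen so that c/(4 L^2) = 2q^2 (1 + B), the deficit to be met for s < L/2. Then
    4c/L^2, the largest possible Laplacian outside, is 16 times as much.\<close>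
  define c where "c = 8 * L\<^sup>2 * q\<^sup>2 * (1 + B)"
  have c: "c > 0" using L q B(1) by (simp add: c_def)
  have sa: "sqrt (a + 1) \<ge> 1" using a by simp
  have "17 * (1 + B) * sqrt (a + 1) \<ge> 1 * 1" using sa B(1) by (intro mult_mono) auto
  then have C: "C \<ge> 0" "exp C = 17 * (1 + B) * sqrt (a + 1)" unfolding C_def by auto
  define s where "s = r2"
  have Ls: "L + s x > 0" for x using L r2_nonneg[of x] by (simp add: s_def)
  have "has_lap (\<lambda>x. inverse (L + r2 x)) (\<lambda>x. 4 * (r2 x * (2 * inverse (L + r2 x) ^ 3) + - (inverse (L + r2 x))\<^sup>2))"
  proof (rule has_lap_radial)
    fix x
    have p: "L + r2 x \<noteq> 0" using Ls[of x] by (simp add: s_def)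
    show "((\<lambda>s. inverse (L + s)) has_real_derivative - (inverse (L + r2 x))\<^sup>2) (at (r2 x))"
      using p by (auto intro!: derivative_eq_intros simp: power2_eq_square)
    show "((\<lambda>s. - (inverse (L + s))\<^sup>2) has_real_derivative 2 * inverse (L + r2 x) ^ 3) (at (r2 x))"
      using p by (auto intro!: derivative_eq_intros simp: power2_eq_square power3_eq_cube)
  qed
  then have "has_lap (\<lambda>x. C + c * inverse (L + s x)) (\<lambda>x. 0 + c * (4 * (s x * (2 * inverse (L + s x) ^ 3) + - (inverse (L + s x))\<^sup>2)))"
    unfolding s_def by (intro has_lap_add has_lap_const has_lap_cmult)
  then have lap': "laplacian (\<lambda>x. C + c * (bump L x * bump L x)) x = c * (4 * (s x * (2 * inverse (L + s x) ^ 3) + - (inverse (L + s x))\<^sup>2))" for x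
    unfolding bump_square[OF L] s_def[symmetric] by (simp add: has_lap_laplacian inverse_eq_divide)
  have lap: "laplacian (\<lambda>x. C + c * (bump L x * bump L x)) x = 4 * c * (s x - L) / (L + s x) ^ 3" for x
  proof -
    define y where "y = inverse (L + s x)"
    have "(L + s x) * y = 1" using Ls[of x] by (simp add: y_def)
    then have "s x * (2 * y ^ 3) + - y\<^sup>2 = s x * (2 * y ^ 3) + - (((L + s x) * y) * y\<^sup>2)" by simp
    also have "\<dots> = (s x - L) * y ^ 3" by (simp add: algebra_simps power2_eq_square power3_eq_cube)
    finally show ?thesis
      unfolding lap' y_def[symmetric] by (simp add: y_def divide_inverse power_inverse)
  qed
  have cancel: "u * y / y ^ 3 = u / y\<^sup>2" for u y :: real
    by (cases "y = 0") (simp_all add: power2_eq_square power3_eq_cube)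
  show thesis
  proof (rule that[OF C(1) c L])
    fix x
    let ?w = "C + c * (bump L x * bump L x)"
    have w: "?w \<ge> C" using c Ls[of x] unfolding bump_square[OF L] s_def by simp
    have G0: "G x \<ge> 0" using a S_nonneg[of x] T_nonneg[of x] D_pos[of x] by (simp add: G_def)
    have F: "F1 x ?w B \<ge> 2 * q\<^sup>2 * (E x * exp C - 1 - B)"
      unfolding F1_def using G0 E_bounds(1)[of x] w
      by (intro order_trans[OF mult_left_mono[OF diff_right_mono[OF diff_right_mono[OF mult_left_mono[of "exp C" "exp ?w"]]]]]) auto
    show "laplacian (\<lambda>x. C + c * (bump L x * bump L x)) x \<le> F1 x ?w B"
    proof (cases "s x \<ge> L / 2")
      case True
      have "R \<le> norm x"
      proof (rule ccontr)
        assume "\<not> R \<le> norm x"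
        then have "(norm x)\<^sup>2 \<le> R\<^sup>2" by (intro power_mono) auto
        then show False using True unfolding L_def s_def r2_norm by simp
      qed
      then have "S x \<ge> 1" using R[of x] by (simp add: S_def one_le_power)
      then have "1\<^sup>2 \<le> (S x)\<^sup>2" by (intro power_mono) auto
      then have "a * 1 \<le> a * (S x)\<^sup>2" using a by (intro mult_left_mono) auto
      then have "a + (S x)\<^sup>2 \<le> (S x)\<^sup>2 * (a + 1)" by (simp add: algebra_simps)
      then have "D x \<le> sqrt ((S x)\<^sup>2 * (a + 1))" unfolding D_def by (rule real_sqrt_le_mono)
      also have "\<dots> = S x * sqrt (a + 1)" using S_nonneg[of x] by (simp add: real_sqrt_mult)
      finally have "1 \<le> E x * sqrt (a + 1)" unfolding E_def using D_pos[of x] by (simp add: field_simps)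
      then have "17 * (1 + B) * 1 \<le> 17 * (1 + B) * (E x * sqrt (a + 1))"
        using B(1) by (intro mult_left_mono) auto
      then have "E x * exp C \<ge> 17 * (1 + B)" unfolding C(2) by (simp add: mult_ac)
      then have f: "2 * q\<^sup>2 * (16 * (1 + B)) \<le> 2 * q\<^sup>2 * (E x * exp C - 1 - B)" by (intro mult_left_mono) auto
      have "4 * c * (s x - L) / (L + s x) ^ 3 \<le> 4 * c * (L + s x) / (L + s x) ^ 3"
        using c L Ls[of x] by (intro divide_right_mono mult_left_mono) auto
      also have "\<dots> = 4 * c / (L + s x)\<^sup>2" by (rule cancel)
      also have "\<dots> \<le> 4 * c / L\<^sup>2"
        using c L r2_nonneg[of x] by (intro divide_left_mono mult_pos_pos zero_less_power power_mono) (auto simp: s_def)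
      also have "\<dots> = 2 * q\<^sup>2 * (16 * (1 + B))" unfolding c_def using L by simp
      finally show ?thesis using f F unfolding lap by linarith
    next
      case False
      have "(L + s x) ^ 3 \<le> (2 * L) ^ 3" using False Ls[of x] by (intro power_mono) auto
      then have "c / (4 * L\<^sup>2) \<le> 4 * c * (L / 2) / (L + s x) ^ 3"
      proof -
        assume h: "(L + s x) ^ 3 \<le> (2 * L) ^ 3"
        have "4 * c * (L / 2) / (2 * L) ^ 3 \<le> 4 * c * (L / 2) / (L + s x) ^ 3"
          using h c L Ls[of x] by (intro divide_left_mono mult_pos_pos zero_less_power) auto
        moreover have "4 * c * (L / 2) / (2 * L) ^ 3 = c / (4 * L\<^sup>2)" using L by (simp add: field_simps eval_nat_numeral)
        ultimately show ?thesis by simp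
      qed
      moreover have "4 * c * (L / 2) / (L + s x) ^ 3 \<le> 4 * c * (L - s x) / (L + s x) ^ 3"
        using False c Ls[of x] by (intro divide_right_mono mult_left_mono) auto
      moreover have "4 * c * (s x - L) / (L + s x) ^ 3 = - (4 * c * (L - s x) / (L + s x) ^ 3)"
        unfolding minus_divide_left by (rule arg_cong[where f="\<lambda>u. u / _"]) (simp add: algebra_simps)
      moreover have "c / (4 * L\<^sup>2) = 2 * q\<^sup>2 * (1 + B)" unfolding c_def using L by simp
      moreover have "0 \<le> E x * exp C" using E_bounds(1)[of x] by simp
      then have "2 * q\<^sup>2 * (- 1 - B) \<le> 2 * q\<^sup>2 * (E x * exp C - 1 - B)" by (intro mult_left_mono) auto
      ultimately show ?thesis using F unfolding lap by (simp add: algebra_simps)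
    qed
  qed
qed

lemma solution_exists:
  obtains w A where "CBi w" "CBi A" "\<And>x. 0 \<le> w x" "\<And>x. - M x \<le> A x" "\<And>x. A x \<le> B"
    "has_lap w (\<lambda>x. F1 x (w x) (A x))" "has_lap A (\<lambda>x. F2 x (w x) (A x))"
proof -
  obtain C c L where *: "C \<ge> 0" "c > 0" "L > 0"
    "\<And>x. laplacian (\<lambda>x. C + c * (bump L x * bump L x)) x \<le> F1 x (C + c * (bump L x * bump L x)) B"
    using super_solution by blast
  define u where "u x = C + c * (bump L x * bump L x)" for x
  define W where "W = C + c / L"
  \<comment> \<open>Since E \<le> 1 and w \<le> W, this exceeds the derivative of \<open>F1\<close>
    in w and that of \<open>F2\<close> in A, so both G functions increase in their own unknown; h
    realises it as 2/h^2.\<close>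
  define m where "m = k\<^sup>2 + 2 * q\<^sup>2 * exp W"
  define h where "h = sqrt (2 / m)"
  have m: "m > 0" using k q by (simp add: m_def add_pos_pos)
  then have h: "h > 0" "2 / h\<^sup>2 = m" by (simp_all add: h_def)
  have u: "0 \<le> u x" "u x \<le> W" for x
    unfolding u_def W_def bump_square[OF *(3)] using * r2_nonneg[of x] L_r2_pos[OF *(3), of x]
    by (auto intro!: add_left_mono divide_left_mono)
  have CBu: "CBi u" unfolding u_def[abs_def] by (intro CBi_add CBi_mult CBi_const CBi_bump *)
  define G1 where "G1 x v A = m * v - F1 x v A" for x v A
  define G2 where "G2 x v A = m * A - F2 x v A" for x v A
  interpret cooperative G1 G2 h "\<lambda>x. 0" "\<lambda>x. - M x" u "\<lambda>x. B"
  proof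
    show "h > 0" by (rule h)
    fix j and v A :: "real^2 \<Rightarrow> real"
    assume c: "CB j v" "CB j A"
    note r = CB_diff CB_add CB_mult CB_const CB_exp c CBiD[OF CBi_E] CBiD[OF CBi_G]
    show "CB j (\<lambda>x. G1 x (v x) (A x))" unfolding G1_def F1_def by (intro r)
    show "CB j (\<lambda>x. G2 x (v x) (A x))" unfolding G2_def F2_def by (intro r)
  next
    fix v w :: "nat \<Rightarrow> real" and a b x
    assume l: "v \<longlonglongrightarrow> a" "w \<longlonglongrightarrow> b"
    show "(\<lambda>n. G1 x (v n) (w n)) \<longlonglongrightarrow> G1 x a b" "(\<lambda>n. G2 x (v n) (w n)) \<longlonglongrightarrow> G2 x a b"
      unfolding G1_def G2_def F1_def F2_def by (intro tendsto_intros l)+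
  next
    fix x a b a' b'
    assume h: "0 \<le> a" "a \<le> a'" "a' \<le> u x" "- M x \<le> b" "b \<le> b'" "b' \<le> B"
    \<comment> \<open>The mean value estimate for exp, obtained from exp y \<ge> 1 + y.\<close>
    have e: "exp a' - exp a \<le> exp W * (a' - a)"
    proof -
      have "exp a' * (1 + (a - a')) \<le> exp a' * exp (a - a')"
        by (intro mult_left_mono exp_ge_add_one_self) simp
      then have "exp a' - exp a \<le> exp a' * (a' - a)" by (simp add: exp_diff algebra_simps)
      also have "\<dots> \<le> exp W * (a' - a)" using h u(2)[of x] by (intro mult_right_mono) auto
      finally show ?thesis .
    qed
    have eE: "E x * (exp a' - exp a) \<le> 1 * (exp W * (a' - a))"
      using h E_bounds[of x] by (intro mult_mono e) auto
    then have "2 * q\<^sup>2 * (E x * (exp a' - exp a)) \<le> 2 * q\<^sup>2 * (exp W * (a' - a))"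
      by (intro mult_left_mono) auto
    moreover have "2 * q\<^sup>2 * (exp W * (a' - a)) \<le> m * (a' - a)"
      unfolding mult.assoc[symmetric] using h by (intro mult_right_mono) (auto simp: m_def)
    moreover have "2 * q\<^sup>2 * b \<le> 2 * q\<^sup>2 * b'" using h by (intro mult_left_mono) auto
    ultimately show "G1 x a b \<le> G1 x a' b'" unfolding G1_def F1_def by (simp add: algebra_simps)
    have "exp a \<le> exp W" using h u(2)[of x] by simp
    then have "E x * exp a \<le> 1 * exp W" using E_bounds[of x] by (intro mult_mono) auto
    then have "2 * q\<^sup>2 * (E x * exp a) \<le> 2 * q\<^sup>2 * exp W" by (intro mult_left_mono) auto
    then have "0 \<le> (m - k\<^sup>2 - 2 * q\<^sup>2 * (E x * exp a)) * (b' - b)"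
      using h by (intro mult_nonneg_nonneg) (auto simp: m_def)
    moreover have "2 * q\<^sup>2 * b' \<le> 2 * q\<^sup>2 * B" using h by (intro mult_left_mono) auto
    then have "0 \<le> (E x * (exp a' - exp a)) * (k\<^sup>2 - 2 * q\<^sup>2 * b')"
      using h E_bounds[of x] by (intro mult_nonneg_nonneg) (auto simp: B(2))
    \<comment> \<open>First A is raised at fixed a, then w at fixed b'. The second coefficient is
      nonnegative precisely because b' \<le> B.\<close>
    moreover have "G2 x a' b' - G2 x a b = (m - k\<^sup>2 - 2 * q\<^sup>2 * (E x * exp a)) * (b' - b) +
        (E x * (exp a' - exp a)) * (k\<^sup>2 - 2 * q\<^sup>2 * b')"
      unfolding G2_def F2_def by (simp add: algebra_simps)
    ultimately show "G2 x a b \<le> G2 x a' b'" by linarith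
  next
    show "CBi (\<lambda>x::real^2. 0::real)" "CBi (\<lambda>x. - M x)" "CBi u" "CBi (\<lambda>x::real^2. B)"
      by (intro CBi_const CBi_uminus CBi_M CBu)+
    fix x
    show "0 \<le> u x" by (rule u)
    show "- M x \<le> B" using M_nonneg[of x] B(1) by linarith
    have l0: "laplacian (\<lambda>x. r) x = 0" for r x using has_lap_laplacian[OF has_lap_const[of r]] by simp
    show "2 / h\<^sup>2 * 0 - laplacian (\<lambda>x. 0) x \<le> G1 x 0 (- M x)"
      using sub_solution(1)[of x] by (simp add: G1_def l0)
    show "2 / h\<^sup>2 * (- M x) - laplacian (\<lambda>x. - M x) x \<le> G2 x 0 (- M x)"
      using sub_solution(2)[of x] by (simp add: G2_def h(2))
    show "G1 x (u x) B \<le> 2 / h\<^sup>2 * u x - laplacian u x"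
      using *(4)[of x] unfolding u_def[symmetric] by (simp add: G1_def h(2))
    \<comment> \<open>At A = B the terms in w cancel and \<open>F2\<close> equals k^2 (1 + B),
      whereas the Laplacian of a constant is 0.\<close>
    have "0 \<le> k\<^sup>2 * (1 + B)" using B(1) by simp
    also have "\<dots> = F2 x (u x) B"
    proof -
      have "F2 x (u x) B = k\<^sup>2 * (1 + B) + (E x * exp (u x)) * (2 * q\<^sup>2 * B - k\<^sup>2)"
        unfolding F2_def by (simp add: algebra_simps)
      then show ?thesis by (simp add: B(2))
    qed
    finally show "G2 x (u x) B \<le> 2 / h\<^sup>2 * B - laplacian (\<lambda>x. B) x"
      by (simp add: G2_def h(2) l0)
  qed
  obtain v w where s: "CBi v" "CBi w" "\<And>x. 0 \<le> v x \<and> - M x \<le> w x \<and> v x \<le> u x \<and> w x \<le> B"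
    "has_lap v (\<lambda>x. 2 / h\<^sup>2 * v x - G1 x (v x) (w x))" "has_lap w (\<lambda>x. 2 / h\<^sup>2 * w x - G2 x (v x) (w x))"
    using cooperative_solution by blast
  have "(\<lambda>x. 2 / h\<^sup>2 * v x - G1 x (v x) (w x)) = (\<lambda>x. F1 x (v x) (w x))"
    "(\<lambda>x. 2 / h\<^sup>2 * w x - G2 x (v x) (w x)) = (\<lambda>x. F2 x (v x) (w x))"
    by (simp_all add: G1_def G2_def h(2))
  then show thesis using that[of v w] s by auto
qed

text \<open>The weight \<open>E\<close> is \<open>|P|\<^sup>2 exp (- K)\<close>, so \<open>U = |P|\<^sup>2 exp (w - K)\<close>; the gradient terms of its
  Laplacian form a square because \<open>P\<close> is holomorphic, which avoids taking logarithms at the zeros.\<close>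

lemma density_eq: "E x * exp (w x) = S x * exp (w x - K x)"
proof -
  have "K x = ln (D x)" unfolding K_def D_def using ln_sqrt[OF less_imp_le[OF Q_pos[of "S x"]]] by simp
  then show ?thesis using D_pos[of x] by (simp add: E_def exp_diff)
qed

text \<open>\<open>o1\<close> and \<open>o2\<close> form the gradient of w - K, which is twice the
  exponent v in phi = P e^v.\<close>

definition o1 where "o1 w x = partial 1 w x - partial 1 K x"
definition o2 where "o2 w x = partial 2 w x - partial 2 K x"

lemma has_grad_phase: "CBi w \<Longrightarrow> has_grad (\<lambda>x. w x - K x) (o1 w) (o2 w)"
  unfolding o1_def[abs_def] o2_def[abs_def] by (intro has_grad_diff CBi_has_grad K_grad)

lemma CBi_phase_grad: assumes "CBi w" shows "CBi (o1 w)" "CBi (o2 w)"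
  unfolding o1_def[abs_def] o2_def[abs_def] by (intro CBi_diff CBi_partial assms K_grad)+

text \<open>The source \<open>G\<close> of \<open>F1\<close> is the Laplacian of K and cancels, so
  the equation for |phi|^2 appears in its original form, now also at the zeros.\<close>

lemma phase_divergence:
  assumes w: "CBi w" "has_lap w (\<lambda>x. F1 x (w x) (A x))"
  shows "partial 1 (o1 w) x + partial 2 (o2 w) x = 2 * q\<^sup>2 * (E x * exp (w x) - 1 - A x)"
proof -
  have "has_lap (\<lambda>x. w x - K x) (\<lambda>x. partial 1 (o1 w) x + partial 2 (o2 w) x)"
    by (rule has_lapI[OF has_grad_phase[OF w(1)] CBi_has_grad[OF CBi_phase_grad(1)[OF w(1)]]
        CBi_has_grad[OF CBi_phase_grad(2)[OF w(1)]]]) simp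
  from fun_cong[OF has_lap_unique[OF this has_lap_diff[OF w(2) has_lap_K]], of x]
  show ?thesis by (simp add: F1_def)
qed

lemma lap_density:
  assumes w: "CBi w" "has_lap w (\<lambda>x. F1 x (w x) (A x))"
  obtains l where "has_lap (\<lambda>x. E x * exp (w x)) l"
    "\<And>x. 2 * q\<^sup>2 * (E x * exp (w x)) * (E x * exp (w x) - 1 - A x) \<le> l x"
proof -
  define o' where "o' x = w x - K x" for x
  define v1 where "v1 = o1 w"
  define v2 where "v2 = o2 w"
  have o: "has_grad o' v1 v2" unfolding o'_def[abs_def] v1_def v2_def by (rule has_grad_phase[OF w(1)])
  note oo = CBi_has_grad[OF CBi_phase_grad(1)[OF w(1)], folded v1_def] CBi_has_grad[OF CBi_phase_grad(2)[OF w(1)], folded v2_def]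
  note lo = phase_divergence[OF w, folded v1_def v2_def]
  have ex: "E x * exp (w x) = S x * exp (o' x)" for x unfolding o'_def by (rule density_eq)
  have g: "has_grad (\<lambda>x. exp (o' x)) (\<lambda>x. exp (o' x) * v1 x) (\<lambda>x. exp (o' x) * v2 x)"
    by (rule has_grad_compose[OF DERIV_exp o])
  \<comment> \<open>With v the gradient of w - K, the terms 4T + 2 S1 v1 + 2 S2 v2 + S |v|^2 are the
    square of |2P' + P (v1 - i v2)|. Dropping it gives the differential inequality.\<close>
  let ?l = "\<lambda>x. exp (o' x) * ((cmod (2 * P' x + P x * Complex (v1 x) (- v2 x)))\<^sup>2 + S x * (partial 1 v1 x + partial 2 v2 x))"
  show thesis
  proof (rule that)
    show "has_lap (\<lambda>x. E x * exp (w x)) ?l"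
      unfolding ex
    proof (rule has_lapI[OF has_grad_mult[OF has_grad_S g]
        has_grad_add[OF has_grad_mult[OF has_grad_S12(1) g] has_grad_mult[OF has_grad_S has_grad_mult[OF g oo(1)]]]
        has_grad_add[OF has_grad_mult[OF has_grad_S12(2) g] has_grad_mult[OF has_grad_S has_grad_mult[OF g oo(2)]]]])
      fix x
      have S: "S x = (Re (P x))\<^sup>2 + (Im (P x))\<^sup>2" by (simp add: S_def cmod_power2)
      show "?l x = (2 * Re (W1 x) * exp (o' x) + S1 x * (exp (o' x) * v1 x) +
            (S1 x * (exp (o' x) * v1 x) + S x * (exp (o' x) * v1 x * v1 x + exp (o' x) * partial 1 v1 x))) +
          (2 * Re (\<i> * W2 x) * exp (o' x) + S2 x * (exp (o' x) * v2 x) +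
            (S2 x * (exp (o' x) * v2 x) + S x * (exp (o' x) * v2 x * v2 x + exp (o' x) * partial 2 v2 x)))"
        unfolding S S1_def S2_def W1_def W2_def cmod_power2
        by (simp add: algebra_simps power2_eq_square)
    qed
    fix x
    have "2 * q\<^sup>2 * (E x * exp (w x)) * (E x * exp (w x) - 1 - A x) = exp (o' x) * (0 + S x * (partial 1 v1 x + partial 2 v2 x))"
      unfolding lo ex by (simp add: algebra_simps)
    also have "\<dots> \<le> ?l x" by (intro mult_left_mono add_right_mono) auto
    finally show "2 * q\<^sup>2 * (E x * exp (w x)) * (E x * exp (w x) - 1 - A x) \<le> ?l x" .
  qed
qed

end

section \<open>A priori bounds and the vortex solution\<close>

context vortex_system
begin

context
  fixes w A :: "real^2 \<Rightarrow> real"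
  assumes w: "CBi w" "has_lap w (\<lambda>x. F1 x (w x) (A x))" and A: "CBi A" "has_lap A (\<lambda>x. F2 x (w x) (A x))"
begin

definition U where "U x = E x * exp (w x)"

lemma U_nonneg: "U x \<ge> 0" using E_bounds[of x] by (simp add: U_def)

lemma CBi_U: "CBi U" unfolding U_def[abs_def] by (intro CBi_mult CBi_exp CBi_E w)

lemma lap_U: obtains l where "has_lap U l" "\<And>x. 2 * q\<^sup>2 * U x * (U x - 1 - A x) \<le> l x"
  using lap_density[OF w] unfolding U_def[abs_def] by blast

lemma CBi_upper_bound: "CBi f \<Longrightarrow> \<exists>C. \<forall>x. f x \<le> C" for f :: "real^2 \<Rightarrow> real"
  using CB_measurable_bound(2)[OF CBiD[of f 0]] by (meson abs_le_D1)

text \<open>The equation for U bounds sup U by about 1 + sup A. At a near maximum of A the term k^2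
  (1 - U + A) is then almost nonnegative, so 2q^2 U A must be small; but U \<ge> 1/2 there, which
  rules out A > 0.\<close>

lemma A_nonpos: "A x0 \<le> 0"
proof (rule ccontr)
  assume "\<not> A x0 \<le> 0"
  define \<alpha> where "\<alpha> = A x0"
  have \<alpha>: "\<alpha> > 0" using \<open>\<not> A x0 \<le> 0\<close> by (simp add: \<alpha>_def)
  \<comment> \<open>The three entries give A x \<ge> \<alpha>/2, then U x \<ge> 1/2, and the final
    contradiction of 4 q^2 U A \<ge> q^2 \<alpha> with 2 q^2 U A \<le> e (1 + 3k^2).\<close>
  define e where "e = min (\<alpha>/2) (min (k\<^sup>2/2) (q\<^sup>2 * \<alpha> / (4 * (1 + 3 * k\<^sup>2))))"
  have k3: "1 + 3 * k\<^sup>2 > 0" by (simp add: add_pos_nonneg)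
  have e: "e > 0" using \<alpha> k q k3 by (simp add: e_def)
  have e1: "e \<le> \<alpha>/2" "e \<le> k\<^sup>2/2"
    unfolding e_def by (rule min.cobounded1, rule min.coboundedI2, rule min.cobounded1)
  have k4: "0 < 4 * (1 + 3 * k\<^sup>2)" using k3 by simp
  have "e \<le> q\<^sup>2 * \<alpha> / (4 * (1 + 3 * k\<^sup>2))"
    unfolding e_def by (rule min.coboundedI2, rule min.cobounded2)
  then have "e * (4 * (1 + 3 * k\<^sup>2)) \<le> q\<^sup>2 * \<alpha>" unfolding pos_le_divide_eq[OF k4] .
  then have e2: "4 * (e * (1 + 3 * k\<^sup>2)) \<le> q\<^sup>2 * \<alpha>" by (simp only: mult.left_commute[of e])
  obtain C where C: "\<And>x. A x \<le> C" using CBi_upper_bound[OF A(1)] by blast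
  obtain x where x: "\<And>y. A y \<le> A x + e" "F2 x (w x) (A x) \<le> e"
    using almost_maximum[OF A(2) C e] by blast
  have Ax: "A x \<ge> \<alpha>/2" using x(1)[of x0] e1 by (simp add: \<alpha>_def)
  obtain l where l: "has_lap U l" "\<And>x. 2 * q\<^sup>2 * U x * (U x - 1 - A x) \<le> l x" by (rule lap_U) blast
  obtain C' where C': "\<And>x. U x \<le> C'" using CBi_upper_bound[OF CBi_U] by blast
  define e' where "e' = min e (q\<^sup>2 * e)"
  have e': "e' > 0" "e' \<le> e" "e' \<le> q\<^sup>2 * e" using e q by (auto simp: e'_def)
  obtain x1 where x1: "\<And>y. U y \<le> U x1 + e'" "l x1 \<le> e'"
    using almost_maximum[OF l(1) C' e'(1)] by blast
  \<comment> \<open>A and U have different near maximisers x and x1. They are linked by A x1 \<le> A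
    x + e, so a bound by A x1 becomes one by A x.\<close>
  have "U x1 \<le> 1 + A x + 2 * e"
  proof (rule ccontr)
    assume "\<not> U x1 \<le> 1 + A x + 2 * e"
    then have u: "U x1 > 1" "U x1 - 1 - A x1 > e" using Ax \<alpha> e x(1)[of x1] by linarith+
    have "1 * e \<le> U x1 * (U x1 - 1 - A x1)" using u e by (intro mult_mono) auto
    then have "2 * q\<^sup>2 * (1 * e) \<le> 2 * q\<^sup>2 * (U x1 * (U x1 - 1 - A x1))" by (intro mult_left_mono) auto
    also have "\<dots> \<le> e'" using l(2)[of x1] x1(2) by (simp add: mult.assoc)
    finally have "2 * (q\<^sup>2 * e) \<le> e'" by (simp add: mult.assoc)
    moreover have "q\<^sup>2 * e > 0" using q e by simp
    ultimately show False using e'(3) by linarith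
  qed
  then have Ux: "U x \<le> 1 + A x + 3 * e" using x1(1)[of x] e'(2) by linarith
  have F: "k\<^sup>2 * (1 - U x + A x) + 2 * q\<^sup>2 * U x * A x \<le> e"
    using x(2) by (simp add: F2_def U_def mult.assoc)
  have UA: "2 * q\<^sup>2 * U x * A x \<ge> 0" using U_nonneg[of x] Ax \<alpha> by simp
  have "k\<^sup>2 * (- 3 * e) \<le> k\<^sup>2 * (1 - U x + A x)" using Ux by (intro mult_left_mono) auto
  then have up: "2 * q\<^sup>2 * U x * A x \<le> e * (1 + 3 * k\<^sup>2)" using F by (simp add: algebra_simps)
  have "U x \<ge> 1/2"
  proof (rule ccontr)
    assume "\<not> U x \<ge> 1/2"
    then have "k\<^sup>2 * (1/2 + A x) < k\<^sup>2 * (1 - U x + A x)" using k by (intro mult_strict_left_mono) auto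
    moreover have "k\<^sup>2 * A x > 0" using k Ax \<alpha> by simp
    ultimately show False using F UA e1(2) by (simp add: algebra_simps)
  qed
  then have "(1/2) * (\<alpha>/2) \<le> U x * A x" using Ax \<alpha> by (intro mult_mono) auto
  then have "2 * q\<^sup>2 * ((1/2) * (\<alpha>/2)) \<le> 2 * q\<^sup>2 * (U x * A x)" by (intro mult_left_mono) auto
  then have "q\<^sup>2 * \<alpha> \<le> 4 * (q\<^sup>2 * (U x * A x))" by (simp add: mult_ac)
  moreover have "2 * (q\<^sup>2 * (U x * A x)) \<le> e * (1 + 3 * k\<^sup>2)" using up by (simp add: mult.assoc)
  moreover have "e * (1 + 3 * k\<^sup>2) > 0" using e k3 by simp
  ultimately show False using e2 by linarith
qed

lemma U_le_1: "U x0 \<le> 1"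
proof (rule ccontr)
  assume "\<not> U x0 \<le> 1"
  define \<alpha> where "\<alpha> = U x0 - 1"
  have \<alpha>: "\<alpha> > 0" using \<open>\<not> U x0 \<le> 1\<close> by (simp add: \<alpha>_def)
  define e where "e = min (\<alpha>/2) (q\<^sup>2 * \<alpha> / 2)"
  have e: "e > 0" "e \<le> \<alpha>/2" "e \<le> q\<^sup>2 * \<alpha> / 2" using \<alpha> q by (auto simp: e_def)
  obtain l where l: "has_lap U l" "\<And>x. 2 * q\<^sup>2 * U x * (U x - 1 - A x) \<le> l x" by (rule lap_U) blast
  obtain C where C: "\<And>x. U x \<le> C" using CBi_upper_bound[OF CBi_U] by blast
  obtain x where x: "\<And>y. U y \<le> U x + e" "l x \<le> e" using almost_maximum[OF l(1) C e(1)] by blast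
  have U: "U x \<ge> 1 + \<alpha>/2" using x(1)[of x0] e(2) \<alpha>_def by linarith
  have "1 * (\<alpha>/2) \<le> U x * (U x - 1 - A x)" using U \<alpha> A_nonpos[of x] by (intro mult_mono) auto
  then have "2 * q\<^sup>2 * (1 * (\<alpha>/2)) \<le> 2 * q\<^sup>2 * (U x * (U x - 1 - A x))" by (intro mult_left_mono) auto
  also have "\<dots> \<le> e" using l(2)[of x] x(2) by (simp add: mult.assoc)
  finally have "q\<^sup>2 * \<alpha> \<le> e" by (simp add: mult.assoc)
  moreover have "q\<^sup>2 * \<alpha> > 0" using q \<alpha> by simp
  ultimately show False using e(3) by linarith
qed

text \<open>For f = U - 1 - A, where f \<ge> 0, the equations and A \<le> 0 make the Laplacian at
  least k^2 f, so a positive supremum contradicts the near maximum.\<close>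

lemma minus_A_le: "- A x0 \<le> 1 - U x0"
proof (rule ccontr)
  assume *: "\<not> - A x0 \<le> 1 - U x0"
  define f where "f x = U x - 1 - A x" for x
  define \<alpha> where "\<alpha> = f x0"
  have \<alpha>: "\<alpha> > 0" using * by (simp add: \<alpha>_def f_def)
  define e where "e = min (\<alpha>/2) (k\<^sup>2 * \<alpha> / 4)"
  have e: "e > 0" "e \<le> \<alpha>/2" "e \<le> k\<^sup>2 * \<alpha> / 4" using \<alpha> k by (auto simp: e_def)
  obtain l where l: "has_lap U l" "\<And>x. 2 * q\<^sup>2 * U x * (U x - 1 - A x) \<le> l x" by (rule lap_U) blast
  have "has_lap (\<lambda>x. U x - 1 - A x) (\<lambda>x. l x - 0 - F2 x (w x) (A x))"
    by (intro has_lap_diff has_lap_const l A)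
  then have lf: "has_lap f (\<lambda>x. l x - F2 x (w x) (A x))" by (simp add: f_def[abs_def])
  have "CBi f" unfolding f_def[abs_def] by (intro CBi_diff CBi_const CBi_U A)
  then obtain C where C: "\<And>x. f x \<le> C" using CBi_upper_bound by blast
  obtain x where x: "\<And>y. f y \<le> f x + e" "l x - F2 x (w x) (A x) \<le> e"
    using almost_maximum[OF lf C e(1)] by blast
  have fx: "f x \<ge> \<alpha>/2" using x(1)[of x0] e(2) by (simp add: \<alpha>_def)
  have "F2 x (w x) (A x) = - (k\<^sup>2 * f x) + 2 * q\<^sup>2 * (U x * A x)"
    by (simp add: F2_def U_def f_def algebra_simps)
  moreover have "2 * q\<^sup>2 * (U x * A x) \<le> 0"
    using U_nonneg[of x] A_nonpos[of x] by (simp add: mult_nonneg_nonpos)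
  moreover have "0 \<le> 2 * q\<^sup>2 * U x * f x" using U_nonneg[of x] fx \<alpha> by simp
  then have "0 \<le> l x" using l(2)[of x] unfolding f_def by linarith
  ultimately have "k\<^sup>2 * f x \<le> e" using x(2) by linarith
  moreover have "k\<^sup>2 * (\<alpha>/2) \<le> k\<^sup>2 * f x" using fx by (intro mult_left_mono) auto
  moreover have "k\<^sup>2 * \<alpha> > 0" using k \<alpha> by simp
  ultimately show False using e(3) by simp
qed

section \<open>The fields and the equations they satisfy\<close>

definition phi where "phi x = P x * of_real (exp ((w x - K x) / 2))"

lemma CBi_phi: "CBi phi"
proof -
  have "CBi (\<lambda>x. (P x * of_real (exp (- K x / 2))) * of_real (exp (1/2 * w x)))"
    by (intro CBi_mult[OF CBi_phase] CBi_linear[OF bounded_linear_of_real] CBi_exp CBi_mult CBi_const w)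
  moreover have "(P x * of_real (exp (- K x / 2))) * of_real (exp (1/2 * w x)) = phi x" for x
    unfolding phi_def mult.assoc of_real_mult[symmetric] exp_add[symmetric] by (simp add: diff_divide_distrib)
  ultimately show ?thesis by simp
qed

lemma phi_sq: "(cmod (phi x))\<^sup>2 = U x"
proof -
  have "(exp ((w x - K x) / 2))\<^sup>2 = exp (w x - K x)" by (simp add: power2_eq_square exp_add[symmetric])
  then show ?thesis unfolding phi_def U_def density_eq by (simp add: norm_mult power_mult_distrib S_def)
qed

lemma phi_partial:
  "partial 1 phi x = (P' x + P x * of_real (o1 w x / 2)) * of_real (exp ((w x - K x) / 2))"
  "partial 2 phi x = (\<i> * P' x + P x * of_real (o2 w x / 2)) * of_real (exp ((w x - K x) / 2))"
proof -
  have "has_grad (\<lambda>x. exp (1/2 * (w x - K x))) (\<lambda>x. exp (1/2 * (w x - K x)) * (1/2 * o1 w x))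
      (\<lambda>x. exp (1/2 * (w x - K x)) * (1/2 * o2 w x))"
    by (rule has_grad_compose[OF DERIV_exp has_grad_cmult[OF has_grad_phase[OF w(1)]]])
  from has_grad_mult[OF has_grad_P has_grad_linear[OF bounded_linear_of_real this]]
  have "has_grad phi (\<lambda>x. P' x * of_real (exp (1/2 * (w x - K x))) + P x * of_real (exp (1/2 * (w x - K x)) * (1/2 * o1 w x)))
     (\<lambda>x. \<i> * P' x * of_real (exp (1/2 * (w x - K x))) + P x * of_real (exp (1/2 * (w x - K x)) * (1/2 * o2 w x)))"
    by (simp add: phi_def[abs_def])
  from has_grad_partial[OF this]
  show "partial 1 phi x = (P' x + P x * of_real (o1 w x / 2)) * of_real (exp ((w x - K x) / 2))"
    "partial 2 phi x = (\<i> * P' x + P x * of_real (o2 w x / 2)) * of_real (exp ((w x - K x) / 2))"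
    by (simp_all add: distrib_right mult.assoc)
qed

definition A0 where "A0 x = q / k * A x"
text \<open>In (D_1 + iD_2) phi the P' terms cancel by holomorphy, which leaves (o1 + i o2)/2 = i q
  (A1 + i A2). Real and imaginary parts give \<open>A2\<close> and \<open>A1\<close>.\<close>

definition A1 where "A1 x = 1 / (2 * q) * o2 w x"
definition A2 where "A2 x = - 1 / (2 * q) * o1 w x"
definition N where "N x = - A0 x"

lemma smooth_solution: "smooth phi" "smooth A0" "smooth A1" "smooth A2" "smooth N"
  unfolding A0_def[abs_def] A1_def[abs_def] A2_def[abs_def] N_def[abs_def]
  by (intro CBi_smooth CBi_phi CBi_uminus CBi_mult CBi_const CBi_phase_grad w A)+

lemma bogomolnyi_solution: "bogomolnyi q k phi A0 A1 A2 N"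
  unfolding bogomolnyi_def
proof (intro allI conjI)
  fix x
  show "A0 x = - N x" by (simp add: N_def)
  have q0: "q * A1 x = o2 w x / 2" "q * A2 x = - (o1 w x / 2)" using q by (simp_all add: A1_def A2_def)
  show "cov_deriv q A1 1 phi x + \<i> * cov_deriv q A2 2 phi x = 0"
    unfolding cov_deriv_def q0 phi_partial phi_def by (simp add: algebra_simps)
  have g1: "has_grad A1 (\<lambda>x. 1 / (2 * q) * partial 1 (o2 w) x) (\<lambda>x. 1 / (2 * q) * partial 2 (o2 w) x)"
    unfolding A1_def[abs_def] by (intro has_grad_cmult CBi_has_grad CBi_phase_grad w)
  have g2: "has_grad A2 (\<lambda>x. - 1 / (2 * q) * partial 1 (o1 w) x) (\<lambda>x. - 1 / (2 * q) * partial 2 (o1 w) x)"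
    unfolding A2_def[abs_def] by (intro has_grad_cmult CBi_has_grad CBi_phase_grad w)
  have "curvature A1 A2 x = - (1 / (2 * q) * (partial 1 (o1 w) x + partial 2 (o2 w) x))"
    unfolding curvature_def has_grad_partial[OF g1] has_grad_partial[OF g2] by (simp add: algebra_simps)
  also have "\<dots> = - (q * (U x - 1 - A x))"
    unfolding phase_divergence[OF w] U_def using q by (simp add: power2_eq_square)
  finally show "curvature A1 A2 x + (q * (cmod (phi x))\<^sup>2 + k * N x - q) = 0"
    unfolding phi_sq N_def A0_def using k by (simp add: algebra_simps)
  have "laplacian A0 x = q / k * F2 x (w x) (A x)"
    using has_lap_laplacian[OF has_lap_cmult[OF A(2), of "q / k"]] by (simp add: A0_def[abs_def])
  also have "\<dots> = k * q * (1 - U x) + k\<^sup>2 * A0 x + 2 * q\<^sup>2 * U x * A0 x"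
    unfolding F2_def U_def A0_def using k by (simp add: field_simps power2_eq_square)
  finally show "laplacian A0 x = k * q * (1 - (cmod (phi x))\<^sup>2) + k\<^sup>2 * A0 x + 2 * q\<^sup>2 * (cmod (phi x))\<^sup>2 * A0 x"
    unfolding phi_sq .
qed

lemma solution_bounds: "0 \<le> k / q * N x" "k / q * N x = - (k / q) * A0 x" "- (k / q) * A0 x \<le> 1 - (cmod (phi x))\<^sup>2"
  using A_nonpos[of x] minus_A_le[of x] q k unfolding phi_sq N_def A0_def by simp_all

text \<open>E^2 = 1 - a/D^2 and D \<ge> S give 1 - a |P|^(-4) \<le> E^2 \<le> E, valid where |P|
  \<ge> 1.\<close>

lemma E_limit: "(E \<longlongrightarrow> 1) at_infinity"
proof -
  have "((\<lambda>x. cmod (inverse (P x))) \<longlongrightarrow> 0) at_infinity"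
    by (rule tendsto_norm_zero[OF filterlim_compose[OF tendsto_inverse_0 P_limit]])
  then have "((\<lambda>x. 1 - a * (cmod (inverse (P x))) ^ 4) \<longlongrightarrow> 1 - a * 0 ^ 4) at_infinity"
    by (intro tendsto_intros)
  then have l: "((\<lambda>x. 1 - a * (cmod (inverse (P x))) ^ 4) \<longlongrightarrow> 1) at_infinity" by simp
  have "\<forall>\<^sub>F x in at_infinity. 1 \<le> norm (P x)"
    using P_limit unfolding filterlim_at_infinity_conv_norm_at_top by (simp add: filterlim_at_top)
  then have low: "\<forall>\<^sub>F x in at_infinity. 1 - a * (cmod (inverse (P x))) ^ 4 \<le> E x"
  proof eventually_elim
    case (elim x)
    have S: "S x \<ge> 1" using elim by (simp add: S_def one_le_power)
    have "a / (D x)\<^sup>2 \<le> a / (S x)\<^sup>2"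
      using a S S_le_D[of x] D_pos[of x] by (intro divide_left_mono power_mono mult_pos_pos) auto
    also have "\<dots> = a * (cmod (inverse (P x))) ^ 4"
      by (simp add: S_def norm_inverse divide_inverse power_inverse)
    finally have "1 - a * (cmod (inverse (P x))) ^ 4 \<le> 1 - a / (D x)\<^sup>2" by simp
    also have "1 - a / (D x)\<^sup>2 = (E x)\<^sup>2"
    proof -
      have "a = (D x)\<^sup>2 - (S x)\<^sup>2" by (simp add: D_sq)
      then show ?thesis using D_pos[of x] by (simp add: E_def power_divide field_simps)
    qed
    also have "\<dots> \<le> E x"
      using mult_left_mono[OF E_bounds(2)[of x] E_bounds(1)[of x]] by (simp add: power2_eq_square)
    finally show ?case .
  qed
  have "\<forall>\<^sub>F x in at_infinity. E x \<le> 1" using E_bounds(2) by (simp add: always_eventually)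
  from tendsto_sandwich[OF low this l tendsto_const] show ?thesis .
qed

text \<open>The barrier w \<ge> 0 means E \<le> U, so U is squeezed to 1, and then N is squeezed to
  0 by (q/k)(1 - U).\<close>

lemma topological_solution:
  assumes "\<And>x. 0 \<le> w x"
  shows "topological phi A0 N"
  unfolding topological_def phi_sq
proof (intro conjI allI)
  have "E x \<le> U x" for x
    using mult_left_mono[of 1 "exp (w x)" "E x"] assms[of x] E_bounds[of x] by (simp add: U_def)
  then have low: "\<forall>\<^sub>F x in at_infinity. E x \<le> U x" by (intro always_eventually) blast
  have "\<forall>\<^sub>F x in at_infinity. U x \<le> 1" using U_le_1 by (intro always_eventually) blast
  from tendsto_sandwich[OF low this E_limit tendsto_const] show U: "(U \<longlongrightarrow> 1) at_infinity" .
  show "N x = - A0 x" for x by (simp add: N_def)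
  have qk: "q / k \<ge> 0" using q k by simp
  have "0 \<le> N x" "N x \<le> q / k * (1 - U x)" for x
    unfolding N_def A0_def
    using mult_nonneg_nonpos[OF qk A_nonpos[of x]] mult_left_mono[OF minus_A_le[of x] qk] by linarith+
  then have b: "\<forall>\<^sub>F x in at_infinity. 0 \<le> N x" "\<forall>\<^sub>F x in at_infinity. N x \<le> q / k * (1 - U x)"
    by (intro always_eventually; blast)+
  have "((\<lambda>x. q / k * (1 - U x)) \<longlongrightarrow> q / k * (1 - 1)) at_infinity" by (intro tendsto_intros U)
  then have "((\<lambda>x. q / k * (1 - U x)) \<longlongrightarrow> 0) at_infinity" by simp
  from tendsto_sandwich[OF b tendsto_const this] show "(N \<longlongrightarrow> 0) at_infinity" .
qed

end

end

section \<open>Winding numbers at the zeros and assembly of the solution\<close>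

lemma cx_circle_at: "cx (circle_at z r t) = cx z + of_real r * exp (2 * of_real pi * \<i> * of_real t)"
proof -
  have "exp (2 * of_real pi * \<i> * of_real t) = Complex (cos (2 * pi * t)) (sin (2 * pi * t))"
    using cis_conv_exp[of "2 * pi * t"] by (simp add: cis.ctr mult_ac)
  then show ?thesis by (simp add: cx_def circle_at_def complex_eq_iff)
qed

text \<open>On a small circle the normalised field has an explicit continuous logarithm l, so its
  winding number is (l 1 - l 0) / (2 pi i). The positive factor \<rho> disappears in the
  normalisation.\<close>

lemma vanishes_with_winding_poly:
  fixes g :: "complex poly"
  assumes \<phi>: "\<And>x. \<phi> x = (cx x - cx z) ^ n * poly g (cx x) * of_real (\<rho> x)" and \<rho>: "\<And>x. \<rho> x > 0"
    and g: "poly g (cx z) \<noteq> 0" and n: "n > 0"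
  shows "vanishes_with_winding \<phi> z n"
proof -
  define g0 where "g0 = poly g (cx z)"
  have "isCont (\<lambda>\<zeta>. poly g \<zeta> / g0) (cx z)" using g by (intro continuous_intros) (simp add: g0_def)
  \<comment> \<open>Within this radius g/g0 stays in the disc of radius 1 about 1, hence in the
    right half-plane, where the principal logarithm is continuous.\<close>
  then obtain \<delta> where \<delta>: "\<delta> > 0" "\<And>\<zeta>. dist \<zeta> (cx z) < \<delta> \<Longrightarrow> dist (poly g \<zeta> / g0) (poly g (cx z) / g0) < 1"
    unfolding continuous_at_eps_delta by (metis zero_less_one)
  have pos: "Re (poly g \<zeta> / g0) > 0" if "cmod (\<zeta> - cx z) < \<delta>" for \<zeta>
  proof -
    have "cmod (poly g \<zeta> / g0 - 1) < 1" using \<delta>(2)[of \<zeta>] that g by (simp add: dist_norm g0_def)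
    then show ?thesis using abs_Re_le_cmod[of "poly g \<zeta> / g0 - 1"] by simp
  qed
  have gnz: "poly g \<zeta> \<noteq> 0" if "cmod (\<zeta> - cx z) < \<delta>" for \<zeta> using pos[OF that] by auto
  have d: "cmod (cx x - cx z) = dist x z" for x
  proof -
    have "cx x - cx z = cx (x - z)" by (simp add: cx_def complex_eq_iff)
    then show ?thesis by (simp add: cmod_cx dist_norm)
  qed
  show ?thesis
    unfolding vanishes_with_winding_def
  proof (intro conjI exI[of _ \<delta>] allI impI)
    show "\<phi> z = 0" using n by (simp add: \<phi>)
    show "\<delta> > 0" by (rule \<delta>)
    show "\<phi> x \<noteq> 0" if "0 < dist x z \<and> dist x z < \<delta>" for x
    proof -
      have "cx x - cx z \<noteq> 0" using that d[of x] by auto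
      moreover have "poly g (cx x) \<noteq> 0" using that by (intro gnz) (simp add: d)
      ultimately show ?thesis using \<rho>[of x] by (simp add: \<phi>)
    qed
    fix r assume r: "0 < r \<and> r < \<delta>"
    define c where "c t = cx (circle_at z r t)" for t
    define h where "h t = poly g (c t) / g0" for t
    \<comment> \<open>The summands are the rotation of (\<zeta> - z)^n, the argument of g/g0 as Ln
      minus its real part, and the constant argument of g0.\<close>
    define l where "l t = 2 * of_real pi * \<i> * of_nat n * of_real t + Ln (h t) - of_real (ln (cmod (h t))) + Ln (g0 / of_real (cmod g0))" for t
    have ce: "c t - cx z = of_real r * exp (2 * of_real pi * \<i> * of_real t)" for t
      by (simp add: c_def cx_circle_at)
    have cr: "cmod (c t - cx z) = r" for t
      unfolding ce using r by (simp add: norm_mult)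
    have hp: "Re (h t) > 0" for t unfolding h_def using r by (intro pos) (simp add: cr)
    then have hnz: "h t \<noteq> 0" and hR: "h t \<notin> \<real>\<^sub>\<le>\<^sub>0" for t
      by (metis less_irrefl zero_complex.sel(1)) (use hp[of t] in \<open>auto simp: complex_nonpos_Reals_iff\<close>)
    have g0: "g0 \<noteq> 0" using g by (simp add: g0_def)
    have cc: "continuous_on UNIV c"
      unfolding c_def cx_circle_at by (intro continuous_intros)
    have ch: "continuous_on UNIV h" unfolding h_def by (intro continuous_intros cc) (simp add: g0)
    have "continuous_on UNIV l"
      unfolding l_def using hR hnz
      by (intro continuous_intros continuous_on_Ln ch) auto
    then have pl: "path l" unfolding path_def by (rule continuous_on_subset) simp
    have eq: "\<phi> (circle_at z r t) / of_real (cmod (\<phi> (circle_at z r t))) = (exp \<circ> l) t" for t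
    proof -
      have e1: "exp (2 * of_real pi * \<i> * of_nat n * of_real t) = exp (2 * of_real pi * \<i> * of_real t) ^ n"
        by (simp add: exp_of_nat_mult[symmetric] mult_ac)
      have "exp (l t) = exp (2 * of_real pi * \<i> * of_real t) ^ n * (h t / of_real (cmod (h t))) * (g0 / of_real (cmod g0))"
        unfolding l_def exp_add exp_diff e1 using hnz[of t] g0 by (simp add: exp_of_real)
      also have "\<dots> = exp (2 * of_real pi * \<i> * of_real t) ^ n * (poly g (c t) / of_real (cmod (poly g (c t))))"
        unfolding h_def using g0 by (simp add: norm_divide field_simps)
      also have "\<dots> = \<phi> (circle_at z r t) / of_real (cmod (\<phi> (circle_at z r t)))"
        unfolding \<phi> c_def[symmetric] ce using r \<rho>[of "circle_at z r t"]
        by (simp add: norm_mult norm_power power_mult_distrib)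
      finally show ?thesis by simp
    qed
    \<comment> \<open>The circle closes up, so the logarithm of h returns to its initial value and
      only the linear term contributes.\<close>
    have "c 1 = c 0" unfolding c_def cx_circle_at by simp
    then have "pathfinish l - pathstart l = 2 * of_real pi * \<i> * of_nat n"
      by (simp add: pathfinish_def pathstart_def l_def h_def)
    then show "winding_number (\<lambda>t. \<phi> (circle_at z r t) / of_real (cmod (\<phi> (circle_at z r t)))) 0 = of_nat n"
      unfolding ext[of _ "exp \<circ> l", OF eq] winding_number_compose_exp[OF pl] by simp
  qed
qed

theorem theorem2:
  fixes m :: nat and z :: "nat \<Rightarrow> real^2" and n :: "nat \<Rightarrow> nat" and q \<kappa> :: real
  assumes "m \<ge> 1"
    and "inj_on z {1..m}"
    and "\<And>j. j \<in> {1..m} \<Longrightarrow> n j > 0"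
    and "q > 0" and "\<kappa> > 0"
  shows "\<exists>(\<phi> :: real^2 \<Rightarrow> complex) (A0 :: real^2 \<Rightarrow> real) (A1 :: real^2 \<Rightarrow> real)
            (A2 :: real^2 \<Rightarrow> real) (N :: real^2 \<Rightarrow> real).
           smooth \<phi> \<and> smooth A0 \<and> smooth A1 \<and> smooth A2 \<and> smooth N \<and>
           bogomolnyi q \<kappa> \<phi> A0 A1 A2 N \<and>
           topological \<phi> A0 N \<and>
           (\<forall>j\<in>{1..m}. vanishes_with_winding \<phi> (z j) (n j)) \<and>
           (\<forall>x. 0 \<le> \<kappa> / q * N x \<and>
                \<kappa> / q * N x = - (\<kappa> / q) * A0 x \<and>
                - (\<kappa> / q) * A0 x \<le> 1 - (cmod (\<phi> x))\<^sup>2)"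
proof -
  define p where "p = (\<Prod>j\<in>{1..m}. [:- cx (z j), 1:] ^ n j)"
  have p0: "p \<noteq> 0" unfolding p_def by simp
  have "poly p (cx (z 1)) = 0"
    unfolding p_def poly_prod using assms(1) assms(3)[of 1] by (intro prod_zero bexI[of _ 1]) auto
  then have deg: "degree p > 0" using p0 by (metis degree_eq_zeroE gr0I pCons_0_0 poly_pCons poly_0 mult_zero_right add.right_neutral)
  \<comment> \<open>The constant of \<open>T_bound\<close>: a is selected only after q and \<kappa>
    have fixed how small |p'|^2/D has to be.\<close>
  define e where "e = q\<^sup>2 * min (1/3) (q\<^sup>2 / (\<kappa>\<^sup>2 + 2 * q\<^sup>2)) / 32"
  have "\<kappa>\<^sup>2 + 2 * q\<^sup>2 > 0" using assms by (simp add: add_pos_nonneg)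
  then have e: "e > 0" using assms by (simp add: e_def)
  obtain a where ab: "a > 0" "\<And>\<zeta>. (cmod (poly (pderiv p) \<zeta>))\<^sup>2 \<le> e * sqrt (a + ((cmod (poly p \<zeta>))\<^sup>2)\<^sup>2)"
    using poly_deriv_bound[OF deg e] by blast
  interpret vortex p a by unfold_locales (rule deg, rule ab)
  interpret vortex_system p a q \<kappa>
    by unfold_locales (use assms ab(2) in \<open>auto simp: T_def P'_def D_def S_def P_def e_def\<close>)
  obtain w A where s: "CBi w" "CBi A" "\<And>x. 0 \<le> w x" "has_lap w (\<lambda>x. F1 x (w x) (A x))" "has_lap A (\<lambda>x. F2 x (w x) (A x))"
    using solution_exists by metis
  note h = s(1,4,2,5)
  have "vanishes_with_winding (phi w) (z j) (n j)" if j: "j \<in> {1..m}" for j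
  proof -
    \<comment> \<open>The cofactor of the zero at z j; distinctness of the points makes it nonzero
      there.\<close>
    define g where "g = (\<Prod>i\<in>{1..m} - {j}. [:- cx (z i), 1:] ^ n i)"
    have p: "p = [:- cx (z j), 1:] ^ n j * g" unfolding p_def g_def using j by (intro prod.remove) auto
    have pp: "poly p \<zeta> = (\<zeta> - cx (z j)) ^ n j * poly g \<zeta>" for \<zeta> unfolding p by (simp add: poly_power)
    show ?thesis
    proof (rule vanishes_with_winding_poly)
      show "phi w x = (cx x - cx (z j)) ^ n j * poly g (cx x) * of_real (exp ((w x - K x) / 2))" for x
        unfolding phi_def[OF h] P_def pp ..
      have "cx (z j) \<noteq> cx (z i)" if "i \<in> {1..m} - {j}" for i
      proof
        assume "cx (z j) = cx (z i)"
        then have "z j = z i" by (simp add: cx_def vec_eq_iff forall_2)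
        then show False using assms(2) j that by (auto dest: inj_onD)
      qed
      then show "poly g (cx (z j)) \<noteq> 0" unfolding g_def poly_prod poly_power by auto
    qed (use assms(3)[OF j] in auto)
  qed
  then show ?thesis
    using smooth_solution[OF h] bogomolnyi_solution[OF h] topological_solution[OF h s(3)] solution_bounds[OF h]
    by blast
qed

end
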